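(* Let $A=\mathrm{diag}(a_1,a_2,a_3)$ be a real diagonal matrix with pairwise distinct diagonal entries, let $\infty_i=(1:a_i:0)\in\mathbb{CP}^2$, and let $C\subset\mathbb{CP}^2$ be a smooth real cubic curve passing through $\infty_1,\infty_2,\infty_3$. Assume that the real part of $C$ has two ovals. Then there exist a real number $T>0$ and a diagonal matrix $M\in\mathbb P\mathrm D(3,\mathbb R)$ such that for every solution $X(t)$ of $\frac{d}{dt}X=[X^2,A]$ lying in $\mathcal T_C=\{X\in\mathfrak{gl}(3,\mathbb R):C_X=C\}$ and existing for all times $t\in\mathbb R$, the following statements hold. 1. The dynamics of the hexagon $H_{X(t)}$ is periodic with period $T$. 2. The dynamics of the matrix $X$ is quasi-periodic: $X(t+T)=MX(t)M^{-1}$ for all $t$. Furthermore, $M\in\mathbb P\mathrm D^+(3,\mathbb R)$ if $H_X$ has type $(6,0)$, and $M\notin\mathbb P\mathrm D^+(3,\mathbb R)$ if $H_X$ has type $(2,4)$.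
   Context: $\mathfrak{gl}(3,\mathbb R)$ is the space of real $3\times3$ matrices. $\mathbb P\mathrm D(3,\mathbb R)$ is the quotient of the group of invertible real diagonal $3\times3$ matrices by the nonzero scalar matrices; it acts on $\mathfrak{gl}(3,\mathbb R)$ by conjugation. $\mathbb P\mathrm D^+(3,\mathbb R)$ is its identity component, consisting of the cosets of diagonal matrices whose diagonal entries all have the same sign. For $z=(z_1,z_2,z_3)$ put $X_z=z_3X+z_1A-z_2\,\mathrm{Id}$. The spectral curve of $X=(x_{ij})$ is $C_X=\{(z_1:z_2:z_3)\in\mathbb{CP}^2 : \det X_z=0\}$; it is conserved along solutions of $\frac{d}{dt}X=[X^2,A]$. A curve is real if it is defined by a real homogeneous polynomial; its real part is its intersection with $\mathbb{RP}^2$, and for a smooth curve the connected components of the real part are called ovals. A smooth real cubic has one or two ovals; if there are two, exactly one of them is contractible in $\mathbb{RP}^2$. Hexagon $H_X$ (for $C_X$ smooth): let $M_{ij}$ be the $(i,j)$ minor of $X_z$ (delete row $i$ and column $j$). For $i\ne j$ one has $M_{ij}=z_3L_{ij}$, where $L_{ij}$ is a linear form in $z_1,z_2,z_3$; explicitly, up to sign, $L_{ij}=x_{ki}x_{jk}z_3-x_{ji}(x_{kk}z_3+a_kz_1-z_2)$ for $\{i,j,k\}=\{1,2,3\}$. When $C_X$ is smooth, $L_{ij}\not\equiv0$. Let $l_{ij}$ be the projective line $L_{ij}=0$. For every permutation $(i,j,k)$ of $(1,2,3)$ put $P_i=l_{ij}\cap l_{ik}$ and $Q_i=l_{ji}\cap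 l_{ki}$; these are well-defined points lying in the real part of $C_X$. $H_X$ is the hexagon with (labelled) vertices $P_1,Q_2,P_3,Q_1,P_2,Q_3$. $H_X$ has type $(m,n)$ if $m$ of its six vertices (counted as labelled vertices) lie on the contractible oval of $C_X$ and $n$ of them lie on the non-contractible oval. The type is constant along a solution. *)

theory Defs
  imports "HOL-Analysis.Analysis" "HOL-Algebra.Coset"
begin

text \<open>
  The coordinates \<open>z\<^sub>1, z\<^sub>2, z\<^sub>3\<close> are \<open>z $ 1, z $ 2, z $ 3\<close>.  In the index type \<open>3\<close>, numerals are
  taken modulo 3, so \<open>3 = 0\<close> and \<open>1 + 2 + 3 = 0\<close>.
\<close>

section \<open>The projective plane\<close>

definition proj_rel :: "('a::field)^3 \<Rightarrow> 'a^3 \<Rightarrow> bool" where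
  "proj_rel u v \<longleftrightarrow> u \<noteq> 0 \<and> v \<noteq> 0 \<and> (\<exists>c. c \<noteq> 0 \<and> v = c *s u)"

lemma part_equivp_proj_rel: "part_equivp (proj_rel :: ('a::field)^3 \<Rightarrow> 'a^3 \<Rightarrow> bool)"
proof (rule part_equivpI)
  have "(axis 1 1 :: 'a^3) \<noteq> 0"
    by (simp add: axis_eq_0_iff)
  then show "\<exists>x. proj_rel x (x :: 'a^3)"
    unfolding proj_rel_def by (metis vector_smult_lid zero_neq_one)
  show "symp (proj_rel :: 'a^3 \<Rightarrow> 'a^3 \<Rightarrow> bool)"
  proof (rule sympI)
    fix u v :: "'a^3"
    assume "proj_rel u v"
    then obtain c where c: "u \<noteq> 0" "v \<noteq> 0" "c \<noteq> 0" "v = c *s u"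
      unfolding proj_rel_def by blast
    then have "u = inverse c *s v" by simp
    then show "proj_rel v u"
      unfolding proj_rel_def using c by (metis inverse_nonzero_iff_nonzero)
  qed
  show "transp (proj_rel :: 'a^3 \<Rightarrow> 'a^3 \<Rightarrow> bool)"
  proof (rule transpI)
    fix u v w :: "'a^3"
    assume "proj_rel u v" "proj_rel v w"
    then obtain c d where cd: "u \<noteq> 0" "w \<noteq> 0" "c \<noteq> 0" "v = c *s u" "d \<noteq> 0" "w = d *s v"
      unfolding proj_rel_def by blast
    then have "w = (d * c) *s u" "d * c \<noteq> 0" by (simp_all add: vector_smult_assoc)
    then show "proj_rel u w"
      unfolding proj_rel_def using cd by blast
  qed
qed

quotient_type (overloaded) 'a proj2 = "('a::field)^3" / partial: proj_rel
  by (rule part_equivp_proj_rel)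

text \<open>\<open>point z\<close> is \<open>(z\<^sub>1:z\<^sub>2:z\<^sub>3)\<close>; it is meaningful only for \<open>z \<noteq> 0\<close>.\<close>

definition point :: "('a::field)^3 \<Rightarrow> 'a proj2" where
  "point z = abs_proj2 z"

lemma point_eq_iff:
  assumes "u \<noteq> 0" "v \<noteq> 0"
  shows "point u = point v \<longleftrightarrow> (\<exists>c. c \<noteq> 0 \<and> v = c *s u)"
proof -
  have refl: "proj_rel w w" if "w \<noteq> 0" for w :: "'a^3"
    unfolding proj_rel_def using that by (metis vector_smult_lid zero_neq_one)
  have "point u = point v \<longleftrightarrow> proj_rel u v"
    unfolding point_def using Quotient3_rel[OF Quotient3_proj2, of u v] refl assms by blast
  then show ?thesis using assms by (simp add: proj_rel_def)
qed

lemma point_cases: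
  obtains z where "z \<noteq> 0" "p = point z"
proof -
  obtain z where "proj_rel z z" "abs_proj2 z = p"
    using Quotient_rep_abs_eq[OF Quotient_proj2] Quotient3_abs_rep[OF Quotient3_proj2]
      Quotient3_rep_reflp[OF Quotient3_proj2] by metis
  then show thesis using that unfolding point_def proj_rel_def by blast
qed

text \<open>The quotient topology.\<close>

instantiation proj2 :: (real_normed_field) topological_space
begin

definition open_proj2 :: "'a proj2 set \<Rightarrow> bool" where
  "open_proj2 U \<longleftrightarrow> open {z. z \<noteq> 0 \<and> point z \<in> U}"

instance
proof
  have "{z::'a^3. z \<noteq> 0 \<and> point z \<in> UNIV} = - {0}" by auto
  then show "open (UNIV :: 'a proj2 set)"
    unfolding open_proj2_def by (metis closed_singleton open_Compl)
next
  fix S T :: "'a proj2 set"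
  assume "open S" "open T"
  moreover have "{z::'a^3. z \<noteq> 0 \<and> point z \<in> S \<inter> T} =
      {z. z \<noteq> 0 \<and> point z \<in> S} \<inter> {z. z \<noteq> 0 \<and> point z \<in> T}" by auto
  ultimately show "open (S \<inter> T)"
    unfolding open_proj2_def by (simp add: open_Int)
next
  fix K :: "'a proj2 set set"
  assume "\<forall>S\<in>K. open S"
  moreover have "{z::'a^3. z \<noteq> 0 \<and> point z \<in> \<Union>K} =
      (\<Union>S\<in>K. {z. z \<noteq> 0 \<and> point z \<in> S})" by auto
  ultimately show "open (\<Union>K)"
    unfolding open_proj2_def by auto
qed

end

lift_definition complexify :: "real proj2 \<Rightarrow> complex proj2" is "\<lambda>z. \<chi> i. complex_of_real (z $ i)"
proof -
  fix u v :: "real^3"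
  assume "proj_rel u v"
  then obtain c where c: "u \<noteq> 0" "v \<noteq> 0" "c \<noteq> 0" "v = c *s u"
    unfolding proj_rel_def by blast
  have "(\<chi> i. complex_of_real (v $ i)) = complex_of_real c *s (\<chi> i. complex_of_real (u $ i))"
    using c by (simp add: vec_eq_iff)
  moreover have "(\<chi> i. complex_of_real (u $ i)) \<noteq> 0" "(\<chi> i. complex_of_real (v $ i)) \<noteq> 0"
    using c(1,2) by (simp_all add: vec_eq_iff)
  ultimately show "proj_rel (\<chi> i. complex_of_real (u $ i)) (\<chi> i. complex_of_real (v $ i))"
    unfolding proj_rel_def using c(3) by (metis of_real_eq_0_iff)
qed

section \<open>Real cubics and ovals\<close>

text \<open>A multi-index \<open>e\<close> of total degree 3 stands for the monomial \<open>\<Prod>\<^sub>i z\<^sub>i ^ e\<^sub>i\<close>.\<close>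

definition cubic_form :: "((3 \<Rightarrow> nat) \<Rightarrow> real) \<Rightarrow> complex^3 \<Rightarrow> complex" where
  "cubic_form c z =
     (\<Sum>e | (\<Sum>i\<in>UNIV. e i) = 3. complex_of_real (c e) * (\<Prod>i\<in>UNIV. z $ i ^ e i))"

lemma finite_exponents: "finite {e :: 3 \<Rightarrow> nat. (\<Sum>i\<in>UNIV. e i) = 3}"
proof (rule finite_subset)
  show "{e :: 3 \<Rightarrow> nat. (\<Sum>i\<in>UNIV. e i) = 3} \<subseteq> Pi\<^sub>E UNIV (\<lambda>_. {..3})"
  proof
    fix e :: "3 \<Rightarrow> nat"
    assume "e \<in> {e. (\<Sum>i\<in>UNIV. e i) = 3}"
    then have "e i \<le> 3" for i
      using member_le_sum[of i UNIV e] by simp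
    then show "e \<in> Pi\<^sub>E UNIV (\<lambda>_. {..3})" by (simp add: PiE_UNIV_domain)
  qed
qed (simp add: finite_PiE)

definition partial_deriv :: "3 \<Rightarrow> (complex^3 \<Rightarrow> complex) \<Rightarrow> complex^3 \<Rightarrow> complex" where
  "partial_deriv i F z = deriv (\<lambda>w. F (\<chi> j. if j = i then w else z $ j)) (z $ i)"

definition smooth_real_cubic :: "complex proj2 set \<Rightarrow> bool" where
  "smooth_real_cubic C \<longleftrightarrow> (\<exists>c.
     C = {point z |z. z \<noteq> 0 \<and> cubic_form c z = 0} \<and>
     (\<forall>z. z \<noteq> 0 \<longrightarrow> cubic_form c z = 0 \<longrightarrow> (\<exists>i. partial_deriv i (cubic_form c) z \<noteq> 0)))"

definition real_part :: "complex proj2 set \<Rightarrow> real proj2 set" where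
  "real_part C = {p. complexify p \<in> C}"

definition ovals :: "complex proj2 set \<Rightarrow> real proj2 set set" where
  "ovals C = components (real_part C)"

definition contractible_in_RP2 :: "real proj2 set \<Rightarrow> bool" where
  "contractible_in_RP2 S \<longleftrightarrow> (\<exists>p. homotopic_with_canon (\<lambda>_. True) S UNIV id (\<lambda>_. p))"

section \<open>The spectral curve\<close>

definition diag :: "('a::zero)^3 \<Rightarrow> 'a^3^3" where
  "diag d = (\<chi> i j. if i = j then d $ i else 0)"

text \<open>\<open>X\<^sub>z = z\<^sub>3 X + z\<^sub>1 A - z\<^sub>2 Id\<close>\<close>

definition pencil :: "('a::comm_ring_1)^3^3 \<Rightarrow> 'a^3^3 \<Rightarrow> 'a^3 \<Rightarrow> 'a^3^3" where
  "pencil A X z = (\<chi> i j. z $ 3 * X $ i $ j + z $ 1 * A $ i $ j - z $ 2 * mat 1 $ i $ j)"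

definition spectral_curve :: "real^3^3 \<Rightarrow> real^3^3 \<Rightarrow> complex proj2 set" where
  "spectral_curve A X =
     {point z |z. z \<noteq> 0 \<and>
        det (pencil (map_matrix complex_of_real A) (map_matrix complex_of_real X) z) = 0}"

definition isospectral :: "real^3^3 \<Rightarrow> complex proj2 set \<Rightarrow> (real^3^3) set" where
  "isospectral A C = {X. spectral_curve A X = C}"

definition flow_solution :: "real^3^3 \<Rightarrow> (real \<Rightarrow> real^3^3) \<Rightarrow> bool" where
  "flow_solution A X \<longleftrightarrow>
     (\<forall>t. (X has_vector_derivative ((X t ** X t) ** A - A ** (X t ** X t))) (at t))"

section \<open>The hexagon\<close>

text \<open>
  For \<open>i \<noteq> j\<close> the third index \<open>k\<close> is \<open>- (i + j)\<close>.
\<close>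

definition L_form :: "real^3^3 \<Rightarrow> real^3^3 \<Rightarrow> 3 \<Rightarrow> 3 \<Rightarrow> real^3 \<Rightarrow> real" where
  "L_form A X i j z = (let k = - (i + j) in
     X $ k $ i * X $ j $ k * z $ 3 - X $ j $ i * (X $ k $ k * z $ 3 + A $ k $ k * z $ 1 - z $ 2))"

lemma third_index:
  assumes "i \<noteq> j"
  shows "{i, j, - (i + j)} = (UNIV :: 3 set)"
proof -
  have neg: "- (1 + 2) = (3::3)" "- (2 + 1) = (3::3)" "- (1 + 3) = (2::3)" "- (3 + 1) = (2::3)"
    "- (2 + 3) = (1::3)" "- (3 + 2) = (1::3)"
    by simp_all
  consider "i = 1" "j = 2" | "i = 2" "j = 1" | "i = 1" "j = 3" | "i = 3" "j = 1"
    | "i = 2" "j = 3" | "i = 3" "j = 2"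
    using assms exhaust_3[of i] exhaust_3[of j] by blast
  then show ?thesis
    by cases (simp_all only: neg UNIV_3, blast+)
qed

text \<open>
  Replacing row \<open>i\<close> of \<open>X\<^sub>z\<close> by the \<open>j\<close>-th unit row turns its determinant into the cofactor
  \<open>(-1)\<^sup>i\<^sup>+\<^sup>j M\<^sub>i\<^sub>j\<close>, so the following is \<open>M\<^sub>i\<^sub>j = \<plusminus> z\<^sub>3 L\<^sub>i\<^sub>j\<close>.
\<close>

lemma cofactor_eq_L_form:
  assumes "i \<noteq> j"
  shows "det (\<chi> r c. if r = i then (if c = j then 1 else 0) else pencil (diag a) X z $ r $ c)
         = z $ 3 * L_form (diag a) X i j z"
proof -
  have neg: "- (1 + 2) = (3::3)" "- (2 + 1) = (3::3)" "- (1 + 3) = (2::3)" "- (3 + 1) = (2::3)"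
    "- (2 + 3) = (1::3)" "- (3 + 2) = (1::3)"
    by simp_all
  have dist: "(1::3) \<noteq> 2" "(2::3) \<noteq> 1" "(1::3) \<noteq> 3" "(3::3) \<noteq> 1" "(2::3) \<noteq> 3" "(3::3) \<noteq> 2"
    by simp_all
  consider "i = 1" "j = 2" | "i = 2" "j = 1" | "i = 1" "j = 3" | "i = 3" "j = 1"
    | "i = 2" "j = 3" | "i = 3" "j = 2"
    using assms exhaust_3[of i] exhaust_3[of j] by blast
  then show ?thesis
    by cases (simp_all only: L_form_def Let_def neg det_3 pencil_def diag_def mat_def vec_lambda_beta
        dist if_True if_False refl mult_zero_left mult_zero_right mult_1_left mult_1_right
        add_0_left add_0_right diff_0_right, simp_all add: algebra_simps)
qed

text \<open>
  The forms \<open>L\<^sub>i\<^sub>j\<close> are real, so the lines and their intersection points are taken in the real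
  projective plane.
\<close>

definition L_line :: "real^3^3 \<Rightarrow> real^3^3 \<Rightarrow> 3 \<Rightarrow> 3 \<Rightarrow> real proj2 set" where
  "L_line A X i j = {point z |z. z \<noteq> 0 \<and> L_form A X i j z = 0}"

definition P_vertex :: "real^3^3 \<Rightarrow> real^3^3 \<Rightarrow> 3 \<Rightarrow> real proj2" where
  "P_vertex A X i = (THE p. \<forall>j. j \<noteq> i \<longrightarrow> p \<in> L_line A X i j)"

definition Q_vertex :: "real^3^3 \<Rightarrow> real^3^3 \<Rightarrow> 3 \<Rightarrow> real proj2" where
  "Q_vertex A X i = (THE p. \<forall>j. j \<noteq> i \<longrightarrow> p \<in> L_line A X j i)"

definition hexagon :: "real^3^3 \<Rightarrow> real^3^3 \<Rightarrow> real proj2 list" where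
  "hexagon A X =
     [P_vertex A X 1, Q_vertex A X 2, P_vertex A X 3,
      Q_vertex A X 1, P_vertex A X 2, Q_vertex A X 3]"

definition hexagon_type :: "real^3^3 \<Rightarrow> real^3^3 \<Rightarrow> nat \<times> nat" where
  "hexagon_type A X = (let Ov = ovals (spectral_curve A X) in
     (length (filter (\<lambda>p. \<exists>S\<in>Ov. contractible_in_RP2 S \<and> p \<in> S) (hexagon A X)),
      length (filter (\<lambda>p. \<exists>S\<in>Ov. \<not> contractible_in_RP2 S \<and> p \<in> S) (hexagon A X))))"

section \<open>The projective diagonal group\<close>

definition D3 :: "(real^3^3) monoid" where
  "D3 = \<lparr>carrier = {diag d |d. \<forall>i. d $ i \<noteq> 0}, mult = (**), one = mat 1\<rparr>"

definition scalars3 :: "(real^3^3) set" where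
  "scalars3 = {mat c |c. c \<noteq> 0}"

definition PD3 :: "(real^3^3) set monoid" where
  "PD3 = D3 Mod scalars3"

definition PD3_plus :: "(real^3^3) set set" where
  "PD3_plus = {scalars3 #>\<^bsub>D3\<^esub> diag d |d. (\<forall>i. d $ i > 0) \<or> (\<forall>i. d $ i < 0)}"

definition PD3_act :: "(real^3^3) set \<Rightarrow> real^3^3 \<Rightarrow> real^3^3" where
  "PD3_act M X = (THE Y. \<exists>m\<in>M. Y = m ** X ** matrix_inv m)"

lemma diag_mult: "diag d ** diag e = diag (\<chi> i. d $ i * (e $ i :: real))"
  by (simp add: matrix_matrix_mult_def diag_def vec_eq_iff forall_3 sum_3)

lemma mat_eq_diag: "mat (c::real) = diag (\<chi> i. c)"
  by (simp add: mat_def diag_def vec_eq_iff)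

lemma matrix_inv_diag:
  assumes "\<forall>i. d $ i \<noteq> (0::real)"
  shows "matrix_inv (diag d) = diag (\<chi> i. inverse (d $ i))"
proof -
  let ?e = "diag (\<chi> i. inverse (d $ i))"
  have l: "?e ** diag d = mat 1" and r: "diag d ** ?e = mat 1"
    using assms by (simp_all add: diag_mult mat_eq_diag)
  then have "matrix_inv (diag d) ** diag d = mat 1"
    unfolding matrix_inv_def by (metis (mono_tags, lifting) someI_ex)
  then have "?e = (matrix_inv (diag d) ** diag d) ** ?e" by simp
  also have "\<dots> = matrix_inv (diag d)" by (simp add: r flip: matrix_mul_assoc)
  finally show ?thesis by simp
qed

lemma D3_simps: "x \<otimes>\<^bsub>D3\<^esub> y = x ** y" "\<one>\<^bsub>D3\<^esub> = mat 1"
  by (simp_all add: D3_def)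

lemma diag_in_D3 [intro]: "\<forall>i. d $ i \<noteq> 0 \<Longrightarrow> diag d \<in> carrier D3"
  by (auto simp: D3_def)

lemma in_D3E:
  assumes "x \<in> carrier D3"
  obtains d where "x = diag d" "\<forall>i. d $ i \<noteq> 0"
  using assms by (auto simp: D3_def)

lemma comm_group_D3: "comm_group D3"
proof (rule comm_groupI)
  fix x y assume "x \<in> carrier D3" "y \<in> carrier D3"
  then obtain d e where de: "x = diag d" "y = diag e" "\<forall>i. d $ i \<noteq> 0" "\<forall>i. e $ i \<noteq> 0"
    unfolding D3_def by auto
  show "x \<otimes>\<^bsub>D3\<^esub> y \<in> carrier D3"
    unfolding D3_simps de(1,2) diag_mult by (rule diag_in_D3) (simp add: de)
  show "x \<otimes>\<^bsub>D3\<^esub> y = y \<otimes>\<^bsub>D3\<^esub> x"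
    unfolding D3_simps de(1,2) diag_mult by (simp add: mult.commute)
next
  show "\<one>\<^bsub>D3\<^esub> \<in> carrier D3"
    unfolding D3_simps mat_eq_diag by (rule diag_in_D3) simp
next
  fix x assume "x \<in> carrier D3"
  then obtain d where d: "x = diag d" "\<forall>i. d $ i \<noteq> 0" by (rule in_D3E)
  then have "diag (\<chi> i. inverse (d $ i)) \<otimes>\<^bsub>D3\<^esub> x = \<one>\<^bsub>D3\<^esub>"
    by (simp add: D3_simps diag_mult mat_eq_diag)
  moreover have "diag (\<chi> i. inverse (d $ i)) \<in> carrier D3"
    by (rule diag_in_D3) (simp add: d)
  ultimately show "\<exists>y\<in>carrier D3. y \<otimes>\<^bsub>D3\<^esub> x = \<one>\<^bsub>D3\<^esub>" by blast
qed (simp_all add: D3_simps matrix_mul_assoc)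

lemma normal_scalars3: "scalars3 \<lhd> D3"
proof -
  interpret D: comm_group D3 by (rule comm_group_D3)
  have mat_in: "mat c \<in> carrier D3" if "c \<noteq> 0" for c
    unfolding mat_eq_diag using that by (intro diag_in_D3) simp
  have mat_mult: "mat c \<otimes>\<^bsub>D3\<^esub> mat d = mat (c * d)" for c d
    by (simp add: D3_simps mat_eq_diag diag_mult)
  have "subgroup scalars3 D3"
  proof (rule D.subgroupI)
    show "scalars3 \<subseteq> carrier D3"
      unfolding scalars3_def using mat_in by blast
    show "scalars3 \<noteq> {}"
      using scalars3_def zero_neq_one[where 'a = real] by (metis (mono_tags, lifting) empty_iff mem_Collect_eq)
  next
    fix a assume "a \<in> scalars3"
    then obtain c where c: "a = mat c" "c \<noteq> 0" unfolding scalars3_def by blast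
    have "inv\<^bsub>D3\<^esub> (mat c) = mat (inverse c)"
      by (rule D.inv_equality) (use c in \<open>simp_all add: mat_in mat_mult, simp add: D3_simps\<close>)
    then show "inv\<^bsub>D3\<^esub> a \<in> scalars3"
      using c nonzero_imp_inverse_nonzero unfolding scalars3_def by blast
  next
    fix a b assume "a \<in> scalars3" "b \<in> scalars3"
    then obtain c d where "a = mat c" "c \<noteq> 0" "b = mat d" "d \<noteq> 0"
      unfolding scalars3_def by blast
    then show "a \<otimes>\<^bsub>D3\<^esub> b \<in> scalars3"
      unfolding scalars3_def using mat_mult[of c d] no_zero_divisors by blast
  qed
  then show ?thesis by (rule D.subgroup_imp_normal)
qed

lemma diag_conj:
  "(diag d ** X ** diag e) $ i $ j = d $ i * X $ i $ j * (e $ j :: real)"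
proof -
  have l: "(diag d ** X) $ i $ k = d $ i * X $ i $ k" for k
    using exhaust_3[of i]
    by (auto simp: matrix_matrix_mult_def diag_def sum_3)
  have "(Y ** diag e) $ i $ j = Y $ i $ j * e $ j" for Y
    using exhaust_3[of j]
    by (auto simp: matrix_matrix_mult_def diag_def sum_3)
  then show ?thesis by (simp add: l)
qed

text \<open>The action does not depend on the representative.\<close>

lemma PD3_act_coset:
  assumes d: "\<forall>i. d $ i \<noteq> 0"
  shows "PD3_act (scalars3 #>\<^bsub>D3\<^esub> diag d) X = diag d ** X ** matrix_inv (diag d)"
proof -
  have *: "m ** X ** matrix_inv m = diag d ** X ** matrix_inv (diag d)"
    if "m \<in> scalars3 #>\<^bsub>D3\<^esub> diag d" for m
  proof -
    from that obtain c where c: "c \<noteq> 0" "m = mat c ** diag d"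
      unfolding r_coset_def scalars3_def D3_simps by blast
    have m: "m = diag (\<chi> i. c * d $ i)"
      by (simp add: c(2) mat_eq_diag diag_mult)
    show ?thesis
      unfolding m using d c(1)
      by (simp add: matrix_inv_diag vec_eq_iff diag_conj)
  qed
  have "mat 1 \<in> scalars3"
    unfolding scalars3_def by (rule CollectI, rule exI[of _ 1]) simp
  then have "mat 1 \<otimes>\<^bsub>D3\<^esub> diag d \<in> scalars3 #>\<^bsub>D3\<^esub> diag d"
    unfolding r_coset_def by blast
  then have "diag d \<in> scalars3 #>\<^bsub>D3\<^esub> diag d"
    by (simp add: D3_simps)
  then show ?thesis
    unfolding PD3_act_def using * by (intro the_equality) metis+
qed

end

theory Submission
  imports Defs "HOL-Real_Asymp.Real_Asymp"
begin

text \<open>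
  Fixing the spectral curve fixes the diagonal of \<open>X\<close> and restricts the products
  \<open>p\<^sub>k = x\<^sub>i\<^sub>j x\<^sub>j\<^sub>i\<close> to a line with parameter \<open>s\<close>.  The two cyclic products \<open>q = x\<^sub>1\<^sub>2 x\<^sub>2\<^sub>3 x\<^sub>3\<^sub>1\<close> and
  \<open>r = x\<^sub>1\<^sub>3 x\<^sub>3\<^sub>2 x\<^sub>2\<^sub>1\<close> have a sum that is affine in \<open>s\<close> and the product \<open>p\<^sub>1 p\<^sub>2 p\<^sub>3\<close>.  The flow makes
  \<open>s' = q - r\<close>, hence \<open>s'\<^sup>2 = (q + r)\<^sup>2 - 4 p\<^sub>1 p\<^sub>2 p\<^sub>3\<close>, a cubic in \<open>s\<close> which has no double root because the
  curve is smooth.  A global solution of this Newton equation oscillates in the unique bounded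
  potential well, so all global solutions are time translates of each other.  Since \<open>(s, s')\<close>
  determines \<open>X\<close> up to conjugation by a diagonal matrix, this gives \<open>T\<close> and \<open>M = diag e\<close>.

  The vertex \<open>P\<^sub>i\<close> has an explicit lift to \<open>\<real>\<^sup>3\<close> that is multiplied by \<open>e\<^sub>j e\<^sub>k / e\<^sub>i\<^sup>2\<close> after a period.  If
  \<open>e\<^sub>j\<close> and \<open>e\<^sub>k\<close> have different signs, the orbit of \<open>P\<^sub>i\<close> reverses orientation in the projective plane, so the
  type is not \<open>(6, 0)\<close>.  If all \<open>e\<^sub>i\<close> have the same sign, no \<open>x\<^sub>i\<^sub>j\<close> has a zero, since its zeros are simple and
  would occur once per period; then the part of the curve over the well stays in a bounded part of the
  affine chart \<open>z\<^sub>3 \<noteq> 0\<close>, all vertices lie on contractible ovals, and the type is not \<open>(2, 4)\<close>.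
\<close>

section \<open>Newton's equation with a cubic potential\<close>

text \<open>No existence theorem for the flow is invoked. If some global solution \<open>X0\<close>
  on the curve exists, its oscillation supplies \<open>T\<close> and its change over one period
  supplies \<open>e\<close>. Every other solution is a diagonal conjugate of a translate of
  \<open>X0\<close>, and diagonal conjugations commute, so the same \<open>e\<close> serves all of
  them. Smoothness of the curve acts twice. It excludes double roots of the potential, so velocities
  have simple zeros and no motion creeps towards an equilibrium. It also excludes two vanishing
  off-diagonal entries in one row or column, since both cyclic products and two of the pair products
  would then vanish at a double root. This keeps the conjugation and the vertices well defined when
  single entries vanish. Outside the well, a motion in the unbounded region where the potential is
  nonnegative obeys s' ~ |s|^(3/2) and blows up in finite time, so no global solution lives there.
  Potential and ovals are tied together by reading \<open>s\<close> as a function on the curve: a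
  real point with z3 nonzero gets the value of \<open>s\<close> at which a chosen principal 2x2
  minor of the pencil vanishes there.\<close>

lemma ode_unique_forward:
  fixes f g :: "real \<Rightarrow> 'a::real_inner"
  assumes f: "\<And>t. (f has_vector_derivative V (f t)) (at t)"
    and g: "\<And>t. (g has_vector_derivative V (g t)) (at t)"
    and lip: "\<And>B. \<exists>K. \<forall>x y. norm x \<le> B \<longrightarrow> norm y \<le> B \<longrightarrow> norm (V x - V y) \<le> K * norm (x - y)"
    and init: "f t0 = g t0" and le: "t0 \<le> t"
  shows "f t = g t"
proof -
  have contf: "continuous_on {t0..t} f" and contg: "continuous_on {t0..t} g"
    using has_vector_derivative_continuous[OF f] has_vector_derivative_continuous[OF g]
    by (simp_all add: continuous_at_imp_continuous_on)
  have "bounded (f ` {t0..t})" "bounded (g ` {t0..t})"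
    using contf contg by (simp_all add: compact_continuous_image compact_imp_bounded)
  then obtain Bf Bg where "\<And>u. u \<in> {t0..t} \<Longrightarrow> norm (f u) \<le> Bf" "\<And>u. u \<in> {t0..t} \<Longrightarrow> norm (g u) \<le> Bg"
    unfolding bounded_iff by (metis image_eqI)
  then have B: "norm (f u) \<le> max Bf Bg" "norm (g u) \<le> max Bf Bg" if "u \<in> {t0..t}" for u
    using that by (meson max.coboundedI1 max.coboundedI2)+
  obtain K where K: "norm (V (f u) - V (g u)) \<le> K * norm (f u - g u)" if "u \<in> {t0..t}" for u
    using lip[of "max Bf Bg"] B by meson
  \<comment> \<open>Gronwall: \<open>K\<close> is a Lipschitz constant on a ball containing both
    trajectories over the compact interval, so the weight absorbs the growth of the squared
    distance, which starts at 0.\<close>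
  let ?e = "\<lambda>u. exp (- 2 * K * u) * ((f u - g u) \<bullet> (f u - g u))"
  have "?e t \<le> ?e t0"
  proof (rule DERIV_nonpos_imp_nonincreasing[OF le])
    fix u assume u: "t0 \<le> u" "u \<le> t"
    have d: "((\<lambda>u. f u - g u) has_vector_derivative (V (f u) - V (g u))) (at u)"
      by (intro derivative_intros f g)
    have i: "((\<lambda>u. (f u - g u) \<bullet> (f u - g u)) has_real_derivative
        2 * ((f u - g u) \<bullet> (V (f u) - V (g u)))) (at u)"
      unfolding has_field_derivative_def
      by (rule has_derivative_eq_rhs, rule has_derivative_inner)
        (use d in \<open>auto simp: has_vector_derivative_def inner_commute algebra_simps fun_eq_iff\<close>)
    have "(?e has_real_derivative exp (- 2 * K * u) * (2 * ((f u - g u) \<bullet> (V (f u) - V (g u))))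
        + exp (- 2 * K * u) * (- 2 * K) * ((f u - g u) \<bullet> (f u - g u))) (at u)"
      by (rule derivative_eq_intros i refl | simp)+
    moreover have "(f u - g u) \<bullet> (V (f u) - V (g u)) \<le> K * ((f u - g u) \<bullet> (f u - g u))"
    proof -
      have "(f u - g u) \<bullet> (V (f u) - V (g u)) \<le> norm (f u - g u) * norm (V (f u) - V (g u))"
        by (rule norm_cauchy_schwarz)
      also have "\<dots> \<le> norm (f u - g u) * (K * norm (f u - g u))"
        using K u by (intro mult_left_mono) auto
      finally show ?thesis by (simp add: dot_square_norm power2_eq_square mult.left_commute)
    qed
    then have "exp (- 2 * K * u) * (2 * ((f u - g u) \<bullet> (V (f u) - V (g u))))
        + exp (- 2 * K * u) * (- 2 * K) * ((f u - g u) \<bullet> (f u - g u)) \<le> 0"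
    proof -
      assume "(f u - g u) \<bullet> (V (f u) - V (g u)) \<le> K * ((f u - g u) \<bullet> (f u - g u))"
      then have "exp (- 2 * K * u) * (2 * ((f u - g u) \<bullet> (V (f u) - V (g u)) - K * ((f u - g u) \<bullet> (f u - g u)))) \<le> 0"
        by (intro mult_nonneg_nonpos) auto
      then show ?thesis by (simp add: algebra_simps)
    qed
    ultimately show "\<exists>y. (?e has_real_derivative y) (at u) \<and> y \<le> 0" by blast
  qed
  then have "(f t - g t) \<bullet> (f t - g t) \<le> 0"
    using init by (simp add: mult_le_0_iff)
  then have "f t - g t = 0" by (metis inner_gt_zero_iff not_less)
  then show ?thesis by simp
qed

lemma ode_unique:
  fixes f g :: "real \<Rightarrow> 'a::real_inner"
  assumes f: "\<And>t. (f has_vector_derivative V (f t)) (at t)"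
    and g: "\<And>t. (g has_vector_derivative V (g t)) (at t)"
    and lip: "\<And>B. \<exists>K. \<forall>x y. norm x \<le> B \<longrightarrow> norm y \<le> B \<longrightarrow> norm (V x - V y) \<le> K * norm (x - y)"
    and init: "f t0 = g t0"
  shows "f t = g t"
proof (cases "t0 \<le> t")
  case True
  then show ?thesis using ode_unique_forward[OF f g lip init] by blast
next
  case False
  have neg: "((\<lambda>t. h (- t)) has_vector_derivative - V (h (- t))) (at t)"
    if "\<And>t. (h has_vector_derivative V (h t)) (at t)" for h :: "real \<Rightarrow> 'a" and t
  proof -
    have "(h has_vector_derivative V (h (- t))) (at (- t))" by (rule that)
    moreover have "(uminus has_vector_derivative (- 1 :: real)) (at t)"
      by (auto intro!: derivative_eq_intros)
    ultimately have "(h \<circ> uminus has_vector_derivative (- 1) *\<^sub>R V (h (- t))) (at t)"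
      by (intro vector_diff_chain_at) auto
    then show ?thesis by (simp add: comp_def)
  qed
  have "f (- (- t)) = g (- (- t))"
    by (rule ode_unique_forward[of "\<lambda>t. f (- t)" "\<lambda>x. - V x" "\<lambda>t. g (- t)" "- t0" "- t"])
      (use neg[OF f] neg[OF g] lip init False in \<open>auto simp: norm_minus_commute\<close>)
  then show ?thesis by simp
qed

lemma bounded_deriv_limit_nonpos:
  fixes f f' :: "real \<Rightarrow> real"
  assumes der: "\<And>t. t \<ge> t0 \<Longrightarrow> (f has_real_derivative f' t) (at t)"
    and lim: "(f' \<longlongrightarrow> c) at_top" and bd: "\<And>t. t \<ge> t0 \<Longrightarrow> \<bar>f t\<bar> \<le> B"
  shows "c \<le> 0"
proof (rule ccontr)
  assume "\<not> c \<le> 0"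
  then have c: "c > 0" by simp
  then have "\<forall>\<^sub>F t in at_top. f' t > c / 2"
    using order_tendstoD(1)[OF lim, of "c/2"] by simp
  then obtain t1 where t1: "\<And>t. t \<ge> t1 \<Longrightarrow> f' t > c / 2"
    unfolding eventually_at_top_linorder by blast
  define u where "u = max t0 t1"
  \<comment> \<open>On [u, w] the slope exceeds c/2, so \<open>f\<close> gains at least 2(|B| + 1),
    more than the band [-B, B] allows.\<close>
  define w where "w = u + 4 * (\<bar>B\<bar> + 1) / c"
  have uw: "u \<le> w" using c by (simp add: w_def)
  have "f u - c / 2 * u \<le> f w - c / 2 * w"
  proof (rule DERIV_nonneg_imp_nondecreasing[OF uw])
    fix x assume "u \<le> x" "x \<le> w"
    then have "((\<lambda>x. f x - c / 2 * x) has_real_derivative f' x - c / 2) (at x)" "f' x - c / 2 \<ge> 0"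
      using t1[of x] der[of x] unfolding u_def by (auto intro!: derivative_eq_intros)
    then show "\<exists>y. ((\<lambda>x. f x - c / 2 * x) has_real_derivative y) (at x) \<and> 0 \<le> y" by blast
  qed
  moreover have "c / 2 * w = c / 2 * u + 2 * (\<bar>B\<bar> + 1)"
    using c by (simp add: w_def field_simps)
  moreover have "f w \<le> B" "- B \<le> f u" "B \<le> \<bar>B\<bar>"
    using bd[of u] bd[of w] uw unfolding u_def by (auto simp: abs_le_iff)
  ultimately have "f u + 2 * (\<bar>B\<bar> + 1) \<le> f w" by simp
  then show False using \<open>f w \<le> B\<close> \<open>- B \<le> f u\<close> \<open>B \<le> \<bar>B\<bar>\<close> by argo
qed

lemma bounded_deriv_limit_zero:
  fixes f f' :: "real \<Rightarrow> real"
  assumes der: "\<And>t. t \<ge> t0 \<Longrightarrow> (f has_real_derivative f' t) (at t)"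
    and lim: "(f' \<longlongrightarrow> c) at_top" and bd: "\<And>t. t \<ge> t0 \<Longrightarrow> \<bar>f t\<bar> \<le> B"
  shows "c = 0"
proof -
  have "- c \<le> 0"
    by (rule bounded_deriv_limit_nonpos[of t0 "\<lambda>t. - f t" "\<lambda>t. - f' t" _ B])
      (auto intro!: derivative_eq_intros tendsto_minus der lim bd)
  moreover have "c \<le> 0" by (rule bounded_deriv_limit_nonpos[OF der lim bd])
  ultimately show ?thesis by simp
qed

definition cubic_pot :: "real \<Rightarrow> real \<Rightarrow> real \<Rightarrow> real \<Rightarrow> real \<Rightarrow> real" where
  "cubic_pot g0 g1 g2 g3 x = g0 + g1 * x + g2 * x^2 + g3 * x^3"

text \<open>Half the derivative of the potential, so that \<open>y\<^sup>2 = cubic_pot s\<close> and \<open>s' = y\<close> give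
  \<open>y' = cubic_force s\<close>.\<close>

definition cubic_force :: "real \<Rightarrow> real \<Rightarrow> real \<Rightarrow> real \<Rightarrow> real" where
  "cubic_force g1 g2 g3 x = (g1 + 2 * g2 * x + 3 * g3 * x^2) / 2"

text \<open>If \<open>s\<close> stays bounded it converges to some \<open>L\<close>; then
  \<open>y\<close> and its derivative both tend to 0, which makes \<open>L\<close> a double root. If
  \<open>s\<close> is unbounded, either the potential becomes negative (g3 < 0) or the motion blows
  up in finite time.\<close>

lemma no_increasing_escape:
  assumes g3: "g3 \<noteq> 0"
    and nd: "\<And>x. cubic_pot g0 g1 g2 g3 x = 0 \<Longrightarrow> cubic_force g1 g2 g3 x \<noteq> 0"
    and s: "\<And>t. t \<ge> t0 \<Longrightarrow> (s has_real_derivative y t) (at t)"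
    and y: "\<And>t. t \<ge> t0 \<Longrightarrow> (y has_real_derivative cubic_force g1 g2 g3 (s t)) (at t)"
    and en: "\<And>t. t \<ge> t0 \<Longrightarrow> (y t)^2 = cubic_pot g0 g1 g2 g3 (s t)"
    and pos: "\<And>t. t \<ge> t0 \<Longrightarrow> y t > 0"
  shows False
proof -
  let ?G = "cubic_pot g0 g1 g2 g3" and ?H = "cubic_force g1 g2 g3"
  have mono: "s u \<le> s v" if "t0 \<le> u" "u \<le> v" for u v
  proof (rule DERIV_nonneg_imp_nondecreasing[OF that(2)])
    fix t assume "u \<le> t" "t \<le> v"
    then show "\<exists>z. (s has_real_derivative z) (at t) \<and> 0 \<le> z"
      using s[of t] pos[of t] that(1) by (intro exI[of _ "y t"]) simp
  qed
  show False
  proof (cases "\<exists>B. \<forall>t\<ge>t0. s t \<le> B")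
    case True
    then obtain B where B: "\<And>t. t \<ge> t0 \<Longrightarrow> s t \<le> B" by blast
    define L where "L = (SUP t\<in>{t0..}. s t)"
    have bdd: "bdd_above (s ` {t0..})" using B by (auto intro!: bdd_aboveI2)
    have L: "s t \<le> L" if "t \<ge> t0" for t
      unfolding L_def using that bdd by (intro cSUP_upper) auto
    have lim: "(s \<longlongrightarrow> L) at_top"
    proof (rule increasing_tendsto)
      show "\<forall>\<^sub>F t in at_top. s t \<le> L"
        using L unfolding eventually_at_top_linorder by blast
      fix x assume "x < L"
      then obtain u where u: "u \<ge> t0" "x < s u"
        unfolding L_def using bdd by (subst (asm) less_cSUP_iff) auto
      then have "x < s t" if "t \<ge> u" for t using mono[of u t] that by simp
      then show "\<forall>\<^sub>F t in at_top. x < s t"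
        unfolding eventually_at_top_linorder by blast
    qed
    have limG: "((\<lambda>t. ?G (s t)) \<longlongrightarrow> ?G L) at_top" and limH: "((\<lambda>t. ?H (s t)) \<longlongrightarrow> ?H L) at_top"
      unfolding cubic_pot_def cubic_force_def by (intro tendsto_intros lim; simp)+
    have ysqrt: "y t = sqrt (?G (s t))" if "t \<ge> t0" for t
      using en[OF that] pos[OF that] by (simp add: real_sqrt_unique)
    have limy: "(y \<longlongrightarrow> sqrt (?G L)) at_top"
    proof (rule Lim_transform_eventually)
      show "((\<lambda>t. sqrt (?G (s t))) \<longlongrightarrow> sqrt (?G L)) at_top"
        by (intro tendsto_real_sqrt limG)
      show "\<forall>\<^sub>F t in at_top. sqrt (?G (s t)) = y t"
        unfolding eventually_at_top_linorder using ysqrt by metis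
    qed
    have "\<bar>s t\<bar> \<le> \<bar>L\<bar> + \<bar>s t0\<bar>" if "t \<ge> t0" for t
      using L[OF that] mono[of t0 t] that by simp
    then have G0: "sqrt (?G L) = 0"
      using bounded_deriv_limit_zero[OF s limy] by blast
    then have "\<forall>\<^sub>F t in at_top. y t < 1" using limy order_tendstoD(2)[OF limy, of 1] by simp
    then obtain t1 where t1: "\<And>t. t \<ge> t1 \<Longrightarrow> y t < 1" unfolding eventually_at_top_linorder by blast
    \<comment> \<open>The same principle one derivative higher: \<open>y\<close> is eventually
      bounded and its derivative tends to \<open>?H L\<close>.\<close>
    have "?H L = 0"
    proof (rule bounded_deriv_limit_zero[of "max t0 t1" y "\<lambda>t. ?H (s t)" _ 1])
      fix t assume "max t0 t1 \<le> t"
      then show "(y has_real_derivative ?H (s t)) (at t)" "\<bar>y t\<bar> \<le> 1"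
        using y t1[of t] pos[of t] by auto
    qed (rule limH)
    then show False using nd G0 by simp
  next
    case False
    then have unb: "\<exists>t\<ge>t0. s t > B" for B by (meson not_le)
    have lim: "((\<lambda>x. ?G x / x^3) \<longlongrightarrow> g3) at_top"
      unfolding cubic_pot_def by real_asymp
    show False
    proof (cases "g3 > 0")
      case False
      then have "\<forall>\<^sub>F x in at_top. ?G x / x^3 < 0"
        using g3 order_tendstoD(2)[OF lim, of 0] by simp
      then obtain x1 where x1: "\<And>x. x \<ge> x1 \<Longrightarrow> ?G x / x^3 < 0"
        unfolding eventually_at_top_linorder by blast
      obtain t where t: "t \<ge> t0" "s t > max x1 0" using unb by blast
      then have "?G (s t) / s t ^ 3 < 0" "s t ^ 3 > 0" using x1[of "s t"] by auto
      then have "?G (s t) < 0" by (simp add: divide_less_0_iff)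
      then show False using en[OF t(1)] by (metis not_less zero_le_power2)
    next
      case True
      define k where "k = sqrt (g3 / 2)"
      have k: "k > 0" "k^2 = g3 / 2" using True by (simp_all add: k_def)
      have "\<forall>\<^sub>F x in at_top. ?G x / x^3 > g3 / 2"
        using True order_tendstoD(1)[OF lim, of "g3/2"] by simp
      then obtain x1 where x1: "\<And>x. x \<ge> x1 \<Longrightarrow> ?G x / x^3 > g3 / 2"
        unfolding eventually_at_top_linorder by blast
      obtain t1 where t1: "t1 \<ge> t0" "s t1 > max x1 0" using unb by blast
      \<comment> \<open>As \<open>y\<close> is at least k s^(3/2), the function s^(-1/2) falls at a
        rate of at least k/2; at time \<open>w\<close> below it would have to be 0 already.\<close>
      define h where "h t = inverse (sqrt (s t))" for t
      have sp: "s t > 0" "s t \<ge> x1" if "t \<ge> t1" for t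
        using mono[of t1 t] t1 that by auto
      have der: "(h has_real_derivative - (y t / (2 * s t * sqrt (s t)))) (at t)"
        and bd: "y t / (2 * s t * sqrt (s t)) \<ge> k / 2" if t: "t \<ge> t1" for t
      proof -
        show "(h has_real_derivative - (y t / (2 * s t * sqrt (s t)))) (at t)"
          unfolding h_def
          by (rule derivative_eq_intros s refl | use sp[OF t] t t1 in \<open>simp add: field_simps power2_eq_square\<close>)+
        have e: "(y t)^2 = ?G (s t)" and yp: "0 < y t" using en[of t] pos[of t] t t1(1) by auto
        have "k^2 * s t ^ 3 \<le> ?G (s t)"
          using x1[OF sp(2)[OF t]] sp(1)[OF t] unfolding k(2) by (simp add: field_simps)
        moreover have "k^2 * s t ^ 3 = (k * s t * sqrt (s t))^2"
          using sp(1)[OF t] by (simp add: power_mult_distrib power3_eq_cube power2_eq_square)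
        ultimately have "(k * s t * sqrt (s t))^2 \<le> (y t)^2"
          unfolding e by metis
        then have "k * s t * sqrt (s t) \<le> y t"
          by (rule power2_le_imp_le) (use yp in simp)
        then show "y t / (2 * s t * sqrt (s t)) \<ge> k / 2"
          using sp(1)[OF t] by (simp add: field_simps)
      qed
      define w where "w = t1 + 2 * h t1 / k"
      have h: "h t > 0" if "t \<ge> t1" for t using sp(1)[OF that] by (simp add: h_def)
      have w: "t1 \<le> w" using h[of t1] k by (simp add: w_def)
      have "h w + k / 2 * w \<le> h t1 + k / 2 * t1"
      proof (rule DERIV_nonpos_imp_nonincreasing[OF w])
        fix t assume t: "t1 \<le> t" "t \<le> w"
        have "((\<lambda>t. h t + k / 2 * t) has_real_derivative - (y t / (2 * s t * sqrt (s t))) + k / 2) (at t)"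
          by (auto intro!: derivative_eq_intros der t)
        then show "\<exists>z. ((\<lambda>t. h t + k / 2 * t) has_real_derivative z) (at t) \<and> z \<le> 0"
          using bd[OF t(1)] by force
      qed
      moreover have "k / 2 * w = k / 2 * t1 + h t1" using k by (simp add: w_def field_simps)
      ultimately show False using h[OF w] by simp
    qed
  qed
qed

lemma cubic_pot_DERIV:
  "(cubic_pot g0 g1 g2 g3 has_real_derivative 2 * cubic_force g1 g2 g3 x) (at x)"
  unfolding cubic_pot_def[abs_def] cubic_force_def
  by (auto intro!: derivative_eq_intros simp: field_simps)

text \<open>The substitution of -s for s stays within the cubic potentials, which reduces decreasing
  motions to increasing ones.\<close>

lemma cubic_pot_minus: "cubic_pot g0 (- g1) g2 (- g3) (- x) = cubic_pot g0 g1 g2 g3 x"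
  by (simp add: cubic_pot_def)

lemma cubic_force_minus: "cubic_force (- g1) g2 (- g3) (- x) = - cubic_force g1 g2 g3 x"
  by (simp add: cubic_force_def field_simps)

section \<open>Motion in a cubic potential without double roots\<close>

locale cubic_osc =
  fixes g0 g1 g2 g3 :: real
  assumes g3: "g3 \<noteq> 0"
    and nondeg: "\<And>x. cubic_pot g0 g1 g2 g3 x = 0 \<Longrightarrow> cubic_force g1 g2 g3 x \<noteq> 0"
begin

abbreviation G where "G \<equiv> cubic_pot g0 g1 g2 g3"
abbreviation H where "H \<equiv> cubic_force g1 g2 g3"

text \<open>The energy law alone does not determine the motion at a turning point, where a solution
  could also rest. The force equation is locally Lipschitz in (s, y) and restores
  uniqueness.\<close>

definition sol :: "(real \<Rightarrow> real) \<Rightarrow> (real \<Rightarrow> real) \<Rightarrow> bool" where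
  "sol s y \<longleftrightarrow> (\<forall>t. (s has_real_derivative y t) (at t) \<and>
     (y has_real_derivative H (s t)) (at t) \<and> (y t)^2 = G (s t))"

lemma solD:
  assumes "sol s y"
  shows "(s has_real_derivative y t) (at t)" "(y has_real_derivative H (s t)) (at t)"
    "(y t)^2 = G (s t)" "isCont s t" "isCont y t"
  using assms unfolding sol_def by (auto intro: DERIV_isCont)

lemma sol_shift: "sol s y \<Longrightarrow> sol (\<lambda>t. s (\<tau> + t)) (\<lambda>t. y (\<tau> + t))"
  unfolding sol_def by (simp flip: DERIV_shift add: add.commute)

lemma sol_reflect: "sol s y \<Longrightarrow> sol (\<lambda>t. s (\<tau> - t)) (\<lambda>t. - y (\<tau> - t))"
  unfolding sol_def
proof (intro allI conjI)
  fix t assume *: "\<forall>t. (s has_real_derivative y t) (at t) \<and>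
     (y has_real_derivative H (s t)) (at t) \<and> (y t)^2 = G (s t)"
  have d: "((\<lambda>t. \<tau> - t) has_real_derivative - 1) (at t)" by (auto intro!: derivative_eq_intros)
  show "((\<lambda>t. s (\<tau> - t)) has_real_derivative - y (\<tau> - t)) (at t)"
    using DERIV_chain2[OF _ d, of s "y (\<tau> - t)"] * by simp
  show "((\<lambda>t. - y (\<tau> - t)) has_real_derivative H (s (\<tau> - t))) (at t)"
    using DERIV_minus[OF DERIV_chain2[OF _ d, of y "H (s (\<tau> - t))"]] * by simp
  show "(- y (\<tau> - t))^2 = G (s (\<tau> - t))" using * by simp
qed

lemma sol_unique:
  assumes s: "sol s y" and s': "sol s' y'" and init: "s t0 = s' t0" "y t0 = y' t0"
  shows "s t = s' t" "y t = y' t"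
proof -
  let ?V = "\<lambda>p::real \<times> real. (snd p, H (fst p))"
  have lip: "\<exists>K. \<forall>p q. norm p \<le> B \<longrightarrow> norm q \<le> B \<longrightarrow> norm (?V p - ?V q) \<le> K * norm (p - q)" for B
  proof (intro exI allI impI)
    fix p q :: "real \<times> real" assume pq: "norm p \<le> B" "norm q \<le> B"
    have "H (fst p) - H (fst q) = (fst p - fst q) * (g2 + 3/2 * g3 * (fst p + fst q))"
      by (simp add: cubic_force_def field_simps power2_eq_square)
    moreover have "\<bar>g2 + 3/2 * g3 * (fst p + fst q)\<bar> \<le> \<bar>g2\<bar> + 3 * \<bar>g3\<bar> * B"
    proof -
      have "\<bar>fst p + fst q\<bar> \<le> 2 * B"
        using norm_fst_le[of "fst p" "snd p"] norm_fst_le[of "fst q" "snd q"] pq by simp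
      then have "\<bar>3/2 * g3\<bar> * \<bar>fst p + fst q\<bar> \<le> \<bar>3/2 * g3\<bar> * (2 * B)"
        by (rule mult_left_mono) simp
      then have "\<bar>3/2 * g3 * (fst p + fst q)\<bar> \<le> 3 * \<bar>g3\<bar> * B" by (simp add: abs_mult)
      then show ?thesis using abs_triangle_ineq[of g2 "3/2 * g3 * (fst p + fst q)"]
        by (rule order_trans[rotated, OF add_left_mono])
    qed
    ultimately have "\<bar>H (fst p) - H (fst q)\<bar> \<le> \<bar>fst p - fst q\<bar> * (\<bar>g2\<bar> + 3 * \<bar>g3\<bar> * B)"
      by (simp add: abs_mult mult_left_mono)
    also have "\<dots> \<le> norm (p - q) * (\<bar>g2\<bar> + 3 * \<bar>g3\<bar> * B)"
    proof (rule mult_right_mono)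
      show "\<bar>fst p - fst q\<bar> \<le> norm (p - q)"
        using norm_fst_le[of "fst (p - q)" "snd (p - q)"] unfolding prod.collapse by simp
      have "0 \<le> B" using pq(1) norm_ge_zero order_trans by blast
      then show "0 \<le> \<bar>g2\<bar> + 3 * \<bar>g3\<bar> * B" by simp
    qed
    finally have "\<bar>H (fst p) - H (fst q)\<bar> \<le> norm (p - q) * (\<bar>g2\<bar> + 3 * \<bar>g3\<bar> * B)" .
    moreover have "norm (?V p - ?V q) \<le> \<bar>snd p - snd q\<bar> + \<bar>H (fst p) - H (fst q)\<bar>"
      using norm_Pair_le[of "snd p - snd q" "H (fst p) - H (fst q)"] by simp
    moreover have "\<bar>snd p - snd q\<bar> \<le> norm (p - q)"
      using norm_snd_le[of "snd (p - q)" "fst (p - q)"] unfolding prod.collapse by simp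
    ultimately show "norm (?V p - ?V q) \<le> (1 + (\<bar>g2\<bar> + 3 * \<bar>g3\<bar> * B)) * norm (p - q)"
      by (simp add: algebra_simps)
  qed
  have der: "((\<lambda>t. (s t, y t)) has_vector_derivative ?V (s t, y t)) (at t)" if "sol s y" for s y t
    unfolding fst_conv snd_conv
    using solD(1,2)[OF that, of t] unfolding has_real_derivative_iff_has_vector_derivative
    by (rule has_vector_derivative_Pair)
  have "(s t, y t) = (s' t, y' t)"
    by (rule ode_unique[OF der[OF s] der[OF s'] lip, of t0]) (use init in simp)
  then show "s t = s' t" "y t = y' t" by simp_all
qed

text \<open>Without a zero the velocity would keep its sign, and s or -s would be a motion excluded
  by \<open>no_increasing_escape\<close>.\<close>

lemma sol_zero_ex:
  assumes s: "sol s y"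
  shows "\<exists>t\<ge>t0. y t = 0"
proof (rule ccontr)
  assume "\<not> ?thesis"
  then have nz: "y t \<noteq> 0" if "t \<ge> t0" for t using that by blast
  show False
  proof (cases "y t0 > 0")
    case True
    have "y t > 0" if t: "t \<ge> t0" for t
    proof (rule ccontr)
      assume "\<not> y t > 0"
      then obtain u where "t0 \<le> u" "u \<le> t" "y u = 0"
        using IVT2[of y t 0 t0] t True solD(5)[OF s] by auto
      then show False using nz by blast
    qed
    then show False
      using no_increasing_escape[OF g3 nondeg, where s = s and y = y and ?t0.0 = t0] solD[OF s] by blast
  next
    case False
    then have neg: "y t0 < 0" using nz[of t0] by simp
    have "- y t > 0" if t: "t \<ge> t0" for t
    proof (rule ccontr)
      assume "\<not> - y t > 0"
      then obtain u where "t0 \<le> u" "u \<le> t" "y u = 0"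
        using IVT[of y t0 0 t] t neg solD(5)[OF s] by auto
      then show False using nz by blast
    qed
    moreover have "cubic_force (- g1) g2 (- g3) x \<noteq> 0" if "cubic_pot g0 (- g1) g2 (- g3) x = 0" for x
      using nondeg[of "- x"] cubic_pot_minus[of g0 g1 g2 g3 "- x"] cubic_force_minus[of g1 g2 g3 "- x"] that
      by simp
    ultimately show False
      using no_increasing_escape[of "- g3" g0 "- g1" g2, where s = "\<lambda>t. - s t" and y = "\<lambda>t. - y t" and ?t0.0 = t0] g3 solD[OF s]
      by (auto simp: cubic_pot_minus cubic_force_minus intro!: DERIV_minus)
  qed
qed

text \<open>At a turning point the solution and its time reversal have the same position and the
  same velocity 0.\<close>

lemma sol_reflect_at:
  assumes s: "sol s y" and z: "y t0 = 0"
  shows "s (t0 + u) = s (t0 - u)" "y (t0 + u) = - y (t0 - u)"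
  using sol_unique[OF sol_shift[OF s, of t0] sol_reflect[OF s, of t0], of 0 u] z by simp_all

lemma sol_next_zero:
  assumes s: "sol s y" and z: "y t0 = 0"
  shows "\<exists>t1>t0. y t1 = 0 \<and> (\<forall>t. t0 < t \<longrightarrow> t < t1 \<longrightarrow> y t \<noteq> 0)"
proof -
  have "H (s t0) \<noteq> 0" using nondeg solD(3)[OF s, of t0] z by simp
  then have "\<exists>d>0. \<forall>h>0. h < d \<longrightarrow> y (t0 + h) \<noteq> 0"
    using DERIV_pos_inc_right[OF solD(2)[OF s, of t0]] DERIV_neg_dec_right[OF solD(2)[OF s, of t0]] z
    by (metis less_irrefl linorder_neqE_linordered_idom)
  then obtain d where d: "d > 0" "\<And>h. 0 < h \<Longrightarrow> h < d \<Longrightarrow> y (t0 + h) \<noteq> 0" by blast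
  \<comment> \<open>Zeros of \<open>y\<close> are simple, because \<open>H\<close> is nonzero at the
    roots of \<open>G\<close>. Starting the set at t0 + d/2 keeps \<open>t0\<close> out of it, so
    its infimum is the next zero.\<close>
  define Z where "Z = {t. t0 + d / 2 \<le> t \<and> y t = 0}"
  have "Z \<noteq> {}" using sol_zero_ex[OF s, of "t0 + d/2"] by (auto simp: Z_def)
  moreover have bdd: "bdd_below Z" by (auto simp: Z_def intro!: bdd_belowI)
  moreover have "closed Z"
  proof -
    have "continuous_on UNIV y" using solD(5)[OF s] continuous_at_imp_continuous_on by blast
    then have "closed {t. t0 + d / 2 \<le> t}" "closed {t. y t = 0}"
      by (auto intro!: closed_Collect_le closed_Collect_eq continuous_intros)
    then show ?thesis unfolding Z_def by (simp add: closed_Collect_conj)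
  qed
  ultimately have "Inf Z \<in> Z" by (rule closed_contains_Inf)
  moreover have "y t \<noteq> 0" if "t0 < t" "t < Inf Z" for t
  proof
    assume "y t = 0"
    then have "t < t0 + d / 2" using that cInf_lower[OF _ bdd, of t] by (force simp: Z_def)
    then show False using d(2)[of "t - t0"] that \<open>y t = 0\<close> d(1) by simp
  qed
  ultimately show ?thesis
    using d(1) by (intro exI[of _ "Inf Z"]) (auto simp: Z_def)
qed

lemma sol_rising:
  assumes s: "sol s y"
  shows "\<exists>t0 t1. t0 < t1 \<and> y t0 = 0 \<and> y t1 = 0 \<and> (\<forall>t. t0 < t \<longrightarrow> t < t1 \<longrightarrow> y t > 0)"
proof -
  obtain t0 where t0: "y t0 = 0" using sol_zero_ex[OF s] by blast
  obtain t1 where t1: "t0 < t1" "y t1 = 0" "\<And>t. t0 < t \<Longrightarrow> t < t1 \<Longrightarrow> y t \<noteq> 0"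
    using sol_next_zero[OF s t0] by blast
  have same: "y u > 0" if u: "t0 < u" "u < t1" and v: "t0 < v" "v < t1" "y v > 0" for u v
  proof (rule ccontr)
    assume n: "\<not> y u > 0"
    have "\<exists>w. min u v \<le> w \<and> w \<le> max u v \<and> y w = 0"
    proof (cases "u \<le> v")
      case True
      then show ?thesis using IVT[of y u 0 v] n v solD(5)[OF s] by auto
    next
      case False
      then show ?thesis using IVT2[of y u 0 v] n v solD(5)[OF s] by auto
    qed
    then show False using t1(3) u v by (metis min_less_iff_disj max_less_iff_conj not_less less_le_trans le_less_trans min_def)
  qed
  define m where "m = (t0 + t1) / 2"
  have m: "t0 < m" "m < t1" using t1 by (simp_all add: m_def)
  show ?thesis
  proof (cases "y m > 0")
    case True
    then show ?thesis using same[OF _ _ m] t0 t1 by blast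
  next
    \<comment> \<open>The motion is falling up to \<open>t1\<close>; reflection at \<open>t1\<close>
      yields a rising interval of the same length right after it.\<close>
    case False
    then have "y m < 0" using t1(3)[OF m] by simp
    have neg: "y u < 0" if u: "t0 < u" "u < t1" for u
      using same[OF m u] t1(3)[OF u] False by argo
    have "y t > 0" if "t1 < t" "t < t1 + (t1 - t0)" for t
      using sol_reflect_at(2)[OF s t1(2), of "t - t1"] neg[of "2 * t1 - t"] that by simp
    moreover have "y (t1 + (t1 - t0)) = 0"
      using sol_reflect_at(2)[OF s t1(2), of "t1 - t0"] t0 by simp
    ultimately show ?thesis using t1 by (intro exI[of _ t1] exI[of _ "t1 + (t1 - t0)"]) auto
  qed
qed

text \<open>Both ends are simple roots, and positivity inside the well decides the sign of the
  derivative there.\<close>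

lemma neg_outside_well:
  assumes "lo < hi" "G lo = 0" "G hi = 0" and pos: "\<And>x. lo < x \<Longrightarrow> x < hi \<Longrightarrow> G x > 0"
  shows "\<exists>e>0. \<forall>x. lo - e < x \<and> x < lo \<or> hi < x \<and> x < hi + e \<longrightarrow> G x < 0"
proof -
  have "2 * H lo > 0"
  proof (rule ccontr)
    assume "\<not> ?thesis"
    then have "2 * H lo < 0" using nondeg[OF assms(2)] by simp
    then obtain d where d: "d > 0" "\<And>h. 0 < h \<Longrightarrow> h < d \<Longrightarrow> G (lo + h) < 0"
      using DERIV_neg_dec_right[OF cubic_pot_DERIV[of g0 g1 g2 g3 lo]] assms(2) by metis
    define e where "e = min d (hi - lo) / 2"
    have "0 < e" "e < d" "e < hi - lo" using d(1) assms(1) by (simp_all add: e_def)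
    then show False using d(2)[of e] pos[of "lo + e"] by simp
  qed
  then obtain d where d: "d > 0" "\<And>h. 0 < h \<Longrightarrow> h < d \<Longrightarrow> G (lo - h) < 0"
    using DERIV_pos_inc_left[OF cubic_pot_DERIV[of g0 g1 g2 g3 lo]] assms(2) by metis
  have "2 * H hi < 0"
  proof (rule ccontr)
    assume "\<not> ?thesis"
    then have "2 * H hi > 0" using nondeg[OF assms(3)] by simp
    then obtain d where d: "d > 0" "\<And>h. 0 < h \<Longrightarrow> h < d \<Longrightarrow> G (hi - h) < 0"
      using DERIV_pos_inc_left[OF cubic_pot_DERIV[of g0 g1 g2 g3 hi]] assms(3) by metis
    define e where "e = min d (hi - lo) / 2"
    have "0 < e" "e < d" "e < hi - lo" using d(1) assms(1) by (simp_all add: e_def)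
    then show False using d(2)[of e] pos[of "hi - e"] by simp
  qed
  then obtain d' where d': "d' > 0" "\<And>h. 0 < h \<Longrightarrow> h < d' \<Longrightarrow> G (hi + h) < 0"
    using DERIV_neg_dec_right[OF cubic_pot_DERIV[of g0 g1 g2 g3 hi]] assms(3) by metis
  show ?thesis
  proof (intro exI[of _ "min d d'"] conjI allI impI)
    fix x assume "lo - min d d' < x \<and> x < lo \<or> hi < x \<and> x < hi + min d d'"
    then show "G x < 0" using d(2)[of "lo - x"] d'(2)[of "x - hi"] by auto
  qed (use d d' in auto)
qed

text \<open>The linear factor left after dividing by (x - lo)(x - hi) has no zero on [lo, hi], so
  the third root lies outside. A second well would end at two of the three roots, and every choice
  but (lo, hi) is degenerate or has a nonpositive value inside.\<close>

lemma well_unique: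
  assumes a: "lo < hi" "G lo = 0" "G hi = 0" "\<And>x. lo < x \<Longrightarrow> x < hi \<Longrightarrow> G x > 0"
    and b: "lo' < hi'" "G lo' = 0" "G hi' = 0" "\<And>x. lo' < x \<Longrightarrow> x < hi' \<Longrightarrow> G x > 0"
  shows "lo' = lo \<and> hi' = hi"
proof -
  \<comment> \<open>Constant term of the linear quotient of \<open>G\<close> by (x - lo)(x -
    hi).\<close>
  define k where "k = g2 + g3 * (lo + hi)"
  have "(hi - lo) * (g1 + g2 * (lo + hi) + g3 * (lo^2 + lo * hi + hi^2)) = G hi - G lo"
    by (simp add: cubic_pot_def algebra_simps power2_eq_square power3_eq_cube)
  then have g1: "g1 = - g2 * (lo + hi) - g3 * (lo^2 + lo * hi + hi^2)" using a(1-3) by simp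
  have g0: "g0 = - (g1 * lo + g2 * lo^2 + g3 * lo^3)" using a(2) by (simp add: cubic_pot_def)
  have fac: "G x = (x - lo) * (x - hi) * (g3 * x + k)" for x
    unfolding cubic_pot_def g0 g1 k_def by (simp add: algebra_simps power2_eq_square power3_eq_cube)
  have neg: "g3 * x + k < 0" if "lo < x" "x < hi" for x
  proof -
    have "(x - lo) * (x - hi) < 0" using that by (simp add: mult_pos_neg)
    moreover have "0 < (x - lo) * (x - hi) * (g3 * x + k)" using a(4)[OF that] fac by simp
    ultimately show ?thesis by (metis mult_neg_neg not_less_iff_gr_or_eq zero_less_mult_pos2 mult.commute zero_less_mult_iff)
  qed
  have Hlo: "H lo = (lo - hi) * (g3 * lo + k) / 2" and Hhi: "H hi = (hi - lo) * (g3 * hi + k) / 2"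
    unfolding cubic_force_def g1 k_def by (simp_all add: field_simps power2_eq_square)
  have "g3 * lo + k \<noteq> 0" "g3 * hi + k \<noteq> 0" using nondeg a(2,3) Hlo Hhi by auto
  moreover have "g3 * lo + k \<le> 0 \<and> g3 * hi + k \<le> 0"
  proof (rule ccontr)
    assume "\<not> ?thesis"
    moreover have mid: "(g3 * lo + k) + (g3 * hi + k) < 0" using neg[of "(lo + hi) / 2"] a(1) by (simp add: field_simps)
    ultimately consider "g3 * lo + k > 0" "g3 * hi + k < 0" | "g3 * hi + k > 0" "g3 * lo + k < 0" by argo
    then show False
    proof cases
      case 1
      then obtain x where "lo < x" "x < hi" "g3 * x + k = 0"
        using IVT2[of "\<lambda>x. g3 * x + k" hi 0 lo] a(1) by (force simp: less_le)
      then show False using neg by force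
    next
      case 2
      then obtain x where "lo < x" "x < hi" "g3 * x + k = 0"
        using IVT[of "\<lambda>x. g3 * x + k" lo 0 hi] a(1) by (force simp: less_le)
      then show False using neg by force
    qed
  qed
  ultimately have e: "g3 * lo + k < 0" "g3 * hi + k < 0" by auto
  have in_out: "g3 * x + k \<noteq> 0" if "lo \<le> x" "x \<le> hi" for x
    using that neg[of x] e by (cases "x = lo \<or> x = hi") auto
  have third: "x = lo \<or> x = hi \<or> g3 * x + k = 0" if "G x = 0" for x using that fac by simp
  have not_in: "\<not> (lo' < x \<and> x < hi' \<and> G x \<le> 0)" for x using b(4)[of x] by auto
  define m where "m = (lo' + hi') / 2"
  have m: "lo' < m" "m < hi'" using b(1) by (simp_all add: m_def)
  have mneg: "g3 * m + k < 0" if "g3 * lo' + k \<le> 0" "g3 * hi' + k \<le> 0" "g3 * lo' + k < 0 \<or> g3 * hi' + k < 0"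
  proof -
    have "2 * (g3 * m + k) = (g3 * lo' + k) + (g3 * hi' + k)" by (simp add: m_def field_simps)
    moreover have "\<And>u v w :: real. 2 * u = v + w \<Longrightarrow> v \<le> 0 \<Longrightarrow> w \<le> 0 \<Longrightarrow> v < 0 \<or> w < 0 \<Longrightarrow> u < 0"
      by linarith
    ultimately show ?thesis using that by blast
  qed
  consider "lo' = lo" "hi' = hi" | "lo' = lo" "g3 * hi' + k = 0" | "lo' = hi" "g3 * hi' + k = 0"
    | "g3 * lo' + k = 0" "hi' = lo" | "g3 * lo' + k = 0" "hi' = hi"
    | "g3 * lo' + k = 0" "g3 * hi' + k = 0" | "lo' = hi" "hi' = lo"
    using third[OF b(2)] third[OF b(3)] b(1) by blast
  then show ?thesis
  proof cases
    case 2
    then have "hi' > hi" using in_out[of hi'] b(1) by force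
    then show ?thesis using not_in[of hi] a 2 by auto
  next
    case 3
    then have "g3 * m + k < 0" using mneg e by simp
    then have "G m < 0" unfolding fac using m 3 a(1) by (simp add: mult_pos_neg)
    then show ?thesis using not_in[of m] m by simp
  next
    case 4
    then have "g3 * m + k < 0" using mneg e by simp
    moreover have "0 < (m - lo) * (m - hi)" using m 4 a(1) by (simp add: mult_neg_neg)
    ultimately have "G m < 0" unfolding fac by (rule mult_pos_neg[rotated])
    then show ?thesis using not_in[of m] m by simp
  next
    case 5
    then have "lo' < lo" using in_out[of lo'] b(1) by force
    then show ?thesis using not_in[of lo] a 5 by auto
  next
    case 6
    then have "g3 * (hi' - lo') = 0" unfolding right_diff_distrib by linarith
    then show ?thesis using g3 b(1) by simp
  next
    case 7
    then show ?thesis using a b by simp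
  qed simp
qed

text \<open>The last two clauses say that the closed phase curve over the well is traversed
  completely, and only once per period. They are what allows zeros of matrix entries to be found and
  counted.\<close>

definition osc :: "(real \<Rightarrow> real) \<Rightarrow> (real \<Rightarrow> real) \<Rightarrow> real \<Rightarrow> real \<Rightarrow> real \<Rightarrow> real \<Rightarrow> bool" where
  "osc s y lo hi T t0 \<longleftrightarrow> lo < hi \<and> 0 < T \<and> G lo = 0 \<and> G hi = 0 \<and> (\<forall>x. lo < x \<longrightarrow> x < hi \<longrightarrow> G x > 0) \<and>
     s t0 = lo \<and> y t0 = 0 \<and> (\<forall>t. s (t + T) = s t \<and> y (t + T) = y t) \<and> (\<forall>t. lo \<le> s t \<and> s t \<le> hi) \<and>
     (\<forall>x e. lo \<le> x \<longrightarrow> x \<le> hi \<longrightarrow> e^2 = G x \<longrightarrow> (\<exists>t. s t = x \<and> y t = e)) \<and>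
     (\<forall>t u. 0 < u \<longrightarrow> u < T \<longrightarrow> \<not> (s (t + u) = s t \<and> y (t + u) = y t))"

lemma sol_osc:
  assumes s: "sol s y"
  shows "\<exists>lo hi T t0. osc s y lo hi T t0"
proof -
  obtain t0 t1 where t01: "t0 < t1" and z: "y t0 = 0" "y t1 = 0"
    and pos: "\<And>t. t0 < t \<Longrightarrow> t < t1 \<Longrightarrow> y t > 0" using sol_rising[OF s] by blast
  have mono: "s u < s v" if "t0 \<le> u" "u < v" "v \<le> t1" for u v
  proof (rule DERIV_pos_imp_increasing_open[OF that(2)])
    fix x assume "u < x" "x < v"
    then show "\<exists>z. (s has_real_derivative z) (at x) \<and> 0 < z" using pos[of x] that solD(1)[OF s] by auto
  next
    show "continuous_on {u..v} s"
      using solD(4)[OF s] by (simp add: continuous_at_imp_continuous_on)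
  qed
  define lo hi T where "lo = s t0" and "hi = s t1" and "T = 2 * (t1 - t0)"
  have lohi: "lo < hi" using mono[of t0 t1] t01 by (simp add: lo_def hi_def)
  have G0: "G lo = 0" "G hi = 0" using solD(3)[OF s, of t0] solD(3)[OF s, of t1] z by (simp_all add: lo_def hi_def)
  have cross: "\<exists>t. t0 \<le> t \<and> t \<le> t1 \<and> s t = x" if "lo \<le> x" "x \<le> hi" for x
    using IVT[of s t0 x t1] that t01 solD(4)[OF s] by (auto simp: lo_def hi_def)
  have Gpos: "G x > 0" if x: "lo < x" "x < hi" for x
  proof -
    obtain t where t: "t0 \<le> t" "t \<le> t1" "s t = x" using cross[of x] x by auto
    then have "t0 < t" "t < t1" using x unfolding lo_def hi_def by (auto simp: less_le)
    then show ?thesis using pos[of t] solD(3)[OF s, of t] t(3) by (metis zero_less_power2 less_irrefl)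
  qed
  \<comment> \<open>The reflections at the two turning points compose to the translation by twice
    their distance.\<close>
  have per: "s (t + T) = s t" "y (t + T) = y t" for t
    using sol_reflect_at[OF s z(1), of "t0 - t"] sol_reflect_at[OF s z(2), of "t + t1 - 2 * t0"]
    by (simp_all add: T_def algebra_simps)
  obtain e where e: "e > 0" "\<And>x. lo - e < x \<Longrightarrow> x < lo \<Longrightarrow> G x < 0" "\<And>x. hi < x \<Longrightarrow> x < hi + e \<Longrightarrow> G x < 0"
    using neg_outside_well[OF lohi G0 Gpos] by blast
  have Gs: "G (s t) \<ge> 0" for t using solD(3)[OF s, of t] by (metis zero_le_power2)
  have hit: "\<exists>u. s u = x" if "s v \<le> x" "x \<le> s w" for v w x
  proof (cases "v \<le> w")
    case True
    then show ?thesis using IVT[of s v x w] that solD(4)[OF s] by blast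
  next
    case False
    then show ?thesis using IVT2[of s v x w] that solD(4)[OF s] by auto
  qed
  \<comment> \<open>To leave the well, \<open>s\<close> would have to take a value in the strip just
    outside it, where \<open>G\<close> is negative.\<close>
  have range: "lo \<le> s t" "s t \<le> hi" for t
  proof -
    show "lo \<le> s t"
    proof (rule ccontr)
      assume n: "\<not> ?thesis"
      define x where "x = max (s t) (lo - e/2)"
      have x: "x < lo" "lo - e < x" "s t \<le> x"
        using e(1) n by (simp_all add: x_def less_max_iff_disj)
      obtain u where "s u = x" using hit[of t x t0] x by (auto simp: lo_def)
      then show False using Gs[of u] e(2)[of x] x by simp
    qed
    show "s t \<le> hi"
    proof (rule ccontr)
      assume n: "\<not> ?thesis"
      define x where "x = min (s t) (hi + e/2)"
      have x: "hi < x" "x < hi + e" "x \<le> s t"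
        using e(1) n by (simp_all add: x_def min_less_iff_disj)
      obtain u where "s u = x" using hit[of t1 x t] x by (auto simp: hi_def)
      then show False using Gs[of u] e(3)[of x] x by simp
    qed
  qed
  have onto: "\<exists>t. s t = x \<and> y t = d" if x: "lo \<le> x" "x \<le> hi" and d: "d^2 = G x" for x d
  proof -
    obtain t where t: "s t = x" using cross[OF x] by blast
    then have "d^2 = (y t)^2" using solD(3)[OF s, of t] d by simp
    then have "d = y t \<or> d = - y t" by (simp add: power2_eq_iff)
    moreover have "s (2 * t0 - t) = x" "y (2 * t0 - t) = - y t"
      using sol_reflect_at[OF s z(1), of "t0 - t"] t by (simp_all add: algebra_simps)
    ultimately show ?thesis using t by blast
  qed
  \<comment> \<open>By uniqueness an early return may be moved to \<open>t0\<close>, so the motion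
    would be at \<open>lo\<close> with velocity 0 at t0 + u. But \<open>y\<close> vanishes strictly
    between t0 and t0 + T only at \<open>t1\<close>, where \<open>s\<close> is
    \<open>hi\<close>.\<close>
  have minimal: "\<not> (s (t + u) = s t \<and> y (t + u) = y t)" if u: "0 < u" "u < T" for t u
  proof
    assume "s (t + u) = s t \<and> y (t + u) = y t"
    then have "s (u + t0) = s t0" "y (u + t0) = y t0"
      using sol_unique[OF sol_shift[OF s, of u] s, of t t0] by (simp_all add: add.commute)
    then have st: "s (t0 + u) = lo" "y (t0 + u) = 0" using z by (simp_all add: add.commute lo_def)
    consider "t0 + u < t1" | "t0 + u = t1" | "t1 < t0 + u" by linarith
    then show False
    proof cases
      case 1
      then show False using pos[of "t0 + u"] st u by simp
    next
      case 2
      then show False using st lohi by (simp add: hi_def)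
    next
      case 3
      then show False
        using sol_reflect_at(2)[OF s z(2), of "t0 + u - t1"] pos[of "2 * t1 - t0 - u"] st u
        by (simp add: T_def algebra_simps)
    qed
  qed
  have "osc s y lo hi T t0"
    unfolding osc_def using lohi t01 G0 Gpos per range onto minimal z by (auto simp: lo_def T_def)
  then show ?thesis by blast
qed

text \<open>Both solutions oscillate in the same well; aligning the times at which they rest at its
  left end gives the shift.\<close>

lemma sol_translate:
  assumes s: "sol s y" and o: "osc s y lo hi T t0" and s': "sol s' y'"
  shows "\<exists>\<tau>. \<forall>t. s' t = s (t + \<tau>) \<and> y' t = y (t + \<tau>)"
proof -
  obtain lo' hi' T' t0' where o': "osc s' y' lo' hi' T' t0'" using sol_osc[OF s'] by blast
  have "lo' = lo \<and> hi' = hi"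
    by (rule well_unique) (use o o' in \<open>simp_all add: osc_def\<close>)
  then have "s' t0' = s (t0 - t0' + t0')" "y' t0' = y (t0 - t0' + t0')" using o o' by (simp_all add: osc_def)
  note start = this
  from sol_unique[OF s' sol_shift[OF s, of "t0 - t0'"] start] show ?thesis
    by (intro exI[of _ "t0 - t0'"]) (simp add: add.commute)
qed

end

section \<open>Loops in the real projective plane\<close>

lemma point_scale: "z \<noteq> 0 \<Longrightarrow> c \<noteq> 0 \<Longrightarrow> point (c *s z) = point (z :: 'a::field^3)"
  by (subst eq_commute, subst point_eq_iff) auto

lemma point_eqD:
  assumes "point u = point v" "u \<noteq> 0" "v \<noteq> 0"
  shows "\<exists>c. c \<noteq> 0 \<and> v = c *s u"
  using point_eq_iff[OF assms(2,3)] assms(1) by (rule iffD1)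

lemma open_proj2_iff:
  "open (U :: 'a::real_normed_field proj2 set) \<longleftrightarrow> open {z. z \<noteq> 0 \<and> point z \<in> U}"
  by (simp add: open_proj2_def)

lemma continuous_on_point: "continuous_on (- {0}) (point :: 'a::real_normed_field^3 \<Rightarrow> _)"
proof (subst continuous_on_open_vimage)
  show "\<forall>B. open B \<longrightarrow> open (point -` B \<inter> - {0 :: 'a^3})"
  proof (intro allI impI)
    fix B :: "'a proj2 set" assume "open B"
    moreover have "point -` B \<inter> - {0 :: 'a^3} = {z. z \<noteq> 0 \<and> point z \<in> B}" by auto
    ultimately show "open (point -` B \<inter> - {0 :: 'a^3})" by (simp add: open_proj2_iff)
  qed
qed (simp add: open_Compl)

lemma continuous_on_proj2:
  fixes f :: "'a::real_normed_field proj2 \<Rightarrow> 'b::topological_space"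
  assumes U: "open U" and f: "continuous_on {z. z \<noteq> 0 \<and> point z \<in> U} (\<lambda>z. f (point z))"
  shows "continuous_on U f"
proof (subst continuous_on_open_vimage[OF U], intro allI impI)
  fix B :: "'b set" assume B: "open B"
  have "open ((\<lambda>z. f (point z)) -` B \<inter> {z. z \<noteq> 0 \<and> point z \<in> U})"
    using f B U by (simp add: continuous_on_open_vimage open_proj2_iff)
  moreover have "(\<lambda>z. f (point z)) -` B \<inter> {z. z \<noteq> 0 \<and> point z \<in> U} = {z. z \<noteq> 0 \<and> point z \<in> f -` B \<inter> U}"
    by auto
  ultimately show "open (f -` B \<inter> U)" by (simp add: open_proj2_iff)
qed

text \<open>In the chart z3 = 1 the set shrinks along straight segments to (0:0:1); \<open>c\<close>
  picks the representative with third coordinate 1.\<close>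

lemma contractible_in_RP2_affine:
  assumes S: "\<And>p. p \<in> S \<Longrightarrow> \<exists>z. z $ 3 \<noteq> 0 \<and> p = point z"
  shows "contractible_in_RP2 S"
proof -
  define U :: "real proj2 set" where "U = {point z |z. z $ 3 \<noteq> 0}"
  define c :: "real proj2 \<Rightarrow> real^3" where
    "c p = (let z = (SOME z. z \<noteq> 0 \<and> point z = p) in inverse (z $ 3) *\<^sub>R z)" for p
  have c: "c (point z) = inverse (z $ 3) *\<^sub>R z" if z: "z \<noteq> 0" for z
  proof -
    define w where "w = (SOME w. w \<noteq> 0 \<and> point w = point z)"
    have "\<exists>w. w \<noteq> 0 \<and> point w = point z" using that by (intro exI[of _ z]) simp
    then have w: "w \<noteq> 0 \<and> point w = point z" unfolding w_def by (rule someI_ex)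
    obtain k where "k \<noteq> 0 \<and> z = k *s w" using point_eqD[OF conjunct2[OF w] conjunct1[OF w] z] ..
    then show ?thesis unfolding c_def w_def[symmetric] by (simp add: vec_eq_iff)
  qed
  have U3: "z \<noteq> 0 \<and> point z \<in> U \<longleftrightarrow> z $ 3 \<noteq> 0" for z
  proof
    assume z: "z \<noteq> 0 \<and> point z \<in> U"
    then obtain w where w: "w $ 3 \<noteq> 0" "point z = point w" by (auto simp: U_def)
    then have "w \<noteq> 0" by auto
    then show "z $ 3 \<noteq> 0" using point_eq_iff[of z w] w z by auto
  qed (auto simp: U_def)
  have oU: "open U" unfolding open_proj2_iff U3
    by (intro open_Collect_neq continuous_intros)
  have contc: "continuous_on U c"
  proof (rule continuous_on_proj2[OF oU])
    have "continuous_on {z :: real^3. z $ 3 \<noteq> 0} (\<lambda>z. inverse (z $ 3) *\<^sub>R z)"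
      by (intro continuous_intros) auto
    moreover have "inverse (z $ 3) *\<^sub>R z = c (point z)" if "z \<in> {z. z $ 3 \<noteq> 0}" for z
      using c[of z] that by (metis (mono_tags) mem_Collect_eq zero_index)
    ultimately show "continuous_on {z. z \<noteq> 0 \<and> point z \<in> U} (\<lambda>z. c (point z))"
      unfolding U3 by (rule continuous_on_eq)
  qed
  have SU: "S \<subseteq> U" using S by (auto simp: U_def)
  have c3: "c p $ 3 = 1" "point (c p) = p" if pU: "p \<in> U" for p
  proof -
    obtain z where z: "z $ 3 \<noteq> 0" "p = point z" using pU by (auto simp: U_def)
    then have "z \<noteq> 0" by auto
    then show "c p $ 3 = 1" "point (c p) = p"
      using z point_scale[of z "inverse (z $ 3)"] by (simp_all add: c scalar_mult_eq_scaleR)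
  qed
  define h where "h y = (1 - fst y) *\<^sub>R c (snd y) + fst y *\<^sub>R axis 3 1" for y :: "real \<times> real proj2"
  have h3: "h y $ 3 = 1" if "snd y \<in> U" for y
    using c3(1)[OF that] by (simp add: h_def axis_def)
  then have h0: "h y \<noteq> 0" if "snd y \<in> U" for y using that by (metis zero_index zero_neq_one)
  have "continuous_on ({0..1} \<times> S) h" unfolding h_def
    by (intro continuous_intros continuous_on_compose2[OF contc]) (use SU in auto)
  then have "continuous_on ({0..1} \<times> S) (\<lambda>y. point (h y))"
    by (rule continuous_on_compose2[OF continuous_on_point]) (use h0 SU in auto)
  moreover have "point (h (0, x)) = x" if "x \<in> S" for x
    using that c3(2)[of x] SU by (auto simp: h_def)
  moreover have "point (h (1, x)) = point (axis 3 1)" for x by (simp add: h_def)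
  ultimately have "homotopic_with_canon (\<lambda>_. True) S UNIV id (\<lambda>_. point (axis 3 1))"
    by (subst homotopic_with) (auto intro!: exI[of _ "\<lambda>y. point (h y)"])
  then show ?thesis unfolding contractible_in_RP2_def by blast
qed

section \<open>The double cover of the projective plane by the sphere\<close>

text \<open>The matrix of the orthogonal projection onto the line through \<open>z\<close>. It
  models the projective plane inside a normed space, where paths can be lifted to the
  sphere.\<close>

definition veronese :: "real^3 \<Rightarrow> real^3^3" where
  "veronese z = (\<chi> i j. z $ i * z $ j / (z \<bullet> z))"

lemma veronese_scale: "c \<noteq> 0 \<Longrightarrow> veronese (c *s z) = veronese z"
  by (simp add: veronese_def vec_eq_iff scalar_mult_eq_scaleR)

lemma veronese_mult: "veronese z *v u = (z \<bullet> u / (z \<bullet> z)) *\<^sub>R z"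
  by (simp add: veronese_def vec_eq_iff matrix_vector_mult_def inner_vec_def sum_divide_distrib sum_distrib_left mult_ac)

lemma continuous_on_veronese: "continuous_on (- {0}) veronese"
  unfolding veronese_def by (intro continuous_intros) auto

lemma veronese_eq_imp_inner_nonzero:
  assumes "u \<noteq> 0" "w \<noteq> 0" "veronese u = veronese w"
  shows "u \<bullet> w \<noteq> 0"
proof
  assume "u \<bullet> w = 0"
  then have "veronese w *v u = 0" by (simp add: veronese_mult inner_commute)
  moreover have "veronese u *v u = u" using assms(1) by (simp add: veronese_mult)
  ultimately show False using assms by simp
qed

lemma continuous_on_matrix_vector [continuous_intros]:
  "continuous_on A f \<Longrightarrow> continuous_on A (\<lambda>x. (f x :: real^3^3) *v u)"
  unfolding matrix_vector_mult_def by (intro continuous_intros)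

text \<open>Around the line of \<open>u0\<close>, take all lines not orthogonal to it. The sheets
  are the open hemispheres about \<open>u0\<close> and its antipode; \<open>q e\<close> recovers the
  unit vector from the projection \<open>m\<close> by normalising the image of \<open>u0\<close> and
  attaching the sign \<open>e\<close>.\<close>

lemma covering_space_veronese:
  "covering_space (sphere 0 1) veronese (veronese ` sphere 0 1)"
proof
  show "continuous_on (sphere 0 1) veronese"
    by (rule continuous_on_subset[OF continuous_on_veronese]) auto
next
  fix x assume "x \<in> veronese ` sphere 0 1"
  then obtain u0 where u0: "norm u0 = 1" "x = veronese u0" by auto
  have uu: "u \<bullet> u = 1" if "norm u = 1" for u :: "real^3" using that by (simp add: dot_square_norm)
  define T where "T = veronese ` sphere 0 1 \<inter> {m. u0 \<bullet> (m *v u0) > 0}"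
  have mT: "u0 \<bullet> (veronese u *v u0) = (u \<bullet> u0)^2" if "norm u = 1" for u
    using uu[OF that] by (simp add: veronese_mult power2_eq_square inner_commute)
  define V where "V e = sphere 0 1 \<inter> {u. e * (u \<bullet> u0) > 0}" for e :: real
  define q where "q e m = (e / norm (m *v u0)) *\<^sub>R (m *v u0)" for e :: real and m :: "real^3^3"
  have hom: "homeomorphism (V e) T veronese (q e)" if e: "e = 1 \<or> e = - 1" for e
  proof -
    have qv: "q e (veronese u) = u" if "u \<in> V e" for u
    proof -
      have "norm u = 1" "0 < e * (u \<bullet> u0)" using that by (auto simp: V_def)
      then show ?thesis using uu[of u] e by (auto simp: q_def veronese_mult)
    qed
    have img: "veronese ` V e = T"
    proof
      show "veronese ` V e \<subseteq> T" unfolding V_def T_def using mT by auto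
      show "T \<subseteq> veronese ` V e"
      proof
        fix m assume "m \<in> T"
        then obtain u where u: "norm u = 1" "m = veronese u" "(u \<bullet> u0)^2 > 0"
          using mT unfolding T_def by auto
        have "veronese (- u) = veronese u" using veronese_scale[of "- 1" u] by simp
        moreover have "u \<in> V e \<or> - u \<in> V e" using u e by (auto simp: V_def)
        ultimately show "m \<in> veronese ` V e" using u(2) by (metis imageI)
      qed
    qed
    show ?thesis
    proof (rule homeomorphismI)
      show "continuous_on (V e) veronese"
        by (rule continuous_on_subset[OF continuous_on_veronese]) (auto simp: V_def)
      show "continuous_on T (q e)" unfolding q_def
        by (intro continuous_intros) (auto simp: T_def)
      show "veronese ` V e \<subseteq> T" using img by simp
      show "q e ` T \<subseteq> V e" using qv img by force
      show "q e (veronese u) = u" if "u \<in> V e" for u using qv[OF that] .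
      show "veronese (q e m) = m" if "m \<in> T" for m using qv img that by force
    qed
  qed
  show "\<exists>T. x \<in> T \<and> openin (top_of_set (veronese ` sphere 0 1)) T \<and>
          (\<exists>v. \<Union>v = sphere 0 1 \<inter> veronese -` T \<and> (\<forall>u\<in>v. openin (top_of_set (sphere 0 1)) u) \<and>
             pairwise disjnt v \<and> (\<forall>u\<in>v. \<exists>q. homeomorphism u T veronese q))"
  proof (intro exI[of _ T] conjI exI[of _ "{V 1, V (- 1)}"])
    show "x \<in> T" using u0 mT[OF u0(1)] uu[OF u0(1)] by (auto simp: T_def)
    show "openin (top_of_set (veronese ` sphere 0 1)) T" unfolding T_def
      by (intro openin_open_Int open_Collect_less continuous_intros)
    show "\<Union>{V 1, V (- 1)} = sphere 0 1 \<inter> veronese -` T"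
    proof
      show "\<Union>{V 1, V (- 1)} \<subseteq> sphere 0 1 \<inter> veronese -` T" by (auto simp: V_def T_def mT)
      show "sphere 0 1 \<inter> veronese -` T \<subseteq> \<Union>{V 1, V (- 1)}"
      proof
        fix u assume "u \<in> sphere 0 1 \<inter> veronese -` T"
        then have "norm u = 1" "0 < u0 \<bullet> (veronese u *v u0)" unfolding T_def by auto
        then show "u \<in> \<Union>{V 1, V (- 1)}" using mT[of u] by (auto simp: V_def)
      qed
    qed
    have "openin (top_of_set (sphere 0 1)) (V e)" for e unfolding V_def
      by (intro openin_open_Int open_Collect_less continuous_intros)
    then show "\<forall>u\<in>{V 1, V (- 1)}. openin (top_of_set (sphere 0 1)) u" by blast
    show "pairwise disjnt {V 1, V (- 1)}"
      by (auto simp: pairwise_def disjnt_def V_def)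
    show "\<forall>u\<in>{V 1, V (- 1)}. \<exists>q. homeomorphism u T veronese q" using hom by blast
  qed
qed simp

lemma nonzero_same_sign:
  fixes f :: "real \<Rightarrow> real"
  assumes "a \<le> b" "continuous_on {a..b} f" "\<And>t. t \<in> {a..b} \<Longrightarrow> f t \<noteq> 0"
  shows "f a * f b > 0"
proof (rule ccontr)
  assume n: "\<not> f a * f b > 0"
  have "f a \<noteq> 0" "f b \<noteq> 0" using assms by auto
  then consider "f a < 0" "0 < f b" | "0 < f a" "f b < 0" using n
    by (metis linorder_neqE_linordered_idom mult_neg_neg mult_pos_pos)
  then obtain t where "a \<le> t" "t \<le> b" "f t = 0"
    using IVT'[of f a 0 b] IVT2'[of f b 0 a] assms(1,2) by (metis less_imp_le)
  then show False using assms(3) by auto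
qed

text \<open>Lift a null-homotopy of the loop to the sphere: the sign by which the two ends of the lifted
  loop differ is constant along the homotopy, but it is negative at the start and positive at the end.\<close>

lemma orientation_reversing_not_contractible:
  fixes z :: "real \<Rightarrow> real^3"
  assumes T: "0 \<le> T" and z: "continuous_on {0..T} z" and nz: "\<And>t. t \<in> {0..T} \<Longrightarrow> z t \<noteq> 0"
    and S: "\<And>t. t \<in> {0..T} \<Longrightarrow> point (z t) \<in> S" and zT: "z T = l *s z 0" and l: "l < 0"
  shows "\<not> contractible_in_RP2 S"
proof
  assume "contractible_in_RP2 S"
  then obtain p where "homotopic_with_canon (\<lambda>_. True) S UNIV id (\<lambda>_. p)"
    unfolding contractible_in_RP2_def ..
  then obtain h where "continuous_map (prod_topology (top_of_set {0..1}) (top_of_set S)) (top_of_set UNIV) h \<and>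
      (\<forall>x. h (0 :: real, x) = id x) \<and> (\<forall>x. h (1, x) = p) \<and> (\<forall>t\<in>{0..1 :: real}. True)"
    unfolding homotopic_with_def ..
  then have h: "continuous_on ({0..1} \<times> S) h" and h0: "\<And>x. h (0, x) = x" and h1: "\<And>x. h (1, x) = p"
    by simp_all
  define pv where "pv x = veronese (SOME z. z \<noteq> 0 \<and> point z = x)" for x
  have pv: "pv (point w) = veronese w" if wn: "w \<noteq> 0" for w
  proof -
    define w' where "w' = (SOME w'. w' \<noteq> 0 \<and> point w' = point w)"
    have "\<exists>w'. w' \<noteq> 0 \<and> point w' = point w" using that by (intro exI[of _ w]) simp
    then have w': "w' \<noteq> 0 \<and> point w' = point w" unfolding w'_def by (rule someI_ex)
    obtain k where "k \<noteq> 0 \<and> w = k *s w'" using point_eqD[OF conjunct2[OF w'] conjunct1[OF w'] wn] ..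
    then show ?thesis unfolding pv_def w'_def[symmetric] by (simp add: veronese_scale)
  qed
  have contpv: "continuous_on UNIV pv"
  proof (rule continuous_on_proj2)
    show "continuous_on {z. z \<noteq> 0 \<and> point z \<in> UNIV} (\<lambda>z. pv (point z))"
      by (rule continuous_on_eq[OF continuous_on_subset[OF continuous_on_veronese]]) (auto simp: pv)
  qed simp
  have sph: "veronese w \<in> veronese ` sphere 0 1" if "w \<noteq> 0" for w
    using that veronese_scale[of "inverse (norm w)" w]
    by (intro image_eqI[of _ _ "inverse (norm w) *s w"]) (auto simp: scalar_mult_eq_scaleR)
  define f where "f y = pv (h (fst y, point (z (snd y))))" for y
  let ?U = "{0..1::real} \<times> {0..T}"
  have contzp: "continuous_on {0..T} (\<lambda>t. point (z t))"
    by (rule continuous_on_compose2[OF continuous_on_point z]) (use nz in auto)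
  have contf: "continuous_on ?U f" unfolding f_def
  proof (rule continuous_on_compose2[OF contpv])
    show "continuous_on ?U (\<lambda>y. h (fst y, point (z (snd y))))"
      by (rule continuous_on_compose2[OF h])
        (use S in \<open>auto intro!: continuous_intros continuous_on_compose2[OF contzp]\<close>)
  qed simp
  have cvx: "convex ?U" by (intro convex_Times) simp_all
  have fim: "f \<in> ?U \<rightarrow> veronese ` sphere 0 1"
  proof
    fix y
    obtain w where "w \<noteq> 0" "h (fst y, point (z (snd y))) = point w" using point_cases by blast
    then show "f y \<in> veronese ` sphere 0 1" using pv sph by (simp add: f_def)
  qed
  obtain g where g: "continuous_on ?U g" "g \<in> ?U \<rightarrow> sphere 0 1" and gf: "\<And>y. y \<in> ?U \<Longrightarrow> veronese (g y) = f y"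
    using covering_space_lift[OF covering_space_veronese convex_imp_simply_connected[OF cvx]
        convex_imp_locally_path_connected[OF cvx] contf fim] by blast
  have gn: "g y \<noteq> 0" "g y \<bullet> g y = 1" if "y \<in> ?U" for y
  proof -
    have "g y \<in> sphere 0 1" using g(2) that by (rule funcset_mem)
    then show "g y \<noteq> 0" "g y \<bullet> g y = 1" by (auto simp: dot_square_norm)
  qed
  have same: "g y \<bullet> g y' \<noteq> 0" if "y \<in> ?U" "y' \<in> ?U" "f y = f y'" for y y'
    using veronese_eq_imp_inner_nonzero[OF gn(1) gn(1), of y y'] gf that by simp
  have sub: "continuous_on {0..T} (\<lambda>t. g (\<tau>, t))" if "\<tau> \<in> {0..1}" for \<tau>
    by (rule continuous_on_compose2[OF g(1)]) (use that in \<open>auto intro!: continuous_intros\<close>)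
  have sub': "continuous_on {0..1} (\<lambda>\<tau>. g (\<tau>, t))" if "t \<in> {0..T}" for t
    by (rule continuous_on_compose2[OF g(1)]) (use that in \<open>auto intro!: continuous_intros\<close>)
  have loop: "point (z T) = point (z 0)" unfolding zT using l nz[of 0] T by (intro point_scale) auto
  have vz: "veronese (g (0, t)) = veronese (z t)" if "t \<in> {0..T}" for t
    using gf[of "(0, t)"] that h0 pv[OF nz[OF that]] by (simp add: f_def)
  \<comment> \<open>At the start of the homotopy the lift and \<open>z\<close> span the same line,
    so their inner product keeps its sign. As \<open>z T\<close> is a negative multiple of
    \<open>z 0\<close>, the two ends of the lift are opposite.\<close>
  have "(g (0, 0) \<bullet> z 0) * (g (0, T) \<bullet> z T) > 0"
  proof (rule nonzero_same_sign[OF T])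
    show "continuous_on {0..T} (\<lambda>t. g (0, t) \<bullet> z t)"
      by (intro continuous_intros sub z) simp
    show "g (0, t) \<bullet> z t \<noteq> 0" if "t \<in> {0..T}" for t
      by (rule veronese_eq_imp_inner_nonzero[OF gn(1) nz[OF that] vz[OF that]]) (use that in auto)
  qed
  moreover have "g (0, t) = (z t \<bullet> g (0, t) / (z t \<bullet> z t)) *\<^sub>R z t" if "t \<in> {0..T}" for t
  proof -
    have "g (0, t) = veronese (g (0, t)) *v g (0, t)" using gn[of "(0, t)"] that by (simp add: veronese_mult)
    then show ?thesis unfolding vz[OF that] veronese_mult .
  qed
  then obtain a b where ab: "g (0, 0) = a *\<^sub>R z 0" "g (0, T) = b *\<^sub>R z T" using T by force
  ultimately have "(a * b) * ((z 0 \<bullet> z 0) * (z T \<bullet> z T)) > 0" by (simp add: mult_ac)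
  moreover have "(z 0 \<bullet> z 0) * (z T \<bullet> z T) > 0" using nz[of 0] nz[of T] T by simp
  ultimately have "a * b > 0" by (rule zero_less_mult_pos2)
  then have "a * b * l * (z 0 \<bullet> z 0) < 0" using l nz[of 0] T
    by (intro mult_neg_pos mult_pos_neg) auto
  then have e0: "g (0, 0) \<bullet> g (0, T) < 0" unfolding ab zT by (simp add: scalar_mult_eq_scaleR mult_ac)
  \<comment> \<open>At the end of the homotopy the loop is constant, so the lift never becomes
    orthogonal to its starting vector.\<close>
  have "(g (1, 0) \<bullet> g (1, 0)) * (g (1, 0) \<bullet> g (1, T)) > 0"
  proof (rule nonzero_same_sign[OF T])
    show "continuous_on {0..T} (\<lambda>t. g (1, 0) \<bullet> g (1, t))" by (intro continuous_intros sub) simp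
    show "g (1, 0) \<bullet> g (1, t) \<noteq> 0" if "t \<in> {0..T}" for t
      by (rule same) (use that T h1 S in \<open>auto simp: f_def\<close>)
  qed
  then have e1: "g (1, 0) \<bullet> g (1, T) > 0" using gn(2)[of "(1, 0)"] T by simp
  have "(g (0, 0) \<bullet> g (0, T)) * (g (1, 0) \<bullet> g (1, T)) > 0"
  proof (rule nonzero_same_sign[of 0 1 "\<lambda>\<tau>. g (\<tau>, 0) \<bullet> g (\<tau>, T)"])
    show "continuous_on {0..1} (\<lambda>\<tau>. g (\<tau>, 0) \<bullet> g (\<tau>, T))"
      using T by (intro continuous_intros sub') auto
    show "g (\<tau>, 0) \<bullet> g (\<tau>, T) \<noteq> 0" if "\<tau> \<in> {0..1}" for \<tau>
      by (rule same) (use that T in \<open>auto simp: f_def loop\<close>)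
  qed simp
  then show False using e0 e1 by (simp add: zero_less_mult_iff)
qed

section \<open>The spectral cubic\<close>

text \<open>The indices are the exponents of z2 and z3, so that on z1 = 1 the terms of fixed
  \<open>j\<close> form a polynomial in z3 alone. The field is left open because real and complex
  zeros of the same form are compared.\<close>

definition ternary_cubic :: "(nat \<Rightarrow> nat \<Rightarrow> real) \<Rightarrow> 'f::real_field^3 \<Rightarrow> 'f" where
  "ternary_cubic h z = (\<Sum>j\<le>3. \<Sum>l\<le>3 - j. of_real (h j l) * (z $ 1 ^ (3 - j - l) * z $ 2 ^ j * z $ 3 ^ l))"

lemma cubic_form_eq_tern:
  "cubic_form c z = ternary_cubic (\<lambda>j l. c (\<lambda>i. if i = 1 then 3 - j - l else if i = 2 then j else l)) z"
proof -
  let ?S = "Sigma {..3::nat} (\<lambda>j. {..3 - j})"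
  let ?e = "\<lambda>p i :: 3. if i = 1 then 3 - fst p - snd p else if i = 2 then fst p else snd p :: nat"
  have ne: "(2::3) \<noteq> 1" "(3::3) \<noteq> 1" "(3::3) \<noteq> 2" by simp_all
  have prod3: "(\<Prod>i\<in>UNIV. f i) = f 1 * f 2 * f 3" for f :: "3 \<Rightarrow> complex"
    unfolding UNIV_3 using ne by (subst prod.insert; simp)+
  have "cubic_form c z = (\<Sum>p\<in>?S. complex_of_real (c (?e p)) * (\<Prod>i\<in>UNIV. z $ i ^ ?e p i))"
    unfolding cubic_form_def
  proof (rule sum.reindex_bij_witness[of _ ?e "\<lambda>e. (e 2, e 3)"])
    fix e :: "3 \<Rightarrow> nat" assume "e \<in> {e. sum e UNIV = 3}"
    then have s: "e 1 + e 2 + e 3 = 3" by (simp add: sum_3)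
    then show e: "?e (e 2, e 3) = e"
    proof (intro ext)
      fix i show "?e (e 2, e 3) i = e i" using s exhaust_3[of i] ne by auto
    qed
    show "(e 2, e 3) \<in> ?S" using s by auto
    show "complex_of_real (c (?e (e 2, e 3))) * (\<Prod>i\<in>UNIV. z $ i ^ ?e (e 2, e 3) i) =
        complex_of_real (c e) * (\<Prod>i\<in>UNIV. z $ i ^ e i)" by (simp only: e fun_cong[OF e])
  next
    fix p assume p: "p \<in> ?S"
    then show "(?e p 2, ?e p 3) = p" using ne by (cases p) simp
    show "?e p \<in> {e. sum e UNIV = 3}" using p ne by (auto simp: sum_3)
  qed
  also have "\<dots> = (\<Sum>j\<le>3. \<Sum>l\<le>3 - j. complex_of_real (c (?e (j, l))) * (\<Prod>i\<in>UNIV. z $ i ^ ?e (j, l) i))"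
    by (subst sum.Sigma) (simp_all add: split_def cong: if_cong)
  also have "\<dots> = ternary_cubic (\<lambda>j l. c (\<lambda>i. if i = 1 then 3 - j - l else if i = 2 then j else l)) z"
    unfolding ternary_cubic_def prod3 by (simp add: mult_ac ne cong: if_cong)
  finally show ?thesis .
qed

lemma tern_of_real: "ternary_cubic h (\<chi> i. of_real (z $ i)) = of_real (ternary_cubic h z)"
  by (simp add: ternary_cubic_def)

lemma tern_scale: "ternary_cubic h (k *s z) = k ^ 3 * ternary_cubic h z"
proof -
  have "k ^ (3 - j - l) * k ^ j * k ^ l = k ^ 3" if "j \<le> 3" "l \<le> 3 - j" for j l
    using that by (simp flip: power_add)
  then have "(k * z $ 1) ^ (3 - j - l) * (k * z $ 2) ^ j * (k * z $ 3) ^ l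
      = k ^ 3 * (z $ 1 ^ (3 - j - l) * z $ 2 ^ j * z $ 3 ^ l)" if "j \<le> 3" "l \<le> 3 - j" for j l
    using that by (simp add: power_mult_distrib mult_ac)
  then show ?thesis unfolding ternary_cubic_def sum_distrib_left by (intro sum.cong refl) auto
qed

lemma tern_combine: "ternary_cubic (\<lambda>j l. h j l + k * g j l) z = ternary_cubic h z + of_real k * ternary_cubic g z"
  by (simp add: ternary_cubic_def sum.distrib sum_distrib_left algebra_simps)

text \<open>For fixed small \<open>e\<close> the form is a polynomial of degree at most 2 in x with
  three roots, hence zero. Each of its coefficients is then a polynomial in \<open>e\<close> that
  vanishes on an interval.\<close>

lemma tern_coeff_eq_0:
  assumes e0: "e0 > 0" and h30: "h 3 0 = 0"
    and roots: "\<And>e. \<bar>e\<bar> < e0 \<Longrightarrow> \<exists>u v w :: real. u \<noteq> v \<and> u \<noteq> w \<and> v \<noteq> w \<and>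
      (\<forall>x\<in>{u, v, w}. ternary_cubic h (vector [1, x, e]) = 0)"
    and jl: "j + l \<le> 3"
  shows "h j l = 0"
proof -
  have col: "(\<Sum>l\<le>3 - j. h j l * e ^ l) = 0" if e: "\<bar>e\<bar> < e0" and j: "j \<le> 3" for e j
  proof -
    define A where "A j = (\<Sum>l\<le>3 - j. h j l * e ^ l)" for j
    have A3: "A 3 = 0" using h30 by (simp add: A_def)
    have val: "ternary_cubic h (vector [1, x, e]) = (\<Sum>j\<le>2. A j * x ^ j)" for x
    proof -
      have "ternary_cubic h (vector [1, x, e]) = (\<Sum>j\<le>3. A j * x ^ j)"
        unfolding ternary_cubic_def A_def sum_distrib_right by (simp add: mult_ac)
      also have "\<dots> = (\<Sum>j\<le>2. A j * x ^ j)" using A3 by (simp add: numeral_eq_Suc)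
      finally show ?thesis .
    qed
    obtain u v w where uvw: "u \<noteq> v" "u \<noteq> w" "v \<noteq> w" "\<forall>x\<in>{u, v, w}. ternary_cubic h (vector [1, x, e]) = 0"
      using roots[OF e] by blast
    have "A j = 0" if "j \<le> 2" for j
    proof (rule ccontr)
      assume "A j \<noteq> 0"
      then have r: "finite {x. (\<Sum>j\<le>2. A j * x ^ j) = 0}" "card {x. (\<Sum>j\<le>2. A j * x ^ j) = 0} \<le> 2"
        using polyfun_rootbound[of 2 A] that by auto
      moreover have "{u, v, w} \<subseteq> {x. (\<Sum>j\<le>2. A j * x ^ j) = 0}" using uvw(4) val by auto
      ultimately have "card {u, v, w} \<le> 2" by (meson card_mono order_trans)
      then show False using uvw(1-3) by simp
    qed
    then have "A j = 0" using A3 j by (cases "j = 3") auto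
    then show ?thesis by (simp add: A_def)
  qed
  show ?thesis
  proof (rule ccontr)
    assume "h j l \<noteq> 0"
    then have "\<exists>l. l \<le> 3 - j \<and> h j l \<noteq> 0" using jl by (intro exI[of _ l]) simp
    then have "finite {x. (\<Sum>l\<le>3 - j. h j l * x ^ l) = 0}"
      by (rule polyfun_rootbound_finite)
    moreover have "{-e0<..<e0} \<subseteq> {x. (\<Sum>l\<le>3 - j. h j l * x ^ l) = 0}" using col[of _ j] jl by auto
    ultimately have "finite {-e0<..<e0}" by (rule rev_finite_subset)
    moreover have "infinite {-e0<..<e0}" using e0 by (intro infinite_Ioo) simp
    ultimately show False by contradiction
  qed
qed

text \<open>If \<open>b\<^sub>k = x\<^sub>k\<^sub>k\<close>, \<open>c\<^sub>k = x\<^sub>i\<^sub>j x\<^sub>j\<^sub>i\<close> for \<open>{i, j, k} = {1, 2, 3}\<close>, and \<open>d\<close> is the sum of the two products of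
  entries of \<open>X\<close> along a 3-cycle, then \<open>spectral_cubic a b c d\<close> is \<open>det X\<^sub>z\<close>, and \<open>diag_form a b k\<close> is the
  \<open>k\<close>-th diagonal entry of \<open>X\<^sub>z\<close>.\<close>

definition diag_form :: "real^3 \<Rightarrow> real^3 \<Rightarrow> 3 \<Rightarrow> 'f::real_field^3 \<Rightarrow> 'f" where
  "diag_form a b k z = of_real (b $ k) * z $ 3 + of_real (a $ k) * z $ 1 - z $ 2"

definition spectral_cubic :: "real^3 \<Rightarrow> real^3 \<Rightarrow> real^3 \<Rightarrow> real \<Rightarrow> 'f::real_field^3 \<Rightarrow> 'f" where
  "spectral_cubic a b c d z = diag_form a b 1 z * diag_form a b 2 z * diag_form a b 3 z
     - (of_real (c $ 1) * diag_form a b 1 z + of_real (c $ 2) * diag_form a b 2 z + of_real (c $ 3) * diag_form a b 3 z) * z $ 3 ^ 2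
     + of_real d * z $ 3 ^ 3"

definition spectral_coeff :: "real^3 \<Rightarrow> real^3 \<Rightarrow> real^3 \<Rightarrow> real \<Rightarrow> nat \<Rightarrow> nat \<Rightarrow> real" where
  "spectral_coeff a b c d j l =
    (if j = 3 then - 1
     else if j = 2 then (if l = 0 then a$1 + a$2 + a$3 else b$1 + b$2 + b$3)
     else if j = 1 then (if l = 0 then - (a$1 * a$2 + a$1 * a$3 + a$2 * a$3)
       else if l = 1 then - (b$1 * (a$2 + a$3) + b$2 * (a$1 + a$3) + b$3 * (a$1 + a$2))
       else c$1 + c$2 + c$3 - (b$1 * b$2 + b$1 * b$3 + b$2 * b$3))
     else (if l = 0 then a$1 * a$2 * a$3
       else if l = 1 then b$1 * a$2 * a$3 + b$2 * a$1 * a$3 + b$3 * a$1 * a$2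
       else if l = 2 then a$1 * b$2 * b$3 + a$2 * b$1 * b$3 + a$3 * b$1 * b$2 - (c$1 * a$1 + c$2 * a$2 + c$3 * a$3)
       else b$1 * b$2 * b$3 - (c$1 * b$1 + c$2 * b$2 + c$3 * b$3) + d))"

lemma spec_eq_tern: "spectral_cubic a b c d z = ternary_cubic (spectral_coeff a b c d) z"
proof -
  have 1: "{..3 - 0} = {0, 1, 2, 3::nat}" "{..3} = {0, 1, 2, 3::nat}" "{..3 - 1} = {0, 1, 2::nat}"
    "{..3 - 2} = {0, 1::nat}" "{..3 - 3} = {0::nat}" "{..2} = {0, 1, 2::nat}" by auto
  show ?thesis
    unfolding ternary_cubic_def 1 spectral_cubic_def diag_form_def
    by (simp add: 1 spectral_coeff_def del: atMost_0 diff_self_eq_0) (simp add: 1 algebra_simps power2_eq_square power3_eq_cube)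
qed

lemma spec_of_real: "spectral_cubic a b c d (\<chi> i. of_real (z $ i)) = of_real (spectral_cubic a b c d z)"
  unfolding spec_eq_tern by (rule tern_of_real)

lemma spec_scale: "spectral_cubic a b c d (k *s z) = k ^ 3 * spectral_cubic a b c d z"
  unfolding spec_eq_tern by (rule tern_scale)

text \<open>For e = 0 the cubic in x changes sign at each of the distinct a_1, a_2, a_3, and these
  sign changes survive a small change of \<open>e\<close>.\<close>

lemma spec_real_roots:
  fixes a :: "real^3"
  assumes a: "\<And>i j. i \<noteq> j \<Longrightarrow> a $ i \<noteq> a $ j"
  shows "\<exists>e0>0. \<forall>e. \<bar>e\<bar> < e0 \<longrightarrow> (\<exists>u v w :: real. u \<noteq> v \<and> u \<noteq> w \<and> v \<noteq> w \<and>
    (\<forall>x\<in>{u, v, w}. spectral_cubic a b c d (vector [1, x, e]) = 0))"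
proof -
  define f where "f x e = spectral_cubic a b c d (vector [1, x, e] :: real^3)" for x e
  have f: "f x e = (b$1 * e + a$1 - x) * (b$2 * e + a$2 - x) * (b$3 * e + a$3 - x)
     - (c$1 * (b$1 * e + a$1 - x) + c$2 * (b$2 * e + a$2 - x) + c$3 * (b$3 * e + a$3 - x)) * e^2 + d * e^3" for x e
    by (simp add: f_def spectral_cubic_def diag_form_def)
  \<comment> \<open>A third of the smallest gap, so that the closed intervals of radius
    \<open>m\<close> around the a_k are disjoint.\<close>
  define m where "m = Min {\<bar>a$1 - a$2\<bar>, \<bar>a$1 - a$3\<bar>, \<bar>a$2 - a$3\<bar>} / 3"
  have ne: "a$1 \<noteq> a$2" "a$1 \<noteq> a$3" "a$2 \<noteq> a$3" using a by auto
  have m: "m > 0" "3 * m \<le> \<bar>a$1 - a$2\<bar>" "3 * m \<le> \<bar>a$1 - a$3\<bar>" "3 * m \<le> \<bar>a$2 - a$3\<bar>"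
    using ne by (auto simp: m_def)
  \<comment> \<open>The product factors as the product over i of (a_i - a_k)^2 - m^2, and only the
    factor with i = k is negative.\<close>
  have neg: "f (a$k - m) 0 * f (a$k + m) 0 < 0" for k
  proof -
    define P where "P x = (x + m) * (x - m)" for x
    have pos: "P x > 0" if "3 * m \<le> \<bar>x\<bar>" for x
    proof -
      have "m^2 < \<bar>x\<bar>^2" using that m(1) by (intro power_strict_mono) auto
      then show ?thesis by (simp add: P_def algebra_simps power2_eq_square)
    qed
    have P0: "P 0 < 0" using m(1) by (simp add: P_def)
    have f0: "f (a$k + e) 0 = (a$1 - a$k - e) * (a$2 - a$k - e) * (a$3 - a$k - e)" for e
      by (simp add: f diff_diff_eq)
    have "f (a$k - m) 0 * f (a$k + m) 0 = P (a$1 - a$k) * P (a$2 - a$k) * P (a$3 - a$k)"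
      using f0[of m] f0[of "- m"] by (simp add: P_def mult_ac)
    also have "\<dots> < 0"
    proof -
      consider "k = 1" | "k = 2" | "k = 3" using exhaust_3 by blast
      then show ?thesis
      proof cases
        case 1
        have "P 0 * (P (a$2 - a$1) * P (a$3 - a$1)) < 0"
          using m by (intro mult_neg_pos P0 mult_pos_pos pos) (simp_all add: abs_minus_commute)
        then show ?thesis using 1 by (simp add: mult_ac)
      next
        case 2
        have "P 0 * (P (a$1 - a$2) * P (a$3 - a$2)) < 0"
          using m by (intro mult_neg_pos P0 mult_pos_pos pos) (simp_all add: abs_minus_commute)
        then show ?thesis using 2 by (simp add: mult_ac)
      next
        case 3
        have "P 0 * (P (a$1 - a$3) * P (a$2 - a$3)) < 0"
          using m by (intro mult_neg_pos P0 mult_pos_pos pos) (simp_all add: abs_minus_commute)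
        then show ?thesis using 3 by (simp add: mult_ac)
      qed
    qed
    finally show ?thesis .
  qed
  have ev: "\<forall>\<^sub>F e in at 0. f (a$k - m) e * f (a$k + m) e < 0" for k
  proof -
    have "isCont (\<lambda>e. f (a$k - m) e * f (a$k + m) e) 0" unfolding f by (intro continuous_intros)
    then show ?thesis using neg[of k] order_tendstoD(2) unfolding isCont_def by blast
  qed
  have "\<forall>\<^sub>F e in at 0. \<forall>k\<in>{1, 2, 3}. f (a$k - m) e * f (a$k + m) e < 0"
    using ev by (intro eventually_ball_finite) auto
  then obtain e0 where e0: "e0 > 0" "\<And>e k. e \<noteq> 0 \<Longrightarrow> \<bar>e\<bar> < e0 \<Longrightarrow> f (a$k - m) e * f (a$k + m) e < 0"
  proof -
    obtain e0 where e0: "e0 > 0" "\<forall>e\<in>UNIV. e \<noteq> 0 \<and> dist e 0 < e0 \<longrightarrow>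
        (\<forall>k\<in>{1, 2, 3}. f (a$k - m) e * f (a$k + m) e < 0)"
      using \<open>\<forall>\<^sub>F e in at 0. \<forall>k\<in>{1, 2, 3}. f (a$k - m) e * f (a$k + m) e < 0\<close> unfolding eventually_at by blast
    have "f (a$k - m) e * f (a$k + m) e < 0" if "e \<noteq> 0" "\<bar>e\<bar> < e0" for e k
    proof -
      have "\<forall>k\<in>{1, 2, 3}. f (a$k - m) e * f (a$k + m) e < 0"
        using e0(2) that by (simp add: dist_real_def)
      then show ?thesis using exhaust_3[of k] by auto
    qed
    then show thesis using e0(1) by (rule that[rotated])
  qed
  show ?thesis
  proof (rule exI[of _ e0], intro conjI allI impI e0(1))
    fix e assume e: "\<bar>e\<bar> < e0"
    have "\<exists>x. a$k - m \<le> x \<and> x \<le> a$k + m \<and> f x e = 0" for k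
    proof -
      have "f (a$k - m) e * f (a$k + m) e < 0" using e0(2)[OF _ e] neg by (cases "e = 0") auto
      then consider "f (a$k - m) e < 0" "0 < f (a$k + m) e" | "0 < f (a$k - m) e" "f (a$k + m) e < 0"
        by (auto simp: mult_less_0_iff)
      moreover have "isCont (\<lambda>x. f x e) x" for x unfolding f by (intro continuous_intros)
      ultimately show ?thesis
        using IVT[of "\<lambda>x. f x e" "a$k - m" 0 "a$k + m"] IVT2[of "\<lambda>x. f x e" "a$k + m" 0 "a$k - m"] m(1)
        by cases auto
    qed
    then obtain r where r: "\<And>k. a$k - m \<le> r k \<and> r k \<le> a$k + m \<and> f (r k) e = 0" by metis
    have "r 1 \<noteq> r 2" "r 1 \<noteq> r 3" "r 2 \<noteq> r 3"
      using r[of 1] r[of 2] r[of 3] m by argo+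
    then show "\<exists>u v w. u \<noteq> v \<and> u \<noteq> w \<and> v \<noteq> w \<and> (\<forall>x\<in>{u, v, w}. spectral_cubic a b c d (vector [1, x, e]) = 0)"
      using r unfolding f_def by (intro exI[of _ "r 1"] exI[of _ "r 2"] exI[of _ "r 3"]) auto
  qed
qed

text \<open>Near \<open>\<infinity>\<^sub>1, \<infinity>\<^sub>2, \<infinity>\<^sub>3\<close> the curve meets every vertical line in three distinct real points, so
  its real points already determine the cubic up to a factor.\<close>

lemma spec_zeros_imp_proportional:
  fixes a :: "real^3"
  assumes a: "\<And>i j. i \<noteq> j \<Longrightarrow> a $ i \<noteq> a $ j"
    and zeros: "\<And>z :: real^3. z \<noteq> 0 \<Longrightarrow> spectral_cubic a b c d z = 0 \<Longrightarrow> ternary_cubic h z = 0"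
    and jl: "j + l \<le> 3"
  shows "h j l = - h 3 0 * spectral_coeff a b c d j l"
proof -
  obtain e0 where e0: "e0 > 0" "\<And>e. \<bar>e\<bar> < e0 \<Longrightarrow> (\<exists>u v w :: real. u \<noteq> v \<and> u \<noteq> w \<and> v \<noteq> w \<and>
    (\<forall>x\<in>{u, v, w}. spectral_cubic a b c d (vector [1, x, e]) = 0))"
    using spec_real_roots[OF a, where b = b and c = c and d = d] by blast
  have nz: "vector [1, x, e] \<noteq> (0 :: real^3)" for x e by (simp add: vec_eq_iff forall_3)
  let ?g = "\<lambda>j l. h j l + h 3 0 * spectral_coeff a b c d j l"
  have "?g j l = 0"
  proof (rule tern_coeff_eq_0[OF e0(1) _ _ jl])
    show "?g 3 0 = 0" by (simp add: spectral_coeff_def)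
    fix e assume "\<bar>e\<bar> < e0"
    then obtain u v w :: real where uvw: "u \<noteq> v" "u \<noteq> w" "v \<noteq> w"
      "\<forall>x\<in>{u, v, w}. spectral_cubic a b c d (vector [1, x, e]) = 0" using e0(2) by meson
    have "ternary_cubic ?g (vector [1, x, e]) = 0" if "x \<in> {u, v, w}" for x
    proof -
      have "spectral_cubic a b c d (vector [1, x, e]) = 0" using uvw(4) that by blast
      then show ?thesis unfolding tern_combine spec_eq_tern[symmetric] using zeros[OF nz] by simp
    qed
    then show "\<exists>u v w. u \<noteq> v \<and> u \<noteq> w \<and> v \<noteq> w \<and> (\<forall>x\<in>{u, v, w}. ternary_cubic ?g (vector [1, x, e]) = 0)"
      using uvw(1-3) by blast
  qed
  then show ?thesis by simp
qed

text \<open>The cross product of \<open>a\<close> and (1, 1, 1): it spans the changes of the pair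
  products that preserve both their sum and their sum weighted by \<open>a\<close>.\<close>

definition gaps :: "real^3 \<Rightarrow> real^3" where
  "gaps a = vector [a$2 - a$3, a$3 - a$1, a$1 - a$2]"

text \<open>The coefficients linear in z3 form an invertible system for \<open>b\<close>. Those
  quadratic in z3 then leave \<open>c\<close> one degree of freedom along \<open>gaps a\<close>, and
  the z3^3 coefficient determines \<open>d\<close>.\<close>

lemma spec_coeff_eq_imp:
  fixes a :: "real^3"
  assumes a: "\<And>i j. i \<noteq> j \<Longrightarrow> a $ i \<noteq> a $ j"
    and eq: "\<And>j l. j + l \<le> 3 \<Longrightarrow> spectral_coeff a b' c' d' j l = spectral_coeff a b c d j l"
  shows "b' = b \<and> (\<exists>s. (\<forall>k. c' $ k = c $ k + gaps a $ k * s) \<and> d' = d + (\<Sum>k\<in>UNIV. gaps a $ k * b $ k) * s)"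
proof -
  have ne: "a$1 \<noteq> a$2" "a$1 \<noteq> a$3" "a$2 \<noteq> a$3" using a by auto
  define x y z where "x = b'$1 - b$1" and "y = b'$2 - b$2" and "z = b'$3 - b$3"
  have e: "x + y + z = 0" "x * (a$2 + a$3) + y * (a$1 + a$3) + z * (a$1 + a$2) = 0"
    "x * a$2 * a$3 + y * a$1 * a$3 + z * a$1 * a$2 = 0"
    using eq[of 2 1] eq[of 1 1] eq[of 0 1] by (simp_all add: spectral_coeff_def x_def y_def z_def algebra_simps)
  \<comment> \<open>Lagrange interpolation: x(t - a_2)(t - a_3) + y(t - a_1)(t - a_3) + z(t - a_1)(t
    - a_2), evaluated at t = a_1. The three equations \<open>e\<close> say that all its coefficients
    vanish.\<close>
  have "x * ((a$2 - a$1) * (a$3 - a$1)) = (x * a$2 * a$3 + y * a$1 * a$3 + z * a$1 * a$2)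
      - a$1 * (x * (a$2 + a$3) + y * (a$1 + a$3) + z * (a$1 + a$2)) + a$1^2 * (x + y + z)"
    by (simp add: algebra_simps power2_eq_square)
  then have x: "x = 0" unfolding e using ne by simp
  have "y * ((a$1 - a$2) * (a$3 - a$2)) = (x * a$2 * a$3 + y * a$1 * a$3 + z * a$1 * a$2)
      - a$2 * (x * (a$2 + a$3) + y * (a$1 + a$3) + z * (a$1 + a$2)) + a$2^2 * (x + y + z)"
    by (simp add: algebra_simps power2_eq_square)
  then have y: "y = 0" unfolding e using ne by simp
  have z: "z = 0" using e(1) x y by simp
  have bb: "b' = b" using x y z by (simp add: vec_eq_iff forall_3 x_def y_def z_def)
  define u v w where "u = c'$1 - c$1" and "v = c'$2 - c$2" and "w = c'$3 - c$3"
  define s where "s = u / (a$2 - a$3)"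
  have f: "u + v + w = 0" "u * a$1 + v * a$2 + w * a$3 = 0" "d' - d = u * b$1 + v * b$2 + w * b$3"
    using eq[of 1 2] eq[of 0 2] eq[of 0 3] unfolding bb
    by (simp_all add: spectral_coeff_def u_def v_def w_def algebra_simps)
  have u: "u = (a$2 - a$3) * s" using ne by (simp add: s_def)
  have "(a$2 - a$3) * v = (u * a$1 + v * a$2 + w * a$3) - a$3 * (u + v + w) - u * (a$1 - a$3)"
    by (simp add: algebra_simps)
  also have "\<dots> = - u * (a$1 - a$3)" unfolding f(1,2) by simp
  also have "\<dots> = (a$2 - a$3) * ((a$3 - a$1) * s)" unfolding u by (simp add: algebra_simps)
  finally have v: "v = (a$3 - a$1) * s" using ne by simp
  have w: "w = (a$1 - a$2) * s" using f(1) u v by (simp add: algebra_simps)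
  have "d' = d + (\<Sum>k\<in>UNIV. gaps a $ k * b $ k) * s"
    using f(3) unfolding u v w by (simp add: sum_3 gaps_def algebra_simps)
  moreover have "\<forall>k. c' $ k = c $ k + gaps a $ k * s"
    using u v w by (simp add: forall_3 gaps_def u_def v_def w_def algebra_simps)
  ultimately show ?thesis using bb by blast
qed

definition cyc :: "3 \<Rightarrow> 3 \<Rightarrow> 3 \<Rightarrow> bool" where
  "cyc i j k \<longleftrightarrow> i = 1 \<and> j = 2 \<and> k = 3 \<or> i = 2 \<and> j = 3 \<and> k = 1 \<or> i = 3 \<and> j = 1 \<and> k = 2"

lemma cycE:
  assumes "cyc i j k"
  obtains "i = 1" "j = 2" "k = 3" | "i = 2" "j = 3" "k = 1" | "i = 3" "j = 1" "k = 2"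
  using assms unfolding cyc_def by blast

definition pair_products :: "real^3^3 \<Rightarrow> real^3" where
  "pair_products X = vector [X$2$3 * X$3$2, X$3$1 * X$1$3, X$1$2 * X$2$1]"

definition cycle_sum :: "real^3^3 \<Rightarrow> real" where
  "cycle_sum X = X$1$2 * X$2$3 * X$3$1 + X$1$3 * X$3$2 * X$2$1"

definition cycle_diff :: "real^3^3 \<Rightarrow> real" where
  "cycle_diff X = X$1$2 * X$2$3 * X$3$1 - X$1$3 * X$3$2 * X$2$1"

lemma det_pencil_eq_spec:
  fixes z :: "'f::real_field^3"
  shows "det (pencil (map_matrix of_real (diag a)) (map_matrix of_real X) z)
    = spectral_cubic a (\<chi> k. X $ k $ k) (pair_products X) (cycle_sum X) z"
proof -
  have ne: "(1::3) \<noteq> 2" "(2::3) \<noteq> 1" "(1::3) \<noteq> 3" "(3::3) \<noteq> 1" "(2::3) \<noteq> 3" "(3::3) \<noteq> 2"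
    by simp_all
  define l where "l k = diag_form a (\<chi> k. X $ k $ k) k z" for k
  define x where "x i j = (of_real (X $ i $ j) :: 'f)" for i j
  define w where "w = z $ 3"
  have p: "pencil (map_matrix of_real (diag a)) (map_matrix of_real X) z $ i $ j
      = (if i = j then l i else w * x i j)" for i j
    by (simp add: pencil_def map_matrix_def diag_def mat_def l_def diag_form_def x_def w_def mult.commute)
  have "det (pencil (map_matrix of_real (diag a)) (map_matrix of_real X) z) =
     l 1 * l 2 * l 3 - (x 2 3 * x 3 2 * l 1 + x 3 1 * x 1 3 * l 2 + x 1 2 * x 2 1 * l 3) * w^2
     + (x 1 2 * x 2 3 * x 3 1 + x 1 3 * x 3 2 * x 2 1) * w^3"
    unfolding det_3 p using ne by (simp add: algebra_simps power2_eq_square power3_eq_cube)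
  then show ?thesis
    unfolding spectral_cubic_def pair_products_def cycle_sum_def by (simp add: l_def x_def w_def)
qed

lemma point_in_spectral_curve_iff:
  assumes "z \<noteq> 0"
  shows "point z \<in> spectral_curve (diag a) X \<longleftrightarrow> spectral_cubic a (\<chi> k. X $ k $ k) (pair_products X) (cycle_sum X) z = 0"
proof
  assume "point z \<in> spectral_curve (diag a) X"
  then obtain w where w: "w \<noteq> 0" "point w = point z" "spectral_cubic a (\<chi> k. X $ k $ k) (pair_products X) (cycle_sum X) w = 0"
    unfolding spectral_curve_def det_pencil_eq_spec by auto
  obtain k where "k \<noteq> 0 \<and> z = k *s w" using point_eqD[OF w(2,1) assms] ..
  then show "spectral_cubic a (\<chi> k. X $ k $ k) (pair_products X) (cycle_sum X) z = 0"
    using w(3) by (simp add: spec_scale)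
qed (use assms in \<open>auto simp: spectral_curve_def det_pencil_eq_spec\<close>)

lemma complexify_point: "z \<noteq> 0 \<Longrightarrow> complexify (point z) = point (\<chi> i. complex_of_real (z $ i))"
proof -
  assume z: "z \<noteq> 0"
  have "proj_rel z z" unfolding proj_rel_def using z by (metis vector_smult_lid zero_neq_one)
  then show ?thesis unfolding point_def by (rule complexify.abs_eq)
qed

lemma of_real_vec_nonzero: "z \<noteq> 0 \<Longrightarrow> (\<chi> i. complex_of_real (z $ i)) \<noteq> 0"
  by (simp add: vec_eq_iff)

lemma point_in_real_part_iff:
  assumes "z \<noteq> 0"
  shows "point z \<in> real_part (spectral_curve (diag a) X)
    \<longleftrightarrow> spectral_cubic a (\<chi> k. X $ k $ k) (pair_products X) (cycle_sum X) z = 0"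
  unfolding real_part_def mem_Collect_eq complexify_point[OF assms]
    point_in_spectral_curve_iff[OF of_real_vec_nonzero[OF assms]] spec_of_real of_real_eq_0_iff ..

section \<open>Matrices with a common spectral curve\<close>

locale spec_data =
  fixes a b c :: "real^3" and d :: real
  assumes dist: "\<And>i j. i \<noteq> j \<Longrightarrow> a $ i \<noteq> a $ j"
begin

definition "cycle_slope = (\<Sum>k\<in>UNIV. gaps a $ k * b $ k)"
definition "pair_at k s = c $ k + gaps a $ k * s"
definition "cycle_at s = d + cycle_slope * s"

text \<open>For matrices with the same spectral cubic the products \<open>x\<^sub>i\<^sub>j x\<^sub>j\<^sub>i\<close> move along a line of direction
  \<open>gaps a\<close>; the parameter \<open>s\<close> is the coordinate on this line.\<close>

definition fit :: "real^3^3 \<Rightarrow> real \<Rightarrow> bool" where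
  "fit X s \<longleftrightarrow> (\<forall>k. X $ k $ k = b $ k) \<and> (\<forall>k. pair_products X $ k = pair_at k s) \<and> cycle_sum X = cycle_at s"

lemma dif_nonzero: "gaps a $ k \<noteq> 0"
  using exhaust_3[of k] dist[of 1 2] dist[of 2 3] dist[of 3 1] by (auto simp: gaps_def)

lemma fitD:
  assumes "fit X s"
  shows "X $ k $ k = b $ k"
    and "X$2$3 * X$3$2 = pair_at 1 s" "X$3$1 * X$1$3 = pair_at 2 s" "X$1$2 * X$2$1 = pair_at 3 s"
    and "X$1$2 * X$2$3 * X$3$1 + X$1$3 * X$3$2 * X$2$1 = cycle_at s"
proof -
  have p: "pair_products X $ k = pair_at k s" for k using assms by (simp add: fit_def)
  show "X$2$3 * X$3$2 = pair_at 1 s" "X$3$1 * X$1$3 = pair_at 2 s" "X$1$2 * X$2$1 = pair_at 3 s"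
    using p[of 1] p[of 2] p[of 3] by (simp_all add: pair_products_def)
qed (use assms in \<open>simp_all add: fit_def cycle_sum_def\<close>)

lemma fit_cyc:
  assumes "fit X s" "cyc i j k"
  shows "X $ i $ j * X $ j $ i = pair_at k s"
    and "X $ i $ j * X $ j $ k * X $ k $ i + X $ i $ k * X $ k $ j * X $ j $ i = cycle_at s"
    and "X $ i $ j * X $ j $ k * X $ k $ i - X $ i $ k * X $ k $ j * X $ j $ i = cycle_diff X"
  using assms(2)
  by (cases rule: cycE; use fitD[OF assms(1)] in \<open>simp add: cycle_diff_def mult_ac add_ac\<close>)+

text \<open>The diagonal forms weighted by \<open>gaps a\<close> add up to
  \<open>cycle_slope\<close> times z3, so the shift of the pair products is cancelled by that of the
  cycle sum.\<close>

lemma spec_shift: "spectral_cubic a b (\<chi> k. pair_at k s) (cycle_at s) z = spectral_cubic a b c d z"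
  unfolding spectral_cubic_def diag_form_def pair_at_def cycle_at_def cycle_slope_def
  by (simp add: gaps_def sum_3 algebra_simps power2_eq_square power3_eq_cube)

lemma fit_spec:
  assumes "fit X s"
  shows "spectral_cubic a (\<chi> k. X $ k $ k) (pair_products X) (cycle_sum X) z = spectral_cubic a b c d z"
proof -
  have "(\<chi> k. X $ k $ k) = b" "pair_products X = (\<chi> k. pair_at k s)" "cycle_sum X = cycle_at s"
    using assms by (simp_all add: fit_def vec_eq_iff)
  then show ?thesis by (simp add: spec_shift)
qed

lemma fit_exists:
  assumes "spectral_curve (diag a) Y = {point z |z. z \<noteq> 0 \<and> spectral_cubic a b c d z = 0}"
  shows "\<exists>s. fit Y s"
proof -
  have z: "ternary_cubic (spectral_coeff a (\<chi> k. Y $ k $ k) (pair_products Y) (cycle_sum Y)) z = 0"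
    if "z \<noteq> 0" "spectral_cubic a b c d z = 0" for z :: "real^3"
  proof -
    have "spectral_cubic a b c d (\<chi> i. complex_of_real (z $ i)) = 0" unfolding spec_of_real using that by simp
    then have "point (\<chi> i. complex_of_real (z $ i)) \<in> spectral_curve (diag a) Y"
      unfolding assms using of_real_vec_nonzero[OF that(1)] by blast
    then have "spectral_cubic a (\<chi> k. Y $ k $ k) (pair_products Y) (cycle_sum Y) (\<chi> i. complex_of_real (z $ i)) = 0"
      by (simp only: point_in_spectral_curve_iff[OF of_real_vec_nonzero[OF that(1)]])
    then show ?thesis unfolding spec_eq_tern tern_of_real of_real_eq_0_iff .
  qed
  \<comment> \<open>Both cubics have coefficient -1 at z2^3, so proportional means equal.\<close>
  have "spectral_coeff a (\<chi> k. Y $ k $ k) (pair_products Y) (cycle_sum Y) j l = spectral_coeff a b c d j l" if "j + l \<le> 3" for j l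
    using spec_zeros_imp_proportional[OF dist z that] by (simp add: spectral_coeff_def)
  from spec_coeff_eq_imp[OF dist this] obtain s where "(\<chi> k. Y $ k $ k) = b"
    "\<forall>k. pair_products Y $ k = c $ k + gaps a $ k * s" "cycle_sum Y = d + cycle_slope * s" unfolding cycle_slope_def by blast
  then have "fit Y s" by (auto simp: fit_def pair_at_def cycle_at_def vec_eq_iff)
  then show ?thesis ..
qed

text \<open>A double root of the potential is a singular point of the curve.\<close>

lemma double_root_critical:
  assumes r: "cycle_at s ^ 2 = 4 * (pair_at 1 s * pair_at 2 s * pair_at 3 s)"
    and r': "cycle_slope * cycle_at s = 2 * (gaps a $ 1 * pair_at 2 s * pair_at 3 s + gaps a $ 2 * pair_at 1 s * pair_at 3 s + gaps a $ 3 * pair_at 1 s * pair_at 2 s)"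
  shows "\<exists>v :: complex^3. v$2 * v$3 = of_real (pair_at 1 s) \<and> v$1 * v$3 = of_real (pair_at 2 s) \<and> v$1 * v$2 = of_real (pair_at 3 s)
    \<and> of_real (gaps a $ 1) * v$1 + of_real (gaps a $ 2) * v$2 + of_real (gaps a $ 3) * v$3 = of_real cycle_slope
    \<and> 2 * (of_real (pair_at 1 s) * v$1 + of_real (pair_at 2 s) * v$2 + of_real (pair_at 3 s) * v$3) = 3 * of_real (cycle_at s)"
proof (cases "cycle_at s = 0")
  \<comment> \<open>The entries of v are the values of the diagonal forms at the singular point with
    z3 = 1. The product conditions and the last condition are vanishing derivatives in these forms
    and in z3, taken as independent variables; the linear condition says that a point with these
    values exists.\<close>
  case False
  define m where "m = cycle_at s / 2"
  have m: "m \<noteq> 0" "m * m = pair_at 1 s * pair_at 2 s * pair_at 3 s" "cycle_at s = 2 * m"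
    using False r by (simp_all add: m_def power2_eq_square field_simps)
  have p: "pair_at 1 s \<noteq> 0" "pair_at 2 s \<noteq> 0" "pair_at 3 s \<noteq> 0" using m(1,2) by auto
  define v :: "real^3" where "v = vector [m / pair_at 1 s, m / pair_at 2 s, m / pair_at 3 s]"
  have "v$2 * v$3 = pair_at 1 s" "v$1 * v$3 = pair_at 2 s" "v$1 * v$2 = pair_at 3 s"
    using p m(2) by (simp_all add: v_def field_simps)
  moreover have "gaps a $ 1 * v$1 + gaps a $ 2 * v$2 + gaps a $ 3 * v$3 = cycle_slope"
  proof -
    have "(gaps a $ 1 * v$1 + gaps a $ 2 * v$2 + gaps a $ 3 * v$3) * (m * m)
      = m * (gaps a $ 1 * pair_at 2 s * pair_at 3 s + gaps a $ 2 * pair_at 1 s * pair_at 3 s + gaps a $ 3 * pair_at 1 s * pair_at 2 s)"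
      unfolding m(2) using p by (simp add: v_def field_simps)
    also have "\<dots> = m * (cycle_slope * m)" using r' unfolding m(3) by simp
    also have "\<dots> = cycle_slope * (m * m)" by simp
    finally show ?thesis using m(1) by simp
  qed
  moreover have "2 * (pair_at 1 s * v$1 + pair_at 2 s * v$2 + pair_at 3 s * v$3) = 3 * cycle_at s"
    using p by (simp add: v_def m(3))
  ultimately show ?thesis
  proof -
    assume v: "v$2 * v$3 = pair_at 1 s" "v$1 * v$3 = pair_at 2 s" "v$1 * v$2 = pair_at 3 s"
      "gaps a $ 1 * v$1 + gaps a $ 2 * v$2 + gaps a $ 3 * v$3 = cycle_slope"
      "2 * (pair_at 1 s * v$1 + pair_at 2 s * v$2 + pair_at 3 s * v$3) = 3 * cycle_at s"
    note w = v[THEN arg_cong[of _ _ complex_of_real]]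
    show ?thesis
      using w by (intro exI[of _ "\<chi> i. complex_of_real (v $ i)"]) simp
  qed
next
  case True
  \<comment> \<open>With cycle sum 0 two pair products vanish, and what is left is to find two
    numbers with given product and given weighted sum. The roots may be complex, which is why the
    singular point is sought over the complex numbers.\<close>
  have quad: "\<exists>x y :: complex. x * y = of_real p \<and> of_real u * x + of_real w * y = of_real q"
    if "u \<noteq> 0" "w \<noteq> 0" for p q u w :: real
  proof -
    define D where "D = csqrt (of_real q ^ 2 - 4 * of_real u * of_real w * of_real p)"
    have D: "D * D = of_real q ^ 2 - 4 * of_real u * of_real w * of_real p"
      by (simp add: D_def flip: power2_eq_square)
    have "((of_real q + D) / (2 * of_real u)) * ((of_real q - D) / (2 * of_real w)) = of_real p"
    proof -
      have "(of_real q + D) * (of_real q - D) = of_real q ^ 2 - D * D" by (simp add: algebra_simps power2_eq_square)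
      then have "(of_real q + D) * (of_real q - D) = 4 * of_real u * of_real w * of_real p" unfolding D by simp
      then show ?thesis using that by (simp add: field_simps)
    qed
    moreover have "of_real u * ((of_real q + D) / (2 * of_real u)) + of_real w * ((of_real q - D) / (2 * of_real w)) = of_real q"
      using that by (simp add: field_simps)
    ultimately show ?thesis by blast
  qed
  have prod0: "pair_at 1 s * pair_at 2 s * pair_at 3 s = 0"
    and r0: "gaps a $ 1 * pair_at 2 s * pair_at 3 s + gaps a $ 2 * pair_at 1 s * pair_at 3 s + gaps a $ 3 * pair_at 1 s * pair_at 2 s = 0"
    using r r' True by simp_all
  \<comment> \<open>One pair product vanishes by \<open>prod0\<close>; then \<open>r0\<close>
    reduces to the product of the other two times a nonzero gap.\<close>
  then consider "pair_at 1 s = 0" "pair_at 2 s = 0" | "pair_at 1 s = 0" "pair_at 3 s = 0" | "pair_at 2 s = 0" "pair_at 3 s = 0"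
    using dif_nonzero by auto
  then show ?thesis
  proof cases
    case 1
    obtain x y :: complex where "x * y = of_real (pair_at 3 s)" "of_real (gaps a $ 1) * x + of_real (gaps a $ 2) * y = of_real cycle_slope"
      using quad[OF dif_nonzero dif_nonzero] by blast
    then show ?thesis using 1 True by (intro exI[of _ "vector [x, y, 0]"]) simp
  next
    case 2
    obtain x y :: complex where "x * y = of_real (pair_at 2 s)" "of_real (gaps a $ 1) * x + of_real (gaps a $ 3) * y = of_real cycle_slope"
      using quad[OF dif_nonzero dif_nonzero] by blast
    then show ?thesis using 2 True by (intro exI[of _ "vector [x, 0, y]"]) simp
  next
    case 3
    obtain x y :: complex where "x * y = of_real (pair_at 1 s)" "of_real (gaps a $ 2) * x + of_real (gaps a $ 3) * y = of_real cycle_slope"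
      using quad[OF dif_nonzero dif_nonzero] by blast
    then show ?thesis using 3 True by (intro exI[of _ "vector [0, x, y]"]) simp
  qed
qed

text \<open>Smoothness provides some regular cubic equation for the curve. Having the same zeros, it
  is a constant multiple of the spectral cubic, so the critical point from
  \<open>double_root_critical\<close> is singular for it as well.\<close>

lemma smooth_imp_nondeg:
  assumes C: "smooth_real_cubic {point z |z. z \<noteq> 0 \<and> spectral_cubic a b c d z = 0}"
    and r: "cycle_at s ^ 2 = 4 * (pair_at 1 s * pair_at 2 s * pair_at 3 s)"
  shows "cycle_slope * cycle_at s \<noteq> 2 * (gaps a $ 1 * pair_at 2 s * pair_at 3 s + gaps a $ 2 * pair_at 1 s * pair_at 3 s + gaps a $ 3 * pair_at 1 s * pair_at 2 s)"
proof
  assume r': "cycle_slope * cycle_at s = 2 * (gaps a $ 1 * pair_at 2 s * pair_at 3 s + gaps a $ 2 * pair_at 1 s * pair_at 3 s + gaps a $ 3 * pair_at 1 s * pair_at 2 s)"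
  obtain e where eq: "{point z |z. z \<noteq> 0 \<and> spectral_cubic a b c d z = 0} = {point z |z. z \<noteq> 0 \<and> cubic_form e z = 0}"
    and reg: "\<And>z. z \<noteq> 0 \<Longrightarrow> cubic_form e z = 0 \<Longrightarrow> \<exists>i. partial_deriv i (cubic_form e) z \<noteq> 0"
    using C unfolding smooth_real_cubic_def by blast
  define h where "h = (\<lambda>j l. e (\<lambda>i. if i = 1 then 3 - j - l else if i = 2 then j else l :: nat))"
  have e: "cubic_form e z = ternary_cubic h z" for z unfolding h_def by (rule cubic_form_eq_tern)
  have zeros: "ternary_cubic h z = 0" if z: "z \<noteq> 0" "spectral_cubic a b c d z = 0" for z :: "real^3"
  proof -
    let ?z = "\<chi> i. complex_of_real (z $ i)"
    have "spectral_cubic a b c d ?z = 0" unfolding spec_of_real using z by simp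
    then have "point ?z \<in> {point z |z. z \<noteq> 0 \<and> cubic_form e z = 0}"
      unfolding eq[symmetric] using of_real_vec_nonzero[OF z(1)] by blast
    then obtain w where w: "w \<noteq> 0" "point w = point ?z" "ternary_cubic h w = 0" using e by auto
    obtain k where "k \<noteq> 0 \<and> ?z = k *s w" using point_eqD[OF w(2,1) of_real_vec_nonzero[OF z(1)]] ..
    then have "ternary_cubic h ?z = 0" using w(3) by (simp add: tern_scale)
    then show ?thesis unfolding tern_of_real by simp
  qed
  define K where "K = complex_of_real (- h 3 0)"
  have form: "cubic_form e z = K * spectral_cubic a b c d z" for z
  proof -
    have "ternary_cubic h z = (\<Sum>j\<le>3. \<Sum>l\<le>3 - j. K * (of_real (spectral_coeff a b c d j l) * (z $ 1 ^ (3 - j - l) * z $ 2 ^ j * z $ 3 ^ l)))"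
      unfolding ternary_cubic_def
    proof (intro sum.cong refl)
      fix j l assume "j \<in> {..3::nat}" "l \<in> {..3 - j}"
      then have "h j l = - h 3 0 * spectral_coeff a b c d j l"
        by (intro spec_zeros_imp_proportional[OF dist zeros]) auto
      then show "of_real (h j l) * (z $ 1 ^ (3 - j - l) * z $ 2 ^ j * z $ 3 ^ l) =
        K * (of_real (spectral_coeff a b c d j l) * (z $ 1 ^ (3 - j - l) * z $ 2 ^ j * z $ 3 ^ l))"
        unfolding K_def by (simp add: mult_ac)
    qed
    then show ?thesis unfolding e spec_eq_tern ternary_cubic_def sum_distrib_left .
  qed
  obtain v :: "complex^3" where v: "v$2 * v$3 = of_real (pair_at 1 s)" "v$1 * v$3 = of_real (pair_at 2 s)" "v$1 * v$2 = of_real (pair_at 3 s)"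
    "of_real (gaps a $ 1) * v$1 + of_real (gaps a $ 2) * v$2 + of_real (gaps a $ 3) * v$3 = of_real cycle_slope"
    "2 * (of_real (pair_at 1 s) * v$1 + of_real (pair_at 2 s) * v$2 + of_real (pair_at 3 s) * v$3) = 3 * of_real (cycle_at s)"
    using double_root_critical[OF r r'] by blast
  define A where "A k = complex_of_real (a $ k)" for k
  define B where "B k = complex_of_real (b $ k)" for k
  \<comment> \<open>Solve for a point whose second and third diagonal forms are v_2 and v_3; the
    first is then v_1 by the linear relation.\<close>
  define z1 where "z1 = (v$2 - v$3 - (B 2 - B 3)) / (A 2 - A 3)"
  define z :: "complex^3" where "z = vector [z1, B 2 + A 2 * z1 - v$2, 1]"
  have A23: "A 2 - A 3 \<noteq> 0" using dist[of 2 3] by (simp add: A_def)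
  have l2: "diag_form a b 2 z = v$2" by (simp add: diag_form_def z_def A_def B_def)
  have "(A 2 - A 3) * z1 = v$2 - v$3 - (B 2 - B 3)" using A23 by (simp add: z1_def)
  then have l3: "diag_form a b 3 z = v$3" by (simp add: diag_form_def z_def A_def B_def algebra_simps)
  have l1: "diag_form a b 1 z = v$1"
  proof -
    have "of_real (gaps a $ 1) * diag_form a b 1 z + of_real (gaps a $ 2) * diag_form a b 2 z + of_real (gaps a $ 3) * diag_form a b 3 z = of_real cycle_slope"
      by (simp add: diag_form_def z_def cycle_slope_def gaps_def sum_3 algebra_simps)
    then have "of_real (gaps a $ 1) * diag_form a b 1 z = of_real (gaps a $ 1) * v$1"
      using v(4) unfolding l2 l3 by (metis add_right_cancel)
    then show ?thesis using dif_nonzero[of 1] by simp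
  qed
  have z0: "z \<noteq> 0" and z3: "z $ 3 = 1" by (auto simp: z_def vec_eq_iff forall_3)
  have sing: "diag_form a b 1 z * diag_form a b 2 z * diag_form a b 3 z = of_real (cycle_at s) / 2"
  proof -
    have "6 * (v$1 * v$2 * v$3) = 2 * ((v$2 * v$3) * v$1 + (v$1 * v$3) * v$2 + (v$1 * v$2) * v$3)" by (simp add: algebra_simps)
    also have "\<dots> = 3 * of_real (cycle_at s)" unfolding v(1-3) by (rule v(5))
    finally show ?thesis unfolding l1 l2 l3 by (simp add: mult.assoc mult.commute[of _ 2])
  qed
  have "spectral_cubic a b (\<chi> k. pair_at k s) (cycle_at s) z = 0"
  proof -
    have lin0: "p - q + l = 0" if "p = l / 2" "2 * q = 3 * l" for p q l :: complex
    proof -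
      have "2 * (p - q + l) = 2 * p - 2 * q + 2 * l" by (simp add: algebra_simps)
      then show ?thesis unfolding that by simp
    qed
    show ?thesis
      unfolding spectral_cubic_def z3 using lin0[OF sing] v(5) unfolding l1 l2 l3 by simp
  qed
  then have F0: "cubic_form e z = 0" unfolding form spec_shift by simp
  have ellv: "complex_of_real (cycle_at s) = 2 * (v$1 * v$2 * v$3)" using sing unfolding l1 l2 l3 by (simp add: mult.commute)
  have "partial_deriv i (cubic_form e) z = 0" for i
  proof -
    let ?y = "\<lambda>w. \<chi> j. if j = i then w else z $ j"
    define u where "u = (\<lambda>k. of_real (b $ k) * (if i = 3 then 1 else 0) + of_real (a $ k) * (if i = 1 then 1 else 0) - (if i = 2 then 1 else 0 :: complex))"
    have self: "?y (z $ i) = z" by (simp add: vec_eq_iff)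
    have dl: "((\<lambda>w. diag_form a b k (?y w)) has_field_derivative u k) (at (z $ i))" for k
      unfolding diag_form_def u_def using exhaust_3[of i] by (auto intro!: derivative_eq_intros)
    have d3: "((\<lambda>w. ?y w $ 3) has_field_derivative (if i = 3 then 1 else 0)) (at (z $ i))"
      using exhaust_3[of i] by (auto intro!: derivative_eq_intros)
    have "((\<lambda>w. spectral_cubic a b (\<chi> k. pair_at k s) (cycle_at s) (?y w)) has_field_derivative 0) (at (z $ i))"
      unfolding spectral_cubic_def
      apply (rule derivative_eq_intros dl d3 refl)+
      unfolding self l1 l2 l3 z3 vec_lambda_beta v(1-3)[symmetric] ellv
      by (simp add: algebra_simps)
    then have "((\<lambda>w. cubic_form e (?y w)) has_field_derivative K * 0) (at (z $ i))"
      unfolding form spec_shift[of s, symmetric] by (rule DERIV_cmult)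
    then show ?thesis unfolding partial_deriv_def by (simp add: DERIV_imp_deriv)
  qed
  then show False using reg[OF z0 F0] by blast
qed

end

section \<open>The flow\<close>

lemma flow_component:
  assumes X: "flow_solution (diag a) X" and d: "i \<noteq> j" "i \<noteq> k" "j \<noteq> k"
  shows "((\<lambda>t. X t $ i $ j) has_real_derivative
    (a $ j - a $ i) * (X t $ i $ j * (X t $ i $ i + X t $ j $ j) + X t $ i $ k * X t $ k $ j)) (at t)"
proof -
  have U: "{i, j, k} = UNIV" by (rule card_eq_UNIV_imp_eq_UNIV) (use d in simp_all)
  have su: "sum f UNIV = f i + f j + f k" for f :: "3 \<Rightarrow> real"
    unfolding U[symmetric] using d by simp
  let ?D = "(X t ** X t) ** diag a - diag a ** (X t ** X t)"
  have "(X has_vector_derivative ?D) (at t)" using X by (simp add: flow_solution_def)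
  then have "((\<lambda>t. X t $ i $ j) has_vector_derivative ?D $ i $ j) (at t)"
    by (intro bounded_linear.has_vector_derivative[OF bounded_linear_vec_nth])
  moreover have "?D $ i $ j = (a $ j - a $ i) * (X t $ i $ j * (X t $ i $ i + X t $ j $ j) + X t $ i $ k * X t $ k $ j)"
    using d by (simp add: matrix_matrix_mult_def diag_def su algebra_simps)
  ultimately show ?thesis by (simp add: has_real_derivative_iff_has_vector_derivative)
qed

lemma bounded_bilinear_matrix_mult: "bounded_bilinear ((**) :: real^3^3 \<Rightarrow> real^3^3 \<Rightarrow> real^3^3)"
  unfolding bilinear_conv_bounded_bilinear[symmetric] bilinear_def
  by (intro conjI allI linearI)
    (simp_all add: vec_eq_iff matrix_matrix_mult_def sum.distrib distrib_left distrib_right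
      sum_distrib_left mult.left_commute mult.assoc)

lemma flow_field_lipschitz:
  fixes A :: "real^3^3"
  defines "V \<equiv> \<lambda>Z. (Z ** Z) ** A - A ** (Z ** Z)"
  shows "\<exists>K. \<forall>x y. norm x \<le> B \<longrightarrow> norm y \<le> B \<longrightarrow> norm (V x - V y) \<le> K * norm (x - y)"
proof -
  note bb = bounded_bilinear_matrix_mult
  note diff_left = bounded_bilinear.diff_left[OF bb] and diff_right = bounded_bilinear.diff_right[OF bb]
  obtain K where "0 < K \<and> (\<forall>(Z :: real^3^3) (W :: real^3^3). norm (Z ** W) \<le> norm Z * norm W * K)"
    using bounded_bilinear.pos_bounded[OF bb] ..
  then have K: "K > 0" "\<And>(Z :: real^3^3) (W :: real^3^3). norm (Z ** W) \<le> norm Z * norm W * K" by simp_all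
  show ?thesis
  proof (intro exI allI impI)
    fix x y :: "real^3^3" assume xy: "norm x \<le> B" "norm y \<le> B"
    have sq: "norm (x ** x - y ** y) \<le> 2 * B * K * norm (x - y)"
    proof -
      have "x ** x - y ** y = x ** (x - y) + (x - y) ** y" by (simp add: diff_left diff_right)
      also have "norm \<dots> \<le> norm x * norm (x - y) * K + norm (x - y) * norm y * K"
        by (intro norm_triangle_le add_mono K)
      also have "\<dots> \<le> B * norm (x - y) * K + norm (x - y) * B * K"
        using xy K(1) by (intro add_mono mult_right_mono mult_left_mono) auto
      finally show ?thesis by (simp add: mult_ac)
    qed
    have "V x - V y = (x ** x - y ** y) ** A - A ** (x ** x - y ** y)" by (simp add: V_def diff_left diff_right)
    also have "norm \<dots> \<le> norm (x ** x - y ** y) * norm A * K + norm A * norm (x ** x - y ** y) * K"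
      by (intro norm_triangle_le_diff add_mono K)
    also have "\<dots> = 2 * norm A * K * norm (x ** x - y ** y)" by simp
    also have "\<dots> \<le> 2 * norm A * K * (2 * B * K * norm (x - y))"
      using sq K(1) by (intro mult_left_mono) auto
    also have "\<dots> = (2 * norm A * K * (2 * B * K)) * norm (x - y)" by simp
    finally show "norm (V x - V y) \<le> (2 * norm A * K * (2 * B * K)) * norm (x - y)" .
  qed
qed

lemma flow_unique:
  assumes X: "flow_solution A X" and Y: "flow_solution A Y" and eq: "X t0 = Y t0"
  shows "X t = Y t"
proof -
  have "(X has_vector_derivative ((X t ** X t) ** A - A ** (X t ** X t))) (at t)"
    "(Y has_vector_derivative ((Y t ** Y t) ** A - A ** (Y t ** Y t))) (at t)" for t
    using X Y unfolding flow_solution_def by auto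
  from ode_unique[of X "\<lambda>Z. (Z ** Z) ** A - A ** (Z ** Z)", OF this flow_field_lipschitz eq] show ?thesis .
qed

definition conj_by :: "real^3 \<Rightarrow> real^3^3 \<Rightarrow> real^3^3" where
  "conj_by e X = (\<chi> i j. e $ i * X $ i $ j / e $ j)"

lemma PD3_act_conj_by:
  assumes "\<forall>i. e $ i \<noteq> 0"
  shows "PD3_act (scalars3 #>\<^bsub>D3\<^esub> diag e) X = conj_by e X"
  unfolding PD3_act_coset[OF assms] matrix_inv_diag[OF assms] conj_by_def
  by (simp add: vec_eq_iff diag_conj divide_inverse)

text \<open>Conjugation by a diagonal matrix is multiplicative and fixes \<open>diag a\<close>, so
  it commutes with the vector field.\<close>

lemma flow_conj_by:
  assumes X: "flow_solution (diag a) X" and e: "\<forall>i. e $ i \<noteq> 0"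
  shows "flow_solution (diag a) (\<lambda>t. conj_by e (X t))"
  unfolding flow_solution_def
proof
  fix t
  have diag_form: "linear (conj_by e)"
    by (rule linearI)
      (simp_all add: conj_by_def vec_eq_iff distrib_left add_divide_distrib mult.left_commute mult.assoc)
  then have bl: "bounded_linear (conj_by e)" by (simp add: linear_conv_bounded_linear)
  have mult: "conj_by e Y ** conj_by e Z = conj_by e (Y ** Z)" for Y Z
  proof -
    have "e $ i * Y $ i $ k / e $ k * (e $ k * Z $ k $ j / e $ j) = e $ i * (Y $ i $ k * Z $ k $ j) / e $ j" for i j k
      using e by (simp add: field_simps)
    then show ?thesis
      by (simp only: conj_by_def matrix_matrix_mult_def vec_eq_iff vec_lambda_beta sum_distrib_left sum_divide_distrib) simp
  qed
  have da: "conj_by e (diag a) = diag a" using e by (simp add: conj_by_def diag_def vec_eq_iff)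
  let ?D = "(X t ** X t) ** diag a - diag a ** (X t ** X t)"
  have "((\<lambda>t. conj_by e (X t)) has_vector_derivative conj_by e ?D) (at t)"
    using X by (intro bounded_linear.has_vector_derivative[OF bl]) (simp add: flow_solution_def)
  moreover have "conj_by e ?D = (conj_by e (X t) ** conj_by e (X t)) ** diag a - diag a ** (conj_by e (X t) ** conj_by e (X t))"
    using mult[of "X t ** X t" "diag a"] mult[of "diag a" "X t ** X t"] mult[of "X t" "X t"] da
      linear_diff[OF diag_form] by simp
  ultimately show "((\<lambda>t. conj_by e (X t)) has_vector_derivative
     (conj_by e (X t) ** conj_by e (X t)) ** diag a - diag a ** (conj_by e (X t) ** conj_by e (X t))) (at t)"
    by simp
qed

lemma flow_shift:
  assumes "flow_solution A X"
  shows "flow_solution A (\<lambda>t. X (t + \<tau>))"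
  unfolding flow_solution_def
proof
  fix t
  have "(X has_vector_derivative ((X (t + \<tau>) ** X (t + \<tau>)) ** A - A ** (X (t + \<tau>) ** X (t + \<tau>)))) (at (t + \<tau>))"
    using assms by (simp add: flow_solution_def)
  moreover have "((\<lambda>t. t + \<tau>) has_vector_derivative 1) (at t)" by (auto intro!: derivative_eq_intros)
  ultimately have "(X \<circ> (\<lambda>t. t + \<tau>) has_vector_derivative
      1 *\<^sub>R ((X (t + \<tau>) ** X (t + \<tau>)) ** A - A ** (X (t + \<tau>) ** X (t + \<tau>)))) (at t)"
    by (intro vector_diff_chain_at) auto
  then show "((\<lambda>t. X (t + \<tau>)) has_vector_derivative
      ((X (t + \<tau>) ** X (t + \<tau>)) ** A - A ** (X (t + \<tau>) ** X (t + \<tau>)))) (at t)"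
    by (simp add: comp_def)
qed

text \<open>The numbers \<open>e, f\<close> are the ratios of the diagonal entries of the conjugating matrix.\<close>

lemma gauge_exists:
  fixes x12 :: real
  assumes p: "y12 * y21 = x12 * x21" "y23 * y32 = x23 * x32" "y31 * y13 = x31 * x13"
    and q: "y12 * y23 * y31 = x12 * x23 * x31" and r: "y13 * y32 * y21 = x13 * x32 * x21"
    and z: "y12 = 0 \<longleftrightarrow> x12 = 0" "y21 = 0 \<longleftrightarrow> x21 = 0" "y23 = 0 \<longleftrightarrow> x23 = 0" "y32 = 0 \<longleftrightarrow> x32 = 0"
      "y31 = 0 \<longleftrightarrow> x31 = 0" "y13 = 0 \<longleftrightarrow> x13 = 0"
    and irr: "\<not> (x21 = 0 \<and> x31 = 0)" "\<not> (x21 = 0 \<and> x23 = 0)" "\<not> (x31 = 0 \<and> x32 = 0)"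
      "\<not> (x12 = 0 \<and> x13 = 0)" "\<not> (x12 = 0 \<and> x32 = 0)" "\<not> (x13 = 0 \<and> x23 = 0)"
  shows "\<exists>e f. e \<noteq> 0 \<and> f \<noteq> 0 \<and> y12 * e = x12 \<and> y21 = e * x21 \<and> y13 * f = x13 \<and> y31 = f * x31
    \<and> y23 * f = e * x23 \<and> y32 * e = f * x32"
proof -
  \<comment> \<open>With first diagonal entry 1, the ratios e and f are read off from two nonzero
    entries linking all three indices; which two depends on the vanishing entry in column 1.\<close>
  consider (A) "x21 \<noteq> 0" "x31 \<noteq> 0" | (B) "x21 = 0" | (C) "x31 = 0" by blast
  then show ?thesis
  proof cases
    case A
    have y: "y21 \<noteq> 0" "y31 \<noteq> 0" using A z by auto
    \<comment> \<open>Compatibility at the entry (2,3). It comes from the cycle through 12, 23, 31;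
      if \<open>x12\<close> is 0 this cycle carries no information, and the opposite one together
      with the pair products replaces it.\<close>
    have k1: "y23 * x21 * y31 = y21 * x31 * x23"
    proof (cases "x12 = 0")
      case False
      then have nz: "y12 \<noteq> 0" using z by simp
      have "(x12 * y12) * (y23 * x21 * y31) = (y12 * y23 * y31) * (x12 * x21)" by (simp add: mult_ac)
      also have "\<dots> = (x12 * y12) * (y21 * x31 * x23)" unfolding q p(1)[symmetric] by (simp add: mult_ac)
      finally show ?thesis using False nz by simp
    next
      case True
      then have nz: "x13 \<noteq> 0" "x32 \<noteq> 0" "y13 \<noteq> 0" "y32 \<noteq> 0" using irr z by auto
      have "(y32 * x32 * x13 * y13) * (y23 * x21 * y31) = (y23 * y32) * (x13 * x32 * x21) * (y31 * y13)" by (simp add: mult_ac)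
      also have "\<dots> = (x23 * x32) * (y13 * y32 * y21) * (x31 * x13)" unfolding p r ..
      also have "\<dots> = (y32 * x32 * x13 * y13) * (y21 * x31 * x23)" by (simp add: mult_ac)
      finally show ?thesis using nz by simp
    qed
    have k2: "y32 * y21 * x31 = y31 * x32 * x21"
    proof (cases "x13 = 0")
      case False
      then have nz: "y13 \<noteq> 0" using z by simp
      have "(x13 * y13) * (y32 * y21 * x31) = (y13 * y32 * y21) * (x31 * x13)" by (simp add: mult_ac)
      also have "\<dots> = (x13 * y13) * (y31 * x32 * x21)" unfolding r p(3)[symmetric] by (simp add: mult_ac)
      finally show ?thesis using False nz by simp
    next
      case True
      then have nz: "x12 \<noteq> 0" "x23 \<noteq> 0" "y12 \<noteq> 0" "y23 \<noteq> 0" using irr z by auto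
      have "(y23 * x23 * x12 * y12) * (y32 * y21 * x31) = (y23 * y32) * (x12 * x23 * x31) * (y12 * y21)" by (simp add: mult_ac)
      also have "\<dots> = (x23 * x32) * (y12 * y23 * y31) * (x12 * x21)" unfolding p q ..
      also have "\<dots> = (y23 * x23 * x12 * y12) * (y31 * x32 * x21)" by (simp add: mult_ac)
      finally show ?thesis using nz by simp
    qed
    show ?thesis
      using A y p k1 k2
      by (intro exI[of _ "y21 / x21"] exI[of _ "y31 / x31"]) (simp add: field_simps)
  next
    case B
    then have nz: "x31 \<noteq> 0" "x23 \<noteq> 0" "y31 \<noteq> 0" "y23 \<noteq> 0" "y21 = 0" using irr z by auto
    show ?thesis
      using B nz p q
      by (intro exI[of _ "y31 / x31 * (y23 / x23)"] exI[of _ "y31 / x31"]) (simp add: field_simps)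
  next
    case C
    then have nz: "x21 \<noteq> 0" "x32 \<noteq> 0" "y21 \<noteq> 0" "y32 \<noteq> 0" "y31 = 0" using irr z by auto
    show ?thesis
      using C nz p r
      by (intro exI[of _ "y21 / x21"] exI[of _ "y21 / x21 * (y32 / x32)"]) (simp add: field_simps)
  qed
qed

section \<open>Isospectral matrices on a smooth curve and the reduced equation\<close>

locale smooth_data = spec_data +
  assumes nondeg_data: "\<And>s. cycle_at s ^ 2 = 4 * (pair_at 1 s * pair_at 2 s * pair_at 3 s) \<Longrightarrow>
    cycle_slope * cycle_at s \<noteq> 2 * (gaps a $ 1 * pair_at 2 s * pair_at 3 s + gaps a $ 2 * pair_at 1 s * pair_at 3 s + gaps a $ 3 * pair_at 1 s * pair_at 2 s)"
begin

definition "g0 = d^2 - 4 * (c$1 * c$2 * c$3)"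
definition "g1 = 2 * d * cycle_slope - 4 * (gaps a $ 1 * c$2 * c$3 + gaps a $ 2 * c$1 * c$3 + gaps a $ 3 * c$1 * c$2)"
definition "g2 = cycle_slope^2 - 4 * (gaps a $ 1 * gaps a $ 2 * c$3 + gaps a $ 1 * gaps a $ 3 * c$2 + gaps a $ 2 * gaps a $ 3 * c$1)"
definition "g3 = - 4 * (gaps a $ 1 * gaps a $ 2 * gaps a $ 3)"

lemma pot_eq: "cubic_pot g0 g1 g2 g3 s = cycle_at s ^ 2 - 4 * (pair_at 1 s * pair_at 2 s * pair_at 3 s)"
  unfolding cubic_pot_def g0_def g1_def g2_def g3_def cycle_at_def pair_at_def
  by (simp add: algebra_simps power2_eq_square power3_eq_cube)

lemma force_eq: "cubic_force g1 g2 g3 s = cycle_slope * cycle_at s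
    - 2 * (gaps a $ 1 * pair_at 2 s * pair_at 3 s + gaps a $ 2 * pair_at 1 s * pair_at 3 s + gaps a $ 3 * pair_at 1 s * pair_at 2 s)"
  unfolding cubic_force_def g1_def g2_def g3_def cycle_at_def pair_at_def
  by (simp add: field_simps power2_eq_square)

sublocale cubic_osc g0 g1 g2 g3
proof
  show "g3 \<noteq> 0" using dif_nonzero by (simp add: g3_def)
  show "cubic_force g1 g2 g3 x \<noteq> 0" if "cubic_pot g0 g1 g2 g3 x = 0" for x
    using nondeg_data[of x] that unfolding pot_eq force_eq by simp
qed

lemma fit_ang: "fit X s \<Longrightarrow> cycle_diff X ^ 2 = G s"
  unfolding pot_eq by (simp add: fitD(2-5)[symmetric] cycle_diff_def) (simp add: algebra_simps power2_eq_square)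

lemma not_two_zero:
  assumes "cycle_at s = 0" "i \<noteq> j" "pair_at i s = 0" "pair_at j s = 0"
  shows False
  using nondeg_data[of s] assms exhaust_3[of i] exhaust_3[of j] by auto

text \<open>Each 3-cycle uses every row and every column once. Two zeros in a row or column
  therefore kill both cyclic products and two pair products, against
  \<open>not_two_zero\<close>.\<close>

lemma irreducible:
  assumes f: "fit X s" and d: "i \<noteq> j" "i \<noteq> k" "j \<noteq> k"
  shows "\<not> (X $ i $ j = 0 \<and> X $ i $ k = 0)" "\<not> (X $ j $ i = 0 \<and> X $ k $ i = 0)"
proof -
  note [simp] = fitD(2-5)[OF f, symmetric]
  have c: "(i = 1 \<and> j = 2 \<and> k = 3) \<or> (i = 1 \<and> j = 3 \<and> k = 2) \<or> (i = 2 \<and> j = 1 \<and> k = 3) \<or>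
    (i = 2 \<and> j = 3 \<and> k = 1) \<or> (i = 3 \<and> j = 1 \<and> k = 2) \<or> (i = 3 \<and> j = 2 \<and> k = 1)"
    using d exhaust_3[of i] exhaust_3[of j] exhaust_3[of k] by auto
  show "\<not> (X $ i $ j = 0 \<and> X $ i $ k = 0)"
    using c not_two_zero[of s 1 2] not_two_zero[of s 1 3] not_two_zero[of s 2 3] by auto
  show "\<not> (X $ j $ i = 0 \<and> X $ k $ i = 0)"
    using c not_two_zero[of s 1 2] not_two_zero[of s 1 3] not_two_zero[of s 2 3] by auto
qed

text \<open>If \<open>pair_at k s\<close> is 0, one of the two opposite entries vanishes. The entry
  (i, j) lies on the cycle with twice the product \<open>cycle_at s + cycle_diff X\<close>, the
  entry (j, i) on the one with the difference, and irreducibility rules out that another factor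
  causes the zero.\<close>

lemma entry_zero_iff:
  assumes f: "fit X s" and c: "cyc i j k"
  shows "X $ i $ j = 0 \<longleftrightarrow> pair_at k s = 0 \<and> cycle_diff X = - cycle_at s"
    and "X $ j $ i = 0 \<longleftrightarrow> pair_at k s = 0 \<and> cycle_diff X = cycle_at s"
proof -
  have d: "i \<noteq> j" "i \<noteq> k" "j \<noteq> k" "j \<noteq> i" "k \<noteq> i" "k \<noteq> j" using c by (auto elim: cycE)
  note F = fit_cyc[OF f c]
  have q: "2 * (X $ i $ j * X $ j $ k * X $ k $ i) = cycle_at s + cycle_diff X"
    and r: "2 * (X $ i $ k * X $ k $ j * X $ j $ i) = cycle_at s - cycle_diff X" using F(2,3) by linarith+
  show "X $ i $ j = 0 \<longleftrightarrow> pair_at k s = 0 \<and> cycle_diff X = - cycle_at s"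
  proof
    assume "X $ i $ j = 0" then show "pair_at k s = 0 \<and> cycle_diff X = - cycle_at s" using F(1) q by auto
  next
    assume h: "pair_at k s = 0 \<and> cycle_diff X = - cycle_at s"
    show "X $ i $ j = 0"
    proof (rule ccontr)
      assume n: "X $ i $ j \<noteq> 0"
      then have "X $ j $ i = 0" "X $ j $ k = 0 \<or> X $ k $ i = 0" using F(1) q h by auto
      then show False using irreducible[OF f, of j i k] irreducible[OF f, of i j k] d by auto
    qed
  qed
  show "X $ j $ i = 0 \<longleftrightarrow> pair_at k s = 0 \<and> cycle_diff X = cycle_at s"
  proof
    assume "X $ j $ i = 0" then show "pair_at k s = 0 \<and> cycle_diff X = cycle_at s" using F(1) r by auto
  next
    assume h: "pair_at k s = 0 \<and> cycle_diff X = cycle_at s"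
    show "X $ j $ i = 0"
    proof (rule ccontr)
      assume n: "X $ j $ i \<noteq> 0"
      then have "X $ i $ j = 0" "X $ i $ k = 0 \<or> X $ k $ j = 0" using F(1) r h by auto
      then show False using irreducible[OF f, of i j k] irreducible[OF f, of j i k] d by auto
    qed
  qed
qed

text \<open>The parameter and \<open>cycle_diff\<close> fix all pair products and both cyclic
  products, and by \<open>entry_zero_iff\<close> also the pattern of zeros, as
  \<open>gauge_exists\<close> requires.\<close>

lemma fit_gauge:
  assumes X: "fit X s" and Y: "fit Y s" and cycle_diff: "cycle_diff Y = cycle_diff X"
  shows "\<exists>e. (\<forall>i. e $ i \<noteq> 0) \<and> Y = conj_by e X"
proof -
  have q: "2 * (Z$1$2 * Z$2$3 * Z$3$1) = cycle_at s + cycle_diff Z"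
    and r: "2 * (Z$1$3 * Z$3$2 * Z$2$1) = cycle_at s - cycle_diff Z" if "fit Z s" for Z
    using fitD(5)[OF that] unfolding cycle_diff_def by linarith+
  have cy: "cyc 1 2 3" "cyc 2 3 1" "cyc 3 1 2" by (simp_all add: cyc_def)
  have "\<exists>e f. e \<noteq> 0 \<and> f \<noteq> 0 \<and> Y$1$2 * e = X$1$2 \<and> Y$2$1 = e * X$2$1 \<and> Y$1$3 * f = X$1$3 \<and> Y$3$1 = f * X$3$1
    \<and> Y$2$3 * f = e * X$2$3 \<and> Y$3$2 * e = f * X$3$2"
  proof (rule gauge_exists)
    show "Y$1$2 * Y$2$3 * Y$3$1 = X$1$2 * X$2$3 * X$3$1" using q[OF X] q[OF Y] cycle_diff by simp
    show "Y$1$3 * Y$3$2 * Y$2$1 = X$1$3 * X$3$2 * X$2$1" using r[OF X] r[OF Y] cycle_diff by simp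
  qed (use fitD(2-4)[OF X] fitD(2-4)[OF Y] not_two_zero[of s 1 2] not_two_zero[of s 1 3] not_two_zero[of s 2 3] in
      \<open>auto simp: entry_zero_iff[OF X cy(1)] entry_zero_iff[OF Y cy(1)] entry_zero_iff[OF X cy(2)]
        entry_zero_iff[OF Y cy(2)] entry_zero_iff[OF X cy(3)] entry_zero_iff[OF Y cy(3)] cycle_diff\<close>)
  then obtain e f where ef: "e \<noteq> 0" "f \<noteq> 0" "Y$1$2 * e = X$1$2" "Y$2$1 = e * X$2$1" "Y$1$3 * f = X$1$3" "Y$3$1 = f * X$3$1"
    "Y$2$3 * f = e * X$2$3" "Y$3$2 * e = f * X$3$2" by blast
  show ?thesis
  proof (intro exI[of _ "vector [1, e, f]"] conjI)
    show "\<forall>i. (vector [1, e, f] :: real^3) $ i \<noteq> 0" using ef by (simp add: forall_3)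
    show "Y = conj_by (vector [1, e, f]) X"
      using ef fitD(1)[OF X] fitD(1)[OF Y] by (simp add: vec_eq_iff forall_3 conj_by_def field_simps)
  qed
qed

lemma flow_sol:
  assumes X: "flow_solution (diag a) X" and f: "\<And>t. fit (X t) (s t)"
  shows "sol s (\<lambda>t. cycle_diff (X t))"
  unfolding sol_def
proof (intro allI conjI)
  fix t
  have D: "(1::3) \<noteq> 2" "(2::3) \<noteq> 1" "(1::3) \<noteq> 3" "(3::3) \<noteq> 1" "(2::3) \<noteq> 3" "(3::3) \<noteq> 2" by simp_all
  have b: "X t $ k $ k = b $ k" for k using fitD(1)[OF f] .
  define x where "x i j = X t $ i $ j" for i j
  note der = flow_component[OF X D(1,3,5), of t] flow_component[OF X D(2,5,3), of t]
    flow_component[OF X D(3,1,6), of t] flow_component[OF X D(4,6,1), of t]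
    flow_component[OF X D(5,2,4), of t] flow_component[OF X D(6,4,2), of t]
  note der' = der[unfolded b x_def[symmetric]]
  \<comment> \<open>The parameter is not given as a differentiable function; it is recovered from
    the first pair product.\<close>
  have s: "s = (\<lambda>t. (X t $ 2 $ 3 * X t $ 3 $ 2 - c $ 1) / gaps a $ 1)"
    using fitD(2)[OF f] dif_nonzero[of 1] by (simp add: fun_eq_iff pair_at_def)
  have d1: "gaps a $ 1 = a$2 - a$3" by (simp add: gaps_def)
  have "((\<lambda>t. X t $ 2 $ 3 * X t $ 3 $ 2 - c $ 1) has_real_derivative gaps a $ 1 * cycle_diff (X t)) (at t)"
    apply (rule derivative_eq_intros der' refl)+
    unfolding cycle_diff_def x_def[symmetric] d1 by (simp add: algebra_simps)
  from DERIV_cdivide[OF this, of "gaps a $ 1"] show "(s has_real_derivative cycle_diff (X t)) (at t)"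
    unfolding s using dif_nonzero[of 1] by simp
  have p: "x 2 3 * x 3 2 = pair_at 1 (s t)" "x 3 1 * x 1 3 = pair_at 2 (s t)" "x 1 2 * x 2 1 = pair_at 3 (s t)"
    "x 1 2 * x 2 3 * x 3 1 + x 1 3 * x 3 2 * x 2 1 = cycle_at (s t)"
    using fitD(2-5)[OF f[of t]] by (simp_all add: x_def)
  have bt: "cycle_slope = (a$2 - a$3) * b$1 + (a$3 - a$1) * b$2 + (a$1 - a$2) * b$3"
    by (simp add: cycle_slope_def sum_3 gaps_def)
  have dd: "gaps a $ 1 = a$2 - a$3" "gaps a $ 2 = a$3 - a$1" "gaps a $ 3 = a$1 - a$2" by (simp_all add: gaps_def)
  show "((\<lambda>t. cycle_diff (X t)) has_real_derivative H (s t)) (at t)"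
    unfolding cycle_diff_def force_eq
    apply (rule derivative_eq_intros der' refl)+
    unfolding x_def[symmetric] bt dd p[symmetric] by (simp add: algebra_simps)
  show "cycle_diff (X t) ^ 2 = G (s t)" by (rule fit_ang[OF f])
qed

end

definition diag_entry :: "real^3 \<Rightarrow> real^3^3 \<Rightarrow> 3 \<Rightarrow> real^3 \<Rightarrow> real" where
  "diag_entry a X k z = X $ k $ k * z $ 3 + a $ k * z $ 1 - z $ 2"

lemma dg_eq_lin: "(\<And>k. X $ k $ k = b $ k) \<Longrightarrow> diag_entry a X k z = diag_form a b k z"
  by (simp add: diag_entry_def diag_form_def)

lemma third_index_eq:
  assumes "i \<noteq> j" "i \<noteq> k" "j \<noteq> k"
  shows "- (i + j) = (k :: 3)"
  using third_index[OF assms(1)] assms by auto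

lemma L_form_eq:
  assumes "i \<noteq> j" "i \<noteq> k" "j \<noteq> k"
  shows "L_form (diag a) X i j z = X $ k $ i * X $ j $ k * z $ 3 - X $ j $ i * diag_entry a X k z"
  unfolding L_form_def Let_def third_index_eq[OF assms] diag_entry_def by (simp add: diag_def)

lemma L_form_transpose: "L_form A (transpose X) i j z = L_form A X j i z"
  by (simp add: L_form_def Let_def transpose_def add.commute mult.commute)

text \<open>Transposition preserves the spectral data, so only the vertices P need to be
  analysed.\<close>

lemma Q_vertex_transpose: "Q_vertex A X i = P_vertex A (transpose X) i"
  unfolding Q_vertex_def P_vertex_def L_line_def L_form_transpose ..

lemma L_form_scale: "L_form A X i j (r *s z) = r * L_form A X i j z"
  by (simp add: L_form_def Let_def algebra_simps)

lemma point_in_L_line_iff: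
  assumes "z \<noteq> 0"
  shows "point z \<in> L_line A X i j \<longleftrightarrow> L_form A X i j z = 0"
proof
  assume "point z \<in> L_line A X i j"
  then obtain w where w: "w \<noteq> 0" "point w = point z" "L_form A X i j w = 0"
    unfolding L_line_def by auto
  obtain r where "r \<noteq> 0 \<and> z = r *s w" using point_eqD[OF w(2,1) assms] ..
  then show "L_form A X i j z = 0" using w(3) by (simp add: L_form_scale)
qed (use assms in \<open>auto simp: L_line_def\<close>)

section \<open>The hexagon\<close>

text \<open>Up to sign, the cross product of the coefficient vectors of \<open>L\<^sub>i\<^sub>j\<close> and \<open>L\<^sub>i\<^sub>k\<close> in the coordinates
  \<open>z\<^sub>3\<close> and the diagonal entries \<open>j\<close> and \<open>k\<close> of \<open>X\<^sub>z\<close>.\<close>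

definition P_lift :: "real^3 \<Rightarrow> real^3^3 \<Rightarrow> 3 \<Rightarrow> 3 \<Rightarrow> 3 \<Rightarrow> real^3" where
  "P_lift a X i j k = (let z3 = X $ j $ i * X $ k $ i; vj = X $ j $ i ^ 2 * X $ k $ j; vk = X $ k $ i ^ 2 * X $ j $ k;
     z1 = (vj - vk - (X $ j $ j - X $ k $ k) * z3) / (a $ j - a $ k)
   in vector [z1, X $ j $ j * z3 + a $ j * z1 - vj, z3])"

lemma P_lift_coords:
  assumes "a $ j \<noteq> a $ k"
  shows "P_lift a X i j k $ 3 = X $ j $ i * X $ k $ i"
    and "diag_entry a X j (P_lift a X i j k) = X $ j $ i ^ 2 * X $ k $ j"
    and "diag_entry a X k (P_lift a X i j k) = X $ k $ i ^ 2 * X $ j $ k"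
proof -
  define z3 vj vk where "z3 = X $ j $ i * X $ k $ i" and "vj = X $ j $ i ^ 2 * X $ k $ j" and "vk = X $ k $ i ^ 2 * X $ j $ k"
  define z1 where "z1 = (vj - vk - (X $ j $ j - X $ k $ k) * z3) / (a $ j - a $ k)"
  have P: "P_lift a X i j k = vector [z1, X $ j $ j * z3 + a $ j * z1 - vj, z3]"
    unfolding P_lift_def Let_def z1_def z3_def vj_def vk_def ..
  have "(a $ j - a $ k) * z1 = vj - vk - (X $ j $ j - X $ k $ k) * z3" using assms by (simp add: z1_def)
  then show "P_lift a X i j k $ 3 = z3" "diag_entry a X j (P_lift a X i j k) = vj" "diag_entry a X k (P_lift a X i j k) = vk"
    unfolding P diag_entry_def by (simp_all add: algebra_simps)
qed

lemma vec_eq_by_dg: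
  assumes "a $ j \<noteq> a $ k" "z $ 3 = w $ 3" "diag_entry a X j z = diag_entry a X j w" "diag_entry a X k z = diag_entry a X k w"
  shows "z = w"
proof -
  have "(a $ j - a $ k) * z $ 1 = (a $ j - a $ k) * w $ 1"
    using assms(2-4) by (simp add: diag_entry_def algebra_simps)
  then have 1: "z $ 1 = w $ 1" using assms(1) by simp
  then have "z $ 2 = w $ 2" using assms(2,3) by (simp add: diag_entry_def)
  then show ?thesis using 1 assms(2) by (simp add: vec_eq_iff forall_3)
qed

lemma dg_scale: "diag_entry a X k (r *s z) = r * diag_entry a X k z"
  by (simp add: diag_entry_def algebra_simps)

text \<open>In the coordinates z3 and the diagonal entries j and k, the lift consists of monomials
  in \<open>X\<close> of equal weight under conjugation.\<close>

lemma P_lift_conj_by: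
  assumes "a $ j \<noteq> a $ k" and e: "\<forall>i. e $ i \<noteq> 0"
  shows "P_lift a (conj_by e X) i j k = (e $ j * e $ k / e $ i ^ 2) *s P_lift a X i j k"
proof (rule vec_eq_by_dg[OF assms(1)])
  have diag_entry: "diag_entry a X m z = diag_entry a (conj_by e X) m z" for m z using e by (simp add: diag_entry_def conj_by_def)
  show "P_lift a (conj_by e X) i j k $ 3 = ((e $ j * e $ k / e $ i ^ 2) *s P_lift a X i j k) $ 3"
    by (simp add: P_lift_coords[OF assms(1)] conj_by_def power2_eq_square)
  show "diag_entry a X j (P_lift a (conj_by e X) i j k) = diag_entry a X j ((e $ j * e $ k / e $ i ^ 2) *s P_lift a X i j k)"
    unfolding dg_scale P_lift_coords[OF assms(1)] unfolding diag_entry P_lift_coords[OF assms(1)]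
    using e by (simp add: conj_by_def power2_eq_square field_simps)
  show "diag_entry a X k (P_lift a (conj_by e X) i j k) = diag_entry a X k ((e $ j * e $ k / e $ i ^ 2) *s P_lift a X i j k)"
    unfolding dg_scale P_lift_coords[OF assms(1)] unfolding diag_entry P_lift_coords[OF assms(1)]
    using e by (simp add: conj_by_def power2_eq_square field_simps)
qed

lemma continuous_on_P_lift:
  assumes "\<And>i j. continuous_on T (\<lambda>t. X t $ i $ j)" "a $ j \<noteq> a $ k"
  shows "continuous_on T (\<lambda>t. P_lift a (X t) i j k)"
proof -
  have vec: "continuous_on T (\<lambda>t. vector [f t, g t, h t] :: real^3)"
    if A: "continuous_on T f" "continuous_on T g" "continuous_on T h" for f g h
  proof -
    have "continuous_on T (\<lambda>t. (vector [f t, g t, h t] :: real^3) $ m)" for m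
    proof -
      consider "m = 1" | "m = 2" | "m = 3" using exhaust_3 by blast
      then show ?thesis by cases (simp_all add: A)
    qed
    then have "continuous_on T (\<lambda>t. \<chi> m. (vector [f t, g t, h t] :: real^3) $ m)" by (rule continuous_on_vec_lambda)
    then show ?thesis unfolding vec_nth_inverse .
  qed
  show ?thesis
    unfolding P_lift_def Let_def
    by (rule vec; intro assms(1) continuous_on_divide continuous_on_diff continuous_on_add continuous_on_mult
        continuous_on_power continuous_on_const) (use assms(2) in simp_all)
qed

text \<open>Conjugation multiplies L_ij by e_j / e_i and so keeps its line. Hence the hexagon is
  periodic although the matrix is only quasi-periodic.\<close>

lemma hexagon_conj_by:
  assumes e: "\<forall>i. e $ i \<noteq> 0"
  shows "hexagon (diag a) (conj_by e X) = hexagon (diag a) X"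
proof -
  have L: "L_line (diag a) (conj_by e X) i j = L_line (diag a) X i j" if "i \<noteq> j" for i j
  proof -
    define k where "k = - (i + j)"
    have k: "i \<noteq> k" "j \<noteq> k"
    proof -
      have "card {i, j, k} = 3" using third_index[OF that] by (simp add: k_def)
      then show "i \<noteq> k" "j \<noteq> k" using that by (auto simp: card_insert_if split: if_splits)
    qed
    have "L_form (diag a) (conj_by e X) i j z = e $ j / e $ i * L_form (diag a) X i j z" for z
      unfolding L_form_eq[OF that k] using e by (simp add: conj_by_def diag_entry_def field_simps)
    then show ?thesis unfolding L_line_def using e by simp
  qed
  have "(\<forall>j. j \<noteq> i \<longrightarrow> p \<in> L_line (diag a) (conj_by e X) i j) \<longleftrightarrow> (\<forall>j. j \<noteq> i \<longrightarrow> p \<in> L_line (diag a) X i j)"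
    "(\<forall>j. j \<noteq> i \<longrightarrow> p \<in> L_line (diag a) (conj_by e X) j i) \<longleftrightarrow> (\<forall>j. j \<noteq> i \<longrightarrow> p \<in> L_line (diag a) X j i)" for i p
    using L by auto
  then show ?thesis unfolding hexagon_def P_vertex_def Q_vertex_def by (simp only:)
qed

context
  fixes a :: "real^3" and X :: "real^3^3" and i j k :: 3
  assumes d: "i \<noteq> j" "i \<noteq> k" "j \<noteq> k" and a: "a $ j \<noteq> a $ k"
    and irr: "\<not> (X $ j $ i = 0 \<and> X $ k $ i = 0)" "\<not> (X $ j $ i = 0 \<and> X $ j $ k = 0)" "\<not> (X $ k $ i = 0 \<and> X $ k $ j = 0)"
begin

lemma P_lift_nonzero: "P_lift a X i j k \<noteq> 0"
proof
  assume "P_lift a X i j k = 0"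
  then have "X $ j $ i * X $ k $ i = 0" "X $ j $ i ^ 2 * X $ k $ j = 0" "X $ k $ i ^ 2 * X $ j $ k = 0"
    using P_lift_coords[OF a, of X i] by (simp_all add: diag_entry_def)
  then show False using irr by auto
qed

lemma L_forms_zero_iff:
  "L_form (diag a) X i j z = 0 \<and> L_form (diag a) X i k z = 0 \<longleftrightarrow>
    X $ j $ i * diag_entry a X k z = X $ k $ i * X $ j $ k * z $ 3 \<and> X $ k $ i * diag_entry a X j z = X $ j $ i * X $ k $ j * z $ 3"
  using L_form_eq[OF d, of a X z] L_form_eq[of i k j a X z] d by auto

lemma P_lift_on_lines: "L_form (diag a) X i j (P_lift a X i j k) = 0 \<and> L_form (diag a) X i k (P_lift a X i j k) = 0"
  unfolding L_forms_zero_iff P_lift_coords[OF a] by (simp add: power2_eq_square)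

lemma L_forms_zero_imp_multiple:
  assumes "z \<noteq> 0" "L_form (diag a) X i j z = 0" "L_form (diag a) X i k z = 0"
  shows "\<exists>r. r \<noteq> 0 \<and> z = r *s P_lift a X i j k"
proof -
  have L: "X $ j $ i * diag_entry a X k z = X $ k $ i * X $ j $ k * z $ 3" "X $ k $ i * diag_entry a X j z = X $ j $ i * X $ k $ j * z $ 3"
    using assms L_forms_zero_iff by auto
  \<comment> \<open>The factor is read off from whichever coordinate of the lift is nonzero.\<close>
  have "\<exists>r. z $ 3 = r * (X $ j $ i * X $ k $ i) \<and> diag_entry a X j z = r * (X $ j $ i ^ 2 * X $ k $ j)
     \<and> diag_entry a X k z = r * (X $ k $ i ^ 2 * X $ j $ k)"
  proof (cases "X $ j $ i = 0")
    case True
    then have nz: "X $ k $ i \<noteq> 0" "X $ j $ k \<noteq> 0" using irr by auto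
    then have "z $ 3 = 0" "diag_entry a X j z = 0" using L True by auto
    then show ?thesis using nz True by (intro exI[of _ "diag_entry a X k z / (X $ k $ i ^ 2 * X $ j $ k)"]) simp
  next
    case j: False
    show ?thesis
    proof (cases "X $ k $ i = 0")
      case True
      then have nz: "X $ k $ j \<noteq> 0" using irr by auto
      then have "z $ 3 = 0" "diag_entry a X k z = 0" using L True j by auto
      then show ?thesis using nz True j by (intro exI[of _ "diag_entry a X j z / (X $ j $ i ^ 2 * X $ k $ j)"]) simp
    next
      case False
      then show ?thesis using L j
        by (intro exI[of _ "z $ 3 / (X $ j $ i * X $ k $ i)"]) (simp add: field_simps power2_eq_square)
    qed
  qed
  then obtain r where r: "z $ 3 = r * (X $ j $ i * X $ k $ i)" "diag_entry a X j z = r * (X $ j $ i ^ 2 * X $ k $ j)"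
     "diag_entry a X k z = r * (X $ k $ i ^ 2 * X $ j $ k)" by auto
  have "z = r *s P_lift a X i j k"
    by (rule vec_eq_by_dg[OF a, of _ _ X]) (simp_all add: r dg_scale P_lift_coords[OF a])
  moreover from this have "r \<noteq> 0" using assms(1) by auto
  ultimately show ?thesis by auto
qed

lemma P_vertex_eq: "P_vertex (diag a) X i = point (P_lift a X i j k)"
proof -
  have ball: "(\<forall>m. m \<noteq> i \<longrightarrow> Q m) \<longleftrightarrow> Q j \<and> Q k" for Q :: "3 \<Rightarrow> bool"
  proof -
    have "UNIV = {i, j, k}" by (rule card_eq_UNIV_imp_eq_UNIV[symmetric]) (use d in simp_all)
    then have "m = i \<or> m = j \<or> m = k" for m by auto
    then show ?thesis using d by metis
  qed
  show ?thesis unfolding P_vertex_def ball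
  proof (rule the_equality)
    show "point (P_lift a X i j k) \<in> L_line (diag a) X i j \<and> point (P_lift a X i j k) \<in> L_line (diag a) X i k"
      using P_lift_on_lines by (simp add: point_in_L_line_iff P_lift_nonzero)
  next
    fix p assume p: "p \<in> L_line (diag a) X i j \<and> p \<in> L_line (diag a) X i k"
    obtain z where z: "z \<noteq> 0" "p = point z" by (rule point_cases)
    then have "L_form (diag a) X i j z = 0" "L_form (diag a) X i k z = 0" using p by (simp_all add: point_in_L_line_iff)
    from L_forms_zero_imp_multiple[OF z(1) this] obtain r where "r \<noteq> 0 \<and> z = r *s P_lift a X i j k" ..
    then show "p = point (P_lift a X i j k)" using z(2) point_scale[OF P_lift_nonzero] by simp
  qed
qed

end

lemma spec_symmetric:
  assumes d: "i \<noteq> j" "i \<noteq> k" "j \<noteq> k"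
  shows "spectral_cubic a (\<chi> k. X $ k $ k) (pair_products X) (cycle_sum X) z = diag_entry a X i z * diag_entry a X j z * diag_entry a X k z
     - (X$j$k * X$k$j * diag_entry a X i z + X$i$k * X$k$i * diag_entry a X j z + X$i$j * X$j$i * diag_entry a X k z) * z $ 3 ^ 2
     + (X$i$j * X$j$k * X$k$i + X$i$k * X$k$j * X$j$i) * z $ 3 ^ 3"
proof -
  have c: "(i = 1 \<and> j = 2 \<and> k = 3) \<or> (i = 1 \<and> j = 3 \<and> k = 2) \<or> (i = 2 \<and> j = 1 \<and> k = 3) \<or>
    (i = 2 \<and> j = 3 \<and> k = 1) \<or> (i = 3 \<and> j = 1 \<and> k = 2) \<or> (i = 3 \<and> j = 2 \<and> k = 1)"
    using d exhaust_3[of i] exhaust_3[of j] exhaust_3[of k] by auto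
  have l: "diag_form a (\<chi> k. X $ k $ k) m z = diag_entry a X m z" for m by (simp add: diag_form_def diag_entry_def)
  show ?thesis
    using c unfolding spectral_cubic_def l pair_products_def cycle_sum_def
    by (elim disjE conjE) (simp_all add: algebra_simps)
qed

lemma P_lift_on_curve:
  assumes d: "i \<noteq> j" "i \<noteq> k" "j \<noteq> k" and a: "a $ j \<noteq> a $ k"
  shows "spectral_cubic a (\<chi> k. X $ k $ k) (pair_products X) (cycle_sum X) (P_lift a X i j k) = 0"
  unfolding spec_symmetric[OF d] P_lift_coords[OF a]
  by (simp add: algebra_simps power2_eq_square power3_eq_cube)


section \<open>Components of the real part over the potential well\<close>

lemma homogeneous_set:
  assumes hom: "\<And>r z. r \<noteq> 0 \<Longrightarrow> P (r *s z) \<longleftrightarrow> P z" and "z \<noteq> 0"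
  shows "point z \<in> {point w |w. w \<noteq> 0 \<and> P w} \<longleftrightarrow> P (z :: real^3)"
proof
  assume "point z \<in> {point w |w. w \<noteq> 0 \<and> P w}"
  then obtain w where w: "w \<noteq> 0" "point w = point z" "P w" by auto
  obtain r where "r \<noteq> 0 \<and> z = r *s w" using point_eqD[OF w(2,1) assms(2)] ..
  then show "P z" using w(3) hom by simp
qed (use assms(2) in auto)

lemma open_homogeneous_set:
  assumes hom: "\<And>r z. r \<noteq> 0 \<Longrightarrow> P (r *s z) \<longleftrightarrow> P z" and "open {z :: real^3. P z}"
  shows "open {point w |w. w \<noteq> 0 \<and> P w}"
proof -
  have "{z. z \<noteq> 0 \<and> point z \<in> {point w |w. w \<noteq> 0 \<and> P w}} = - {0} \<inter> {z. P z}"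
    using homogeneous_set[of P, OF hom] by auto
  then show ?thesis unfolding open_proj2_iff using assms(2) by (simp add: open_Int open_Compl)
qed

lemma component_clopen:
  assumes S: "S \<in> components R" and A: "open A" and B: "open B" and cov: "R \<subseteq> A \<union> B" and dis: "A \<inter> B \<inter> R = {}"
    and p: "p \<in> S" "p \<in> A"
  shows "S \<subseteq> A"
proof -
  have SR: "S \<subseteq> R" and con: "connected S" using S in_components_subset in_components_connected by auto
  have "A \<inter> S = {} \<or> B \<inter> S = {}"
    by (rule connectedD[OF con A B]) (use SR cov dis in auto)
  then have "B \<inter> S = {}" using p by auto
  then show ?thesis using SR cov by auto
qed

context spec_data
begin

text \<open>The condition \<open>minor\<close> attaches the parameter \<open>s\<close> to the point.
  It turns the cubic into the linear equation cycle_at z3 = u + v with u = p_j l_j and v = p_k l_k,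
  while u v is the product of all three p times z3^2. So (u - v)^2 and u^2 + v^2 are known multiples
  of z3^2.\<close>

lemma conic_square:
  fixes z :: "real^3"
  assumes z3: "z $ 3 \<noteq> 0" and F: "spectral_cubic a b c d z = 0" and cyc: "cyc i j k"
    and minor: "diag_form a b j z * diag_form a b k z = pair_at i s * z $ 3 ^ 2"
  shows "0 \<le> cycle_at s ^ 2 - 4 * (pair_at 1 s * pair_at 2 s * pair_at 3 s)"
    and "pair_at k s ^ 2 * diag_form a b k z ^ 2 \<le> (cycle_at s ^ 2 - 2 * (pair_at 1 s * pair_at 2 s * pair_at 3 s)) * z $ 3 ^ 2"
    and "pair_at j s ^ 2 * diag_form a b j z ^ 2 \<le> (cycle_at s ^ 2 - 2 * (pair_at 1 s * pair_at 2 s * pair_at 3 s)) * z $ 3 ^ 2"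
proof -
  define l where "l m = diag_form a b m z" for m
  have p: "pair_at 1 s * pair_at 2 s * pair_at 3 s = pair_at i s * (pair_at j s * pair_at k s)"
    using cyc by (cases rule: cycE) (simp_all add: mult_ac)
  have F': "spectral_cubic a b (\<chi> k. pair_at k s) (cycle_at s) z = 0" using F by (simp only: spec_shift)
  have "0 = l i * (l j * l k - pair_at i s * z $ 3 ^ 2) - (pair_at j s * l j + pair_at k s * l k) * z $ 3 ^ 2 + cycle_at s * z $ 3 ^ 3"
    using cyc
    by (cases rule: cycE)
      (use F'[unfolded spectral_cubic_def, folded l_def] in \<open>simp_all add: algebra_simps\<close>)
  then have "(cycle_at s * z $ 3 - (pair_at j s * l j + pair_at k s * l k)) * z $ 3 ^ 2 = 0"
    using minor unfolding l_def[symmetric] by (simp add: algebra_simps power3_eq_cube power2_eq_square)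
  then have e: "cycle_at s * z $ 3 = pair_at j s * l j + pair_at k s * l k" using z3 by simp
  have e2: "(cycle_at s ^ 2 - r * (pair_at i s * (pair_at j s * pair_at k s))) * z $ 3 ^ 2
      = (cycle_at s * z $ 3) ^ 2 - r * (pair_at j s * l j) * (pair_at k s * l k)" for r
  proof -
    have "(cycle_at s ^ 2 - r * (pair_at i s * (pair_at j s * pair_at k s))) * z $ 3 ^ 2
      = (cycle_at s * z $ 3) ^ 2 - r * (pair_at j s * pair_at k s) * (pair_at i s * z $ 3 ^ 2)"
      by (simp add: algebra_simps power2_eq_square)
    then show ?thesis unfolding minor[folded l_def, symmetric] by (simp add: mult_ac)
  qed
  have "(cycle_at s ^ 2 - 4 * (pair_at 1 s * pair_at 2 s * pair_at 3 s)) * z $ 3 ^ 2 = (pair_at j s * l j - pair_at k s * l k) ^ 2"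
    unfolding p e2 e by (simp add: algebra_simps power2_eq_square)
  then have "0 \<le> (cycle_at s ^ 2 - 4 * (pair_at 1 s * pair_at 2 s * pair_at 3 s)) * z $ 3 ^ 2" by simp
  moreover have "z $ 3 ^ 2 > 0" using z3 by simp
  ultimately show "0 \<le> cycle_at s ^ 2 - 4 * (pair_at 1 s * pair_at 2 s * pair_at 3 s)" by (simp add: zero_le_mult_iff)
  have s2: "(cycle_at s ^ 2 - 2 * (pair_at 1 s * pair_at 2 s * pair_at 3 s)) * z $ 3 ^ 2 = (pair_at j s * l j) ^ 2 + (pair_at k s * l k) ^ 2"
    unfolding p e2 e by (simp add: algebra_simps power2_eq_square)
  show "pair_at k s ^ 2 * diag_form a b k z ^ 2 \<le> (cycle_at s ^ 2 - 2 * (pair_at 1 s * pair_at 2 s * pair_at 3 s)) * z $ 3 ^ 2"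
    unfolding s2 l_def[symmetric] by (simp add: power_mult_distrib)
  show "pair_at j s ^ 2 * diag_form a b j z ^ 2 \<le> (cycle_at s ^ 2 - 2 * (pair_at 1 s * pair_at 2 s * pair_at 3 s)) * z $ 3 ^ 2"
    unfolding s2 l_def[symmetric] by (simp add: power_mult_distrib)
qed

end

context smooth_data
begin

lemma pl_continuous: "continuous_on T (pair_at k)" and ell_continuous: "continuous_on T cycle_at"
  unfolding pair_at_def[abs_def] cycle_at_def[abs_def] by (intro continuous_intros)+

text \<open>As long as no \<open>pair_at k\<close> vanishes on the potential well, the curve over the well stays in a bounded part
  of the affine chart \<open>z\<^sub>3 \<noteq> 0\<close>, and it is open and closed in the real part.\<close>

lemma component_over_well:
  assumes well: "lo < hi" "G lo = 0" "G hi = 0" "\<And>x. lo < x \<Longrightarrow> x < hi \<Longrightarrow> G x > 0"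
    and nz: "\<And>k x. lo \<le> x \<Longrightarrow> x \<le> hi \<Longrightarrow> pair_at k x \<noteq> 0"
    and cyc: "cyc i j k"
    and R: "\<And>z. z \<noteq> 0 \<Longrightarrow> point z \<in> R \<longleftrightarrow> spectral_cubic a b c d z = 0"
    and S: "S \<in> components R" "point z0 \<in> S" "z0 \<noteq> 0" "z0 $ 3 \<noteq> 0"
    and s: "lo \<le> s" "s \<le> hi" and minor: "diag_form a b j z0 * diag_form a b k z0 = pair_at i s * z0 $ 3 ^ 2"
  shows "contractible_in_RP2 S"
proof -
  obtain e where e: "e > 0" "\<And>x. lo - e < x \<and> x < lo \<or> hi < x \<and> x < hi + e \<Longrightarrow> G x < 0"
    using neg_outside_well[OF well] by blast
  have "\<exists>K\<ge>0. \<forall>x. lo \<le> x \<longrightarrow> x \<le> hi \<longrightarrow> (cycle_at x ^ 2 - 2 * (pair_at 1 x * pair_at 2 x * pair_at 3 x)) / pair_at m x ^ 2 \<le> K ^ 2" for m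
  proof -
    have "continuous_on {lo..hi} (\<lambda>x. (cycle_at x ^ 2 - 2 * (pair_at 1 x * pair_at 2 x * pair_at 3 x)) / pair_at m x ^ 2)"
      by (intro continuous_intros pl_continuous ell_continuous) (use nz in auto)
    then have "bounded ((\<lambda>x. (cycle_at x ^ 2 - 2 * (pair_at 1 x * pair_at 2 x * pair_at 3 x)) / pair_at m x ^ 2) ` {lo..hi})"
      by (intro compact_imp_bounded compact_continuous_image) auto
    then obtain B where B: "\<forall>x\<in>{lo..hi}. \<bar>(cycle_at x ^ 2 - 2 * (pair_at 1 x * pair_at 2 x * pair_at 3 x)) / pair_at m x ^ 2\<bar> \<le> B"
      unfolding bounded_iff by auto
    have "(cycle_at x ^ 2 - 2 * (pair_at 1 x * pair_at 2 x * pair_at 3 x)) / pair_at m x ^ 2 \<le> sqrt \<bar>B\<bar> ^ 2" if "lo \<le> x" "x \<le> hi" for x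
    proof -
      have "\<bar>(cycle_at x ^ 2 - 2 * (pair_at 1 x * pair_at 2 x * pair_at 3 x)) / pair_at m x ^ 2\<bar> \<le> B" using B that by simp
      then show ?thesis by (simp only: real_sqrt_pow2[OF abs_ge_zero])
    qed
    then show ?thesis by (intro exI[of _ "sqrt \<bar>B\<bar>"]) simp
  qed
  then obtain K where K: "\<And>m. K m \<ge> 0" "\<And>m x. lo \<le> x \<Longrightarrow> x \<le> hi \<Longrightarrow>
      (cycle_at x ^ 2 - 2 * (pair_at 1 x * pair_at 2 x * pair_at 3 x)) / pair_at m x ^ 2 \<le> K m ^ 2" by metis
  define D where "D = gaps a $ i"
  have D: "D \<noteq> 0" using dif_nonzero by (simp add: D_def)
  \<comment> \<open>Solving the minor condition for the parameter: it is \<open>f z\<close> divided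
    by z3^2.\<close>
  define f where "f z = (diag_form a b j z * diag_form a b k z - c $ i * z $ 3 ^ 2) / D" for z :: "real^3"
  have lsc: "diag_form a b m (r *s z) = r * diag_form a b m z" for m r and z :: "real^3" by (simp add: diag_form_def algebra_simps)
  have fsc: "f (r *s z) = r ^ 2 * f z" for r z by (simp add: f_def lsc power_mult_distrib power2_eq_square field_simps)
  have lcont: "continuous_on UNIV (\<lambda>z :: real^3. diag_form a b m z)" for m unfolding diag_form_def by (intro continuous_intros)
  have fcont: "continuous_on UNIV f" unfolding f_def[abs_def] using D by (intro continuous_intros lcont) simp
  have fpl: "diag_form a b j z * diag_form a b k z = pair_at i x * z $ 3 ^ 2 \<longleftrightarrow> f z = x * z $ 3 ^ 2" for z x
    using D unfolding f_def pair_at_def D_def[symmetric] by (auto simp: field_simps)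
  \<comment> \<open>\<open>PA\<close> is an open and \<open>PN\<close> a closed condition, and on
    the curve they agree because \<open>G\<close> is negative in the margins of width
    \<open>e\<close>. The bounds by \<open>K\<close> in \<open>PN\<close> keep the closed set away
    from the line z3 = 0.\<close>
  define PA where "PA z \<longleftrightarrow> (lo - e) * z $ 3 ^ 2 < f z \<and> f z < (hi + e) * z $ 3 ^ 2" for z :: "real^3"
  define PN where "PN z \<longleftrightarrow> \<bar>diag_form a b j z\<bar> \<le> K j * \<bar>z $ 3\<bar> \<and> \<bar>diag_form a b k z\<bar> \<le> K k * \<bar>z $ 3\<bar> \<and>
    lo * z $ 3 ^ 2 \<le> f z \<and> f z \<le> hi * z $ 3 ^ 2" for z :: "real^3"
  have jk: "a $ j \<noteq> a $ k" using cyc dist by (auto elim: cycE)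
  have PAs: "PA (r *s z) \<longleftrightarrow> PA z" if "r \<noteq> 0" for r z
    using that unfolding PA_def fsc by (simp add: power_mult_distrib mult.left_commute)
  have PNs: "PN (r *s z) \<longleftrightarrow> PN z" if "r \<noteq> 0" for r z
    using that unfolding PN_def fsc lsc by (simp add: power_mult_distrib mult.left_commute abs_mult)
  have oA: "open {z. PA z}" unfolding PA_def
    by (intro open_Collect_conj open_Collect_less continuous_intros fcont)
  have oN: "open {z. \<not> PN z}"
  proof -
    have "closed {z. PN z}" unfolding PN_def
      by (intro closed_Collect_conj closed_Collect_le continuous_intros fcont lcont)
    then show ?thesis by (simp add: closed_def Collect_neg_eq)
  qed
  have PN3: "z $ 3 \<noteq> 0" if "PN z" "z \<noteq> 0" for z
  proof
    assume z3: "z $ 3 = 0"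
    then have "diag_form a b j z = 0" "diag_form a b k z = 0" using that(1) by (simp_all add: PN_def)
    then have "a $ j * z $ 1 = z $ 2" "a $ k * z $ 1 = z $ 2" using z3 by (simp_all add: diag_form_def)
    moreover from this have "(a $ j - a $ k) * z $ 1 = 0" by (simp add: left_diff_distrib)
    ultimately have "z $ 1 = 0" "z $ 2 = 0" using jk by auto
    then show False using that(2) z3 by (simp add: vec_eq_iff forall_3)
  qed
  have key: "PA z \<longleftrightarrow> PN z" if z: "z \<noteq> 0" "spectral_cubic a b c d z = 0" for z
  proof
    assume PA: "PA z"
    then have z3: "z $ 3 \<noteq> 0" by (auto simp: PA_def)
    then have z32: "z $ 3 ^ 2 > 0" by simp
    define x where "x = f z / z $ 3 ^ 2"
    have x: "f z = x * z $ 3 ^ 2" using z3 by (simp add: x_def)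
    note cs = conic_square[OF z3 z(2) cyc, of x, unfolded fpl, OF x]
    have "lo - e < x" "x < hi + e" using PA z32 unfolding PA_def x by auto
    moreover have "0 \<le> G x" using cs(1) by (simp add: pot_eq)
    ultimately have xr: "lo \<le> x" "x \<le> hi" using e(2)[of x] by argo+
    have bd: "\<bar>diag_form a b m z\<bar> \<le> K m * \<bar>z $ 3\<bar>"
      if "pair_at m x ^ 2 * diag_form a b m z ^ 2 \<le> (cycle_at x ^ 2 - 2 * (pair_at 1 x * pair_at 2 x * pair_at 3 x)) * z $ 3 ^ 2" for m
    proof -
      have pm: "pair_at m x ^ 2 > 0" using nz[OF xr, of m] by simp
      have "diag_form a b m z ^ 2 \<le> (cycle_at x ^ 2 - 2 * (pair_at 1 x * pair_at 2 x * pair_at 3 x)) / pair_at m x ^ 2 * z $ 3 ^ 2"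
        using that pm by (simp add: field_simps)
      also have "\<dots> \<le> K m ^ 2 * z $ 3 ^ 2" using K(2)[OF xr, of m] z32 by (intro mult_right_mono) auto
      also have "\<dots> = (K m * \<bar>z $ 3\<bar>) ^ 2" by (simp add: power_mult_distrib)
      finally have "\<bar>diag_form a b m z\<bar> ^ 2 \<le> (K m * \<bar>z $ 3\<bar>) ^ 2" by simp
      then show ?thesis by (rule power2_le_imp_le) (simp add: K(1))
    qed
    show "PN z" unfolding PN_def x using bd[OF cs(2)] bd[OF cs(3)] xr z32 by simp
  next
    assume PN: "PN z"
    have "z $ 3 ^ 2 > 0" using PN3[OF PN z(1)] by simp
    then have "(lo - e) * z $ 3 ^ 2 < lo * z $ 3 ^ 2" "hi * z $ 3 ^ 2 < (hi + e) * z $ 3 ^ 2" using e(1) by simp_all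
    then show "PA z" using PN unfolding PA_def PN_def by linarith
  qed
  define A where "A = {point w |w. w \<noteq> 0 \<and> PA w}"
  define B where "B = {point w |w. w \<noteq> 0 \<and> \<not> PN w}"
  have inA: "point z \<in> A \<longleftrightarrow> PA z" if "z \<noteq> 0" for z
    unfolding A_def by (rule homogeneous_set[OF PAs that])
  have inB: "point z \<in> B \<longleftrightarrow> \<not> PN z" if "z \<noteq> 0" for z
    unfolding B_def by (rule homogeneous_set[OF _ that]) (simp add: PNs)
  have RAB: "p \<in> A \<longleftrightarrow> p \<notin> B" if p: "p \<in> R" for p
  proof -
    obtain z where z: "z \<noteq> 0" "p = point z" by (rule point_cases)
    then have "spectral_cubic a b c d z = 0" using p R by simp
    then show ?thesis unfolding z(2) inA[OF z(1)] inB[OF z(1)] using key z(1) by simp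
  qed
  have "PA z0"
  proof -
    have "f z0 = s * z0 $ 3 ^ 2" using minor fpl by simp
    moreover have "z0 $ 3 ^ 2 > 0" using S(4) by simp
    ultimately show ?thesis using s e(1) by (simp add: PA_def)
  qed
  then have zA: "point z0 \<in> A" using inA[OF S(3)] by simp
  have oA': "open A" unfolding A_def by (rule open_homogeneous_set[OF PAs oA])
  have oB': "open B" unfolding B_def by (rule open_homogeneous_set[OF _ oN]) (simp add: PNs)
  have "R \<subseteq> A \<union> B" "A \<inter> B \<inter> R = {}" using RAB by blast+
  then have SA: "S \<subseteq> A" by (rule component_clopen[OF S(1) oA' oB' _ _ S(2) zA])
  show ?thesis
  proof (rule contractible_in_RP2_affine)
    fix p assume "p \<in> S"
    then obtain w where w: "p = point w" "PA w" using SA unfolding A_def by auto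
    then have "w $ 3 \<noteq> 0" by (auto simp: PA_def)
    then show "\<exists>z. z $ 3 \<noteq> 0 \<and> p = point z" using w(1) by auto
  qed
qed

end

lemma zero_between_rising_zeros:
  fixes f :: "real \<Rightarrow> real"
  assumes lt: "t0 < t1" and f: "\<And>t. isCont f t" and z: "f t0 = 0" "f t1 = 0"
    and d: "(f has_real_derivative p) (at t0)" "(f has_real_derivative q) (at t1)" "0 < p" "0 < q"
  shows "\<exists>u. t0 < u \<and> u < t1 \<and> f u = 0"
proof -
  obtain r where r: "r > 0" "\<And>h. 0 < h \<Longrightarrow> h < r \<Longrightarrow> f (t0 + h) > 0"
    using DERIV_pos_inc_right[OF d(1,3)] z by auto
  obtain r' where r': "r' > 0" "\<And>h. 0 < h \<Longrightarrow> h < r' \<Longrightarrow> f (t1 - h) < 0"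
    using DERIV_pos_inc_left[OF d(2,4)] z by auto
  define h where "h = min (min r r') ((t1 - t0) / 2) / 2"
  have h: "0 < h" "h < r" "h < r'" "2 * h < t1 - t0"
  proof -
    have "2 * h \<le> (t1 - t0) / 2"
      using min.cobounded2[of "min r r'" "(t1 - t0) / 2"] by (simp only: h_def)
    then show "2 * h < t1 - t0" using lt by argo
    show "0 < h" "h < r" "h < r'" using r(1) r'(1) lt by (auto simp: h_def)
  qed
  have "\<exists>u. t0 + h \<le> u \<and> u \<le> t1 - h \<and> f u = 0"
    by (rule IVT2) (use r(2)[of h] r'(2)[of h] h f in auto)
  then show ?thesis using h(1) by force
qed

lemma conj_by_commute: "conj_by e (conj_by f X) = conj_by f (conj_by e X)"
  by (simp add: conj_by_def vec_eq_iff mult_ac)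

lemma cyc_exists: "\<exists>j k. cyc i j k"
  using exhaust_3[of i] unfolding cyc_def by auto

lemma cyc_distinct: "cyc i j k \<Longrightarrow> i \<noteq> j \<and> i \<noteq> k \<and> j \<noteq> k"
  by (erule cycE) simp_all

section \<open>Ovals of the vertices and signs of the conjugating matrix\<close>

context smooth_data
begin

lemma fit_transpose: "fit X s \<Longrightarrow> fit (transpose X) s"
proof -
  assume "fit X s"
  moreover have "pair_products (transpose X) = pair_products X" "cycle_sum (transpose X) = cycle_sum X"
    by (simp_all add: pair_products_def cycle_sum_def transpose_def mult_ac)
  moreover have "transpose X $ k $ k = X $ k $ k" for k by (simp add: transpose_def)
  ultimately show ?thesis by (simp add: fit_def)
qed

lemma vertex:
  assumes f: "fit X s" and ijk: "i \<noteq> j" "i \<noteq> k" "j \<noteq> k"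
  shows "P_vertex (diag a) X i = point (P_lift a X i j k)" "P_lift a X i j k \<noteq> 0"
    "spectral_cubic a b c d (P_lift a X i j k) = 0"
proof -
  note irr = irreducible(2)[OF f ijk] irreducible(1)[OF f, of j i k] irreducible(1)[OF f, of k i j]
  show "P_vertex (diag a) X i = point (P_lift a X i j k)"
    by (rule P_vertex_eq) (use irr ijk dist in auto)
  show "P_lift a X i j k \<noteq> 0"
    by (rule P_lift_nonzero) (use irr ijk dist in auto)
  show "spectral_cubic a b c d (P_lift a X i j k) = 0"
    using P_lift_on_curve[OF ijk dist[OF ijk(3)], of X] unfolding fit_spec[OF f] .
qed

text \<open>At the lift of P_i the diagonal entries j and k multiply to x_jk x_kj z3^2, so the point
  lies over the parameter of the matrix itself, which is in the well.\<close>

lemma vertex_component_contractible: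
  assumes well: "lo < hi" "G lo = 0" "G hi = 0" "\<And>x. lo < x \<Longrightarrow> x < hi \<Longrightarrow> G x > 0"
    and nz: "\<And>k x. lo \<le> x \<Longrightarrow> x \<le> hi \<Longrightarrow> pair_at k x \<noteq> 0"
    and R: "\<And>z. z \<noteq> 0 \<Longrightarrow> point z \<in> R \<longleftrightarrow> spectral_cubic a b c d z = 0"
    and f: "fit X s" and s: "lo \<le> s" "s \<le> hi"
    and S: "S \<in> components R" "P_vertex (diag a) X i \<in> S"
  shows "contractible_in_RP2 S"
proof -
  obtain j k where cyc: "cyc i j k" using cyc_exists by blast
  have ijk: "i \<noteq> j" "i \<noteq> k" "j \<noteq> k" using cyc_distinct[OF cyc] by auto
  note v = vertex[OF f ijk]
  note co = P_lift_coords[OF dist[OF ijk(3)], of X i]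
  have l: "diag_form a b m z = diag_entry a X m z" for m z by (rule dg_eq_lin[symmetric]) (rule fitD(1)[OF f])
  have c2: "cyc j k i" "cyc k i j" using cyc by (auto simp: cyc_def)
  have "X $ j $ i \<noteq> 0" "X $ k $ i \<noteq> 0"
    using fit_cyc(1)[OF f cyc] fit_cyc(1)[OF f c2(2)] nz[OF s] by (metis mult_zero_left mult_zero_right)+
  then have z3: "P_lift a X i j k $ 3 \<noteq> 0" unfolding co(1) by simp
  have m: "diag_form a b j (P_lift a X i j k) * diag_form a b k (P_lift a X i j k) = pair_at i s * P_lift a X i j k $ 3 ^ 2"
    unfolding l co fit_cyc(1)[OF f c2(1), symmetric] by (simp add: power2_eq_square)
  show ?thesis
    by (rule component_over_well[OF well nz cyc R S(1) _ v(2) z3 s m]) (use S(2) v(1) in simp_all)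
qed

lemma vertex_component_not_contractible:
  assumes X: "flow_solution (diag a) X" and f: "\<And>t. fit (X t) (s t)"
    and T: "0 < T" and e: "\<forall>i. e $ i \<noteq> 0" and per: "\<And>t. X (t + T) = conj_by e (X t)"
    and ijk: "i \<noteq> j" "i \<noteq> k" "j \<noteq> k" and neg: "e $ j * e $ k < 0"
    and R: "\<And>z. z \<noteq> 0 \<Longrightarrow> point z \<in> R \<longleftrightarrow> spectral_cubic a b c d z = 0"
    and S: "S \<in> components R" "P_vertex (diag a) (X t) i \<in> S"
  shows "\<not> contractible_in_RP2 S"
proof -
  define z where "z u = P_lift a (X (t + u)) i j k" for u
  note v = vertex[OF f ijk]
  have contX: "continuous_on UNIV (\<lambda>u. X (t + u) $ m $ n)" for m n
  proof -
    have "isCont X u" for u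
      using X has_vector_derivative_continuous unfolding flow_solution_def by blast
    then have "continuous_on UNIV X" by (simp add: continuous_at_imp_continuous_on)
    then have "continuous_on UNIV (\<lambda>u. X (t + u))"
      by (rule continuous_on_compose2) (auto intro!: continuous_intros)
    then show ?thesis by (intro continuous_on_component)
  qed
  have contz: "continuous_on UNIV z" unfolding z_def
    by (rule continuous_on_P_lift[OF contX dist[OF ijk(3)]])
  have z0: "z u \<noteq> 0" for u unfolding z_def by (rule v(2))
  have "continuous_on {0..T} (\<lambda>u. point (z u))"
    by (rule continuous_on_compose2[OF continuous_on_point continuous_on_subset[OF contz]]) (use z0 in auto)
  then have "connected ((\<lambda>u. point (z u)) ` {0..T})" by (rule connected_continuous_image) simp
  moreover have "(\<lambda>u. point (z u)) ` {0..T} \<subseteq> R" using R[OF z0] v(3) unfolding z_def by auto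
  moreover have "point (z 0) \<in> S" using S(2) v(1)[of t] by (simp add: z_def)
  then have "S \<inter> (\<lambda>u. point (z u)) ` {0..T} \<noteq> {}" using T by auto
  ultimately have sub: "(\<lambda>u. point (z u)) ` {0..T} \<subseteq> S" by (intro components_maximal[OF S(1)])
  show ?thesis
  proof (rule orientation_reversing_not_contractible)
    show "z T = (e $ j * e $ k / e $ i ^ 2) *s z 0"
      unfolding z_def per using P_lift_conj_by[OF dist[OF ijk(3)] e] by simp
    show "e $ j * e $ k / e $ i ^ 2 < 0" using neg e by (simp add: divide_neg_pos)
    show "continuous_on {0..T} z" by (rule continuous_on_subset[OF contz]) simp
    show "0 \<le> T" using T by simp
    show "point (z u) \<in> S" if "u \<in> {0..T}" for u using sub that by blast
  qed (rule z0)
qed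

text \<open>If \<open>pair_at k\<close> vanishes on the well, the entry \<open>(i, j)\<close> has exactly one zero per period, and that
  zero is simple.\<close>

lemma entry_sign_change:
  assumes X: "flow_solution (diag a) X" and f: "\<And>t. fit (X t) (s t)"
    and o: "osc s (\<lambda>t. cycle_diff (X t)) lo hi T t0"
    and e: "\<forall>i. e $ i \<noteq> 0" and per: "\<And>t. X (t + T) = conj_by e (X t)"
    and x: "lo \<le> x" "x \<le> hi" "pair_at k x = 0" and cyc: "cyc i j k"
  shows "e $ i * e $ j < 0"
proof (rule ccontr)
  assume "\<not> e $ i * e $ j < 0"
  then have pos: "e $ i / e $ j > 0" using e by (simp add: zero_less_divide_iff mult_less_0_iff) (metis linorder_neqE_linordered_idom)
  have ijk: "i \<noteq> j" "i \<noteq> k" "j \<noteq> k" using cyc_distinct[OF cyc] by auto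
  have T: "T > 0" using o by (simp add: osc_def)
  have "pair_at 1 x * pair_at 2 x * pair_at 3 x = 0" using x(3) exhaust_3[of k] by auto
  then have "(- cycle_at x) ^ 2 = G x" by (simp add: pot_eq)
  \<comment> \<open>As \<open>pair_at k x\<close> is 0, the phase point with velocity
    \<open>- cycle_at x\<close> lies on the phase curve, and it is the only one at which the entry
    (i, j) vanishes.\<close>
  then obtain t where t: "s t = x" "cycle_diff (X t) = - cycle_at x" using o x(1,2) unfolding osc_def by blast
  define w where "w u = X u $ i $ j" for u
  have w0: "w u = 0 \<longleftrightarrow> s u = x \<and> cycle_diff (X u) = - cycle_at x" for u
  proof -
    have "pair_at k (s u) = 0 \<longleftrightarrow> s u = x"
    proof -
      have "pair_at k (s u) = pair_at k x + gaps a $ k * (s u - x)" by (simp add: pair_at_def algebra_simps)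
      then show ?thesis using x(3) dif_nonzero[of k] by simp
    qed
    then show ?thesis unfolding w_def entry_zero_iff(1)[OF f cyc] by auto
  qed
  have wp: "w (u + T) = e $ i / e $ j * w u" for u unfolding w_def per by (simp add: conj_by_def)
  define D where "D u = (a $ j - a $ i) * (w u * (X u $ i $ i + X u $ j $ j) + X u $ i $ k * X u $ k $ j)" for u
  have der: "(w has_real_derivative D u) (at u)" for u
    unfolding w_def D_def by (rule flow_component[OF X ijk])
  have wt: "w t = 0" using w0 t by simp
  \<comment> \<open>At a zero of the entry (i, j) the derivative is a nonzero multiple of x_ik x_kj,
    whose factors share its row and its column and so cannot vanish.\<close>
  have Dt: "D t \<noteq> 0"
    unfolding D_def wt using irreducible(1)[OF f ijk, of t] irreducible(2)[OF f, of j i k t] ijk dist[OF ijk(1)] wt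
    by (auto simp: w_def)
  have DT: "D (t + T) = e $ i / e $ j * D t"
  proof -
    have "((\<lambda>u. w (u + T)) has_real_derivative D (t + T)) (at t)" using der[of "t + T"] by (simp add: DERIV_shift)
    moreover have "((\<lambda>u. w (u + T)) has_real_derivative e $ i / e $ j * D t) (at t)"
      unfolding wp by (rule DERIV_cmult[OF der])
    ultimately show ?thesis by (rule DERIV_unique)
  qed
  \<comment> \<open>Another zero would be an early return to the same phase point. Yet a positive
    factor \<open>e $ i / e $ j\<close> makes the slopes at t and t + T agree in sign, which forces
    a zero in between.\<close>
  have no: "\<not> (t < u \<and> u < t + T \<and> w u = 0)" for u
  proof
    assume u: "t < u \<and> u < t + T \<and> w u = 0"
    then have "s (t + (u - t)) = s t \<and> cycle_diff (X (t + (u - t))) = cycle_diff (X t)" using w0[of u] t by simp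
    moreover have "0 < u - t" "u - t < T" using u by auto
    ultimately show False using o unfolding osc_def by blast
  qed
  have wT: "w (t + T) = 0" using wp wt by simp
  show False
  proof (cases "D t > 0")
    case True
    then have "D (t + T) > 0" unfolding DT using pos by (rule mult_pos_pos[rotated])
    from zero_between_rising_zeros[OF _ DERIV_isCont[OF der] wt wT der der True this] T no show False by auto
  next
    case False
    then have "D t < 0" using Dt by simp
    then have m: "- D t > 0" "- D (t + T) > 0" unfolding DT using mult_pos_neg[OF pos] by auto
    from zero_between_rising_zeros[of t "t + T" "\<lambda>u. - w u", OF _ isCont_minus[OF DERIV_isCont[OF der]] _ _ DERIV_minus[OF der] DERIV_minus[OF der] m]
    show False using T no wt wT by auto
  qed
qed

end

section \<open>The common period and conjugating class, and the hexagon type\<close>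

lemma PD3_coset_in_carrier:
  assumes "\<forall>i. e $ i \<noteq> 0"
  shows "scalars3 #>\<^bsub>D3\<^esub> diag e \<in> carrier PD3"
  unfolding PD3_def FactGroup_def RCOSETS_def using diag_in_D3[OF assms] by auto

lemma length_filter_eq_imp_all:
  assumes "length (filter P xs) = length xs" "x \<in> set xs"
  shows "P x"
  using length_filter_less[of x xs P] assms by auto

theorem theorem2p16:
  fixes a :: "real^3" and C :: "complex proj2 set"
  assumes "\<forall>i j. i \<noteq> j \<longrightarrow> a $ i \<noteq> a $ j"
    and "smooth_real_cubic C"
    and "\<forall>i. point (vector [1, complex_of_real (a $ i), 0]) \<in> C"
    and "card (ovals C) = 2"
  shows "\<exists>T::real. T > 0 \<and> (\<exists>M \<in> carrier PD3.
           \<forall>X. flow_solution (diag a) X \<and> (\<forall>t. X t \<in> isospectral (diag a) C) \<longrightarrow>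
             (\<forall>t. hexagon (diag a) (X (t + T)) = hexagon (diag a) (X t)) \<and>
             (\<forall>t. X (t + T) = PD3_act M (X t)) \<and>
             (\<forall>t. hexagon_type (diag a) (X t) = (6, 0) \<longrightarrow> M \<in> PD3_plus) \<and>
             (\<forall>t. hexagon_type (diag a) (X t) = (2, 4) \<longrightarrow> M \<notin> PD3_plus))"
proof (cases "\<exists>X. flow_solution (diag a) X \<and> (\<forall>t. X t \<in> isospectral (diag a) C)")
  case False
  \<comment> \<open>Without a global solution the claim is vacuous, and T = 1 with the identity
    class will do.\<close>
  have "scalars3 #>\<^bsub>D3\<^esub> diag (\<chi> i. 1) \<in> carrier PD3" by (rule PD3_coset_in_carrier) simp
  then show ?thesis using False by (intro exI[of _ 1] conjI bexI) auto
next
  case True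
  then obtain X0 where X0: "flow_solution (diag a) X0" and iso0: "\<And>t. X0 t \<in> isospectral (diag a) C" by blast
  define b where "b = (\<chi> k. X0 0 $ k $ k)"
  define c where "c = pair_products (X0 0)"
  define d where "d = cycle_sum (X0 0)"
  interpret spec_data a b c d by unfold_locales (use assms(1) in blast)
  have C: "C = {point z |z. z \<noteq> 0 \<and> spectral_cubic a b c d z = 0}"
    using iso0[of 0] unfolding isospectral_def spectral_curve_def det_pencil_eq_spec b_def c_def d_def by simp
  interpret smooth_data a b c d
    by unfold_locales (use smooth_imp_nondeg assms(2) C in blast)
  have fits: "\<exists>s. \<forall>t. fit (X t) (s t)" if "\<And>t. X t \<in> isospectral (diag a) C" for X :: "real \<Rightarrow> real^3^3"
  proof -
    have "\<exists>s. fit (X t) s" for t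
      by (rule fit_exists) (use that[of t] C in \<open>simp add: isospectral_def\<close>)
    then show ?thesis by metis
  qed
  obtain s0 where s0: "\<And>t. fit (X0 t) (s0 t)" using fits[of X0, OF iso0] by blast
  define y0 where "y0 t = cycle_diff (X0 t)" for t
  have sol0: "sol s0 y0" unfolding y0_def by (rule flow_sol[OF X0 s0])
  obtain lo hi T t0 where o: "osc s0 y0 lo hi T t0" using sol_osc[OF sol0] by blast
  have T: "T > 0" and per0: "\<And>t. s0 (t + T) = s0 t" "\<And>t. y0 (t + T) = y0 t"
    and range0: "\<And>t. lo \<le> s0 t \<and> s0 t \<le> hi"
    and well: "lo < hi" "G lo = 0" "G hi = 0" "\<And>x. lo < x \<Longrightarrow> x < hi \<Longrightarrow> G x > 0"
    using o by (simp_all add: osc_def)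
  have "\<exists>e. (\<forall>i. e $ i \<noteq> 0) \<and> X0 (0 + T) = conj_by e (X0 0)"
    by (rule fit_gauge[OF s0, of "X0 (0 + T)" 0]) (use s0[of "0 + T"] per0[of 0] in \<open>simp_all add: y0_def\<close>)
  then obtain e where e: "\<forall>i. e $ i \<noteq> 0" and e0: "X0 (0 + T) = conj_by e (X0 0)" by blast
  have perX0: "X0 (t + T) = conj_by e (X0 t)" for t
    by (rule flow_unique[OF flow_shift[OF X0, of T] flow_conj_by[OF X0 e] e0])
  define M where "M = scalars3 #>\<^bsub>D3\<^esub> diag e"
  have act: "PD3_act M Y = conj_by e Y" for Y unfolding M_def by (rule PD3_act_conj_by[OF e])
  have "(\<forall>t. hexagon (diag a) (X (t + T)) = hexagon (diag a) (X t)) \<and>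
             (\<forall>t. X (t + T) = PD3_act M (X t)) \<and>
             (\<forall>t. hexagon_type (diag a) (X t) = (6, 0) \<longrightarrow> M \<in> PD3_plus) \<and>
             (\<forall>t. hexagon_type (diag a) (X t) = (2, 4) \<longrightarrow> M \<notin> PD3_plus)"
    if X: "flow_solution (diag a) X" and iso: "\<And>t. X t \<in> isospectral (diag a) C" for X
  proof -
    obtain s where s: "\<And>t. fit (X t) (s t)" using fits[of X, OF iso] by blast
    obtain \<tau> where \<tau>: "\<And>t. s t = s0 (t + \<tau>)" "\<And>t. cycle_diff (X t) = y0 (t + \<tau>)"
      using sol_translate[OF sol0 o flow_sol[OF X s]] by blast
    have "\<exists>f. (\<forall>i. f $ i \<noteq> 0) \<and> X 0 = conj_by f (X0 (0 + \<tau>))"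
      by (rule fit_gauge[OF s0]) (use s[of 0] \<tau>[of 0] in \<open>simp_all add: y0_def\<close>)
    then obtain f where f: "\<forall>i. f $ i \<noteq> 0" "X 0 = conj_by f (X0 (0 + \<tau>))" by blast
    have Xt: "X t = conj_by f (X0 (t + \<tau>))" for t
      by (rule flow_unique[OF X flow_conj_by[OF flow_shift[OF X0] f(1)] f(2)])
    \<comment> \<open>The conjugations by \<open>e\<close> and \<open>f\<close> commute, so the
      class of \<open>e\<close> does not depend on the solution.\<close>
    have perX: "X (t + T) = conj_by e (X t)" for t
      using perX0[of "t + \<tau>"] unfolding Xt by (simp add: conj_by_commute add_ac)
    have range: "lo \<le> s t" "s t \<le> hi" for t using range0 \<tau>(1) by simp_all
    have curve: "spectral_curve (diag a) (X t) = C" for t using iso[of t] by (simp add: isospectral_def)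
    have R: "point z \<in> real_part C \<longleftrightarrow> spectral_cubic a b c d z = 0" if "z \<noteq> 0" for z
      using point_in_real_part_iff[OF that, of a "X 0"] unfolding curve fit_spec[OF s] .
    have six: "M \<in> PD3_plus" if type: "hexagon_type (diag a) (X t) = (6, 0)" for t
    proof (rule ccontr)
      assume "M \<notin> PD3_plus"
      then have "\<not> (\<forall>i. e $ i > 0)" "\<not> (\<forall>i. e $ i < 0)" unfolding M_def PD3_plus_def by blast+
      then obtain j k where "e $ j < 0" "e $ k > 0" using e by (meson linorder_neqE_linordered_idom)
      then have jk: "e $ j * e $ k < 0" "j \<noteq> k" by (auto simp: mult_neg_pos)
      \<comment> \<open>Opposite signs at j and k affect the lift of the vertex with the remaining
        index.\<close>
      define i where "i = - (j + k)"
      have "card {j, k, i} = 3" using third_index[OF jk(2)] by (simp add: i_def)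
      then have ijk: "i \<noteq> j" "i \<noteq> k" using jk(2) by (auto simp: card_insert_if split: if_splits)
      have "length (filter (\<lambda>p. \<exists>S\<in>ovals C. contractible_in_RP2 S \<and> p \<in> S) (hexagon (diag a) (X t)))
          = length (hexagon (diag a) (X t))"
        using type unfolding hexagon_type_def Let_def curve by (simp add: hexagon_def)
      moreover have "P_vertex (diag a) (X t) i \<in> set (hexagon (diag a) (X t))"
        using exhaust_3[of i] by (auto simp: hexagon_def)
      ultimately have "\<exists>S\<in>ovals C. contractible_in_RP2 S \<and> P_vertex (diag a) (X t) i \<in> S"
        by (rule length_filter_eq_imp_all)
      then obtain S where "S \<in> components (real_part C)" "contractible_in_RP2 S" "P_vertex (diag a) (X t) i \<in> S"
        unfolding ovals_def by blast
      then show False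
        using vertex_component_not_contractible[OF X s T e perX ijk jk(2,1) R] by blast
    qed
    have two: "M \<notin> PD3_plus" if type: "hexagon_type (diag a) (X t) = (2, 4)" for t
    proof
      assume "M \<in> PD3_plus"
      then obtain e' where e': "M = scalars3 #>\<^bsub>D3\<^esub> diag e'" "(\<forall>i. e' $ i > 0) \<or> (\<forall>i. e' $ i < 0)"
        unfolding PD3_plus_def by blast
      then have e'0: "\<forall>i. e' $ i \<noteq> 0" by (metis less_irrefl)
      have "conj_by e' Y = conj_by e Y" for Y
        using act[of Y] PD3_act_conj_by[OF e'0, of Y] e'(1) by simp
      \<comment> \<open>Membership of \<open>M\<close> only provides some representative of one
        sign. It acts as \<open>e\<close> does, so it may replace \<open>e\<close> in the
        periodicity.\<close>
      then have perX0': "X0 (t + T) = conj_by e' (X0 t)" for t using perX0 by simp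
      have nz: "pair_at k x \<noteq> 0" if "lo \<le> x" "x \<le> hi" for k x
      proof
        assume "pair_at k x = 0"
        obtain i j where "cyc i j k" using exhaust_3[of k] unfolding cyc_def by auto
        then have "e' $ i * e' $ j < 0"
          using entry_sign_change[OF X0 s0 o[unfolded y0_def] e'0 perX0' that \<open>pair_at k x = 0\<close>] by blast
        moreover have "e' $ i * e' $ j > 0" using e'(2) by (auto simp: mult_neg_neg)
        ultimately show False by simp
      qed
      have con: "contractible_in_RP2 S" if S: "S \<in> ovals C" "p \<in> S" and p: "p \<in> set (hexagon (diag a) (X t))" for p S
      proof -
        obtain i where "p = P_vertex (diag a) (X t) i \<or> p = P_vertex (diag a) (transpose (X t)) i"
          using p by (auto simp: hexagon_def Q_vertex_transpose)
        then show ?thesis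
          using vertex_component_contractible[OF well nz R s range, of S t i]
            vertex_component_contractible[OF well nz R fit_transpose[OF s] range, of S t i] S
          unfolding ovals_def by blast
      qed
      have "filter (\<lambda>p. \<exists>S\<in>ovals C. \<not> contractible_in_RP2 S \<and> p \<in> S) (hexagon (diag a) (X t)) = []"
        unfolding filter_empty_conv using con by blast
      then show False using type unfolding hexagon_type_def Let_def curve by simp
    qed
    show ?thesis using six two perX hexagon_conj_by[OF e] act by simp
  qed
  then show ?thesis using T PD3_coset_in_carrier[OF e] unfolding M_def[symmetric] by blast
qed

end
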